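(* Let $\acute N$ be a screen transversal anti-invariant lightlike submanifold of a locally metallic semi-Riemannian manifold $(\breve N,\breve g,\breve J)$. Then the induced connection $\nabla$ on $\acute N$ is a metric connection if and only if $$B_2\nabla^s_W\breve J\xi=0$$ for all $W\in\Gamma(T\acute N)$ and $\xi\in\Gamma(Rad(T\acute N))$.
   Context: Fix positive integers $p,q$. A metallic semi-Riemannian manifold $(\breve N,\breve g,\breve J)$ is a semi-Riemannian manifold $(\breve N,\breve g)$ with a $(1,1)$-tensor field $\breve J$ such that $\breve J^2=p\breve J+qI$ and $\breve g(\breve JW,U)=\breve g(W,\breve JU)$ for all vector fields $W,U$ on $\breve N$. It is locally metallic if $\breve\nabla\breve J=0$, i.e. $\breve\nabla_W\breve JU=\breve J\breve\nabla_WU$, where $\breve\nabla$ is the Levi-Civita connection of $\breve g$. A submanifold $\acute N$ of dimension $m$ in $\breve N$ is lightlike if the metric $g$ induced from $\breve g$ is degenerate and $Rad(T\acute N)=T\acute N\cap T\acute N^{\perp}$ is a distribution of constant rank $r$, $1\le r\le m$. Fix a screen distribution $S(T\acute N)$ (non-degenerate complement of $Rad(T\acute N)$ in $T\acute N$), a screen transversal bundle $S(T\acute N^{\perp})$ (non-degenerate complement of $Rad(T\acute N)$ in $T\acute N^{\perp}$), and the associated lightlike transversal bundle $ltr(T\acute N)$: it is orthogonal to $S(T\acute N)$ and $S(T\acute N^\perp)$, and for any local basis $\{\xi_i\}$ of $Rad(T\acute N)$ it is locally spanned by $\{N_i\}$ with $\breve g(\xi_i,N_j)=\delta_{ij}$,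 $\breve g(N_i,N_j)=0$. With $\oplus_{ort}$ denoting orthogonal direct sum, $T\breve N|_{\acute N}=S(T\acute N)\oplus_{ort}[Rad(T\acute N)\oplus ltr(T\acute N)]\oplus_{ort}S(T\acute N^{\perp})$. For $W,U\in\Gamma(T\acute N)$ and $Z\in\Gamma(S(T\acute N^\perp))$ write $\breve\nabla_WU=\nabla_WU+h^{\ell}(W,U)+h^s(W,U)$ and $\breve\nabla_WZ=-A_ZW+\nabla^s_WZ+D^{\ell}(W,Z)$, where $\nabla_WU,A_ZW\in\Gamma(T\acute N)$, $h^\ell(W,U),D^\ell(W,Z)\in\Gamma(ltr(T\acute N))$ and $h^s(W,U),\nabla^s_WZ\in\Gamma(S(T\acute N^\perp))$. $\nabla$ is the induced connection; it is a metric connection if $\nabla g=0$. $\acute N$ is screen transversal anti-invariant if $\breve J\,Rad(T\acute N)\subset S(T\acute N^{\perp})$ and $\breve J\,S(T\acute N)\subset S(T\acute N^{\perp})$. Throughout, $\breve J\,ltr(T\acute N)\subset S(T\acute N^\perp)$ as well, and $S(T\acute N^\perp)=\{\breve J Rad(T\acute N)\oplus\breve J\,ltr(T\acute N)\oplus\breve J S(T\acute N)\}\oplus_{ort}D_o$, where $D_o$ is the non-degenerate orthogonal complement. Let $T_2$ be the projection of $S(T\acute N^\perp)$ onto $\breve J S(T\acute N)$ with respect to this decomposition. For $U\in\Gamma(S(T\acute N^\perp))$, $\breve J T_2U$ lies in $S(T\acute N)\oplus\breve JS(T\acute N)$, and $B_2U$ denotes its component in $S(T\acute N)$; thus $B_2U$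 is the $S(T\acute N)$-component of $\breve JU$. *)

theory Defs
  imports
    "HOL-Analysis.Analysis"
    "HOL-Library.Function_Algebras"
    "HOL-Library.Set_Algebras"
begin

text \<open>
  Tangent vectors are represented below by their families of components, one for each chart, so
  the pointwise vector space structure on functions is needed.  On sets, \<open>A + B\<close> is the Minkowski
  sum of \<^theory>\<open>HOL-Library.Set_Algebras\<close>.
\<close>

instantiation "fun" :: (type, real_vector) real_vector
begin

definition scaleR_fun :: "real \<Rightarrow> ('a \<Rightarrow> 'b) \<Rightarrow> 'a \<Rightarrow> 'b"
  where "scaleR_fun r f = (\<lambda>x. r *\<^sub>R f x)"

instance
  by standard (simp_all add: scaleR_fun_def fun_eq_iff algebra_simps)

end

section \<open>Smooth manifolds\<close>

text \<open>These two notions are used for open \<open>S\<close> only.\<close>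

primrec Ck_on :: "nat \<Rightarrow> 'b::euclidean_space set \<Rightarrow> ('b \<Rightarrow> 'c::real_normed_vector) \<Rightarrow> bool"
  where
    "Ck_on 0 S f \<longleftrightarrow> continuous_on S f"
  | "Ck_on (Suc k) S f \<longleftrightarrow>
       f differentiable_on S \<and> (\<forall>v. Ck_on k S (\<lambda>u. frechet_derivative f (at u) v))"

definition smooth_on :: "'b::euclidean_space set \<Rightarrow> ('b \<Rightarrow> 'c::real_normed_vector) \<Rightarrow> bool"
  where "smooth_on S f \<longleftrightarrow> (\<forall>k. Ck_on k S f)"

text \<open>
  A chart is a pair of a domain and a coordinate map.  A manifold carries its own topology on a
  subset of the point type, so that a submanifold of \<open>M\<close> can live on a subset of the points of \<open>M\<close>
  with a topology that may be finer than the subspace topology.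
\<close>

type_synonym ('a, 'e) chart = "'a set \<times> ('a \<Rightarrow> 'e)"

definition chart_inv :: "('a, 'e) chart \<Rightarrow> 'e \<Rightarrow> 'a"
  where "chart_inv c = inv_into (fst c) (snd c)"

record ('a, 'e) mfd =
  mtop :: "'a topology"
  atlas :: "('a, 'e) chart set"

abbreviation points :: "('a, 'e) mfd \<Rightarrow> 'a set"
  where "points M \<equiv> topspace (mtop M)"

definition smooth_manifold :: "('a, 'e::euclidean_space) mfd \<Rightarrow> bool"
  where "smooth_manifold M \<longleftrightarrow>
    Hausdorff_space (mtop M) \<and> second_countable (mtop M) \<and>
    (\<Union>c\<in>atlas M. fst c) = points M \<and>
    (\<forall>c\<in>atlas M. openin (mtop M) (fst c) \<and> open (snd c ` fst c) \<and>
       homeomorphic_map (subtopology (mtop M) (fst c)) (top_of_set (snd c ` fst c)) (snd c)) \<and>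
    (\<forall>c\<in>atlas M. \<forall>c'\<in>atlas M.
       smooth_on (snd c ` (fst c \<inter> fst c')) (snd c' \<circ> chart_inv c))"

definition charts_at :: "('a, 'e) mfd \<Rightarrow> 'a \<Rightarrow> ('a, 'e) chart set"
  where "charts_at M x = {c \<in> atlas M. x \<in> fst c}"

definition chart_at :: "('a, 'e) mfd \<Rightarrow> 'a \<Rightarrow> ('a, 'e) chart"
  where "chart_at M x = (SOME c. c \<in> charts_at M x)"

text \<open>
  A tangent vector at \<open>x\<close> assigns to each chart at \<open>x\<close> a component vector, subject to the usual
  transformation rule under change of charts (and is \<open>0\<close> on all other arguments, for uniqueness
  of the representation).
\<close>

type_synonym ('a, 'e) tvec = "('a, 'e) chart \<Rightarrow> 'e"

definition tangent_space :: "('a, 'e::euclidean_space) mfd \<Rightarrow> 'a \<Rightarrow> ('a, 'e) tvec set"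
  where "tangent_space M x = {v.
    (\<forall>c. c \<notin> charts_at M x \<longrightarrow> v c = 0) \<and>
    (\<forall>c\<in>charts_at M x. \<forall>c'\<in>charts_at M x.
       v c' = frechet_derivative (snd c' \<circ> chart_inv c) (at (snd c x)) (v c))}"

text \<open>The tangent vector at \<open>x\<close> with component vector \<open>e\<close> in the chart \<open>c\<close>.\<close>

definition coord_vec ::
    "('a, 'e::euclidean_space) mfd \<Rightarrow> ('a, 'e) chart \<Rightarrow> 'a \<Rightarrow> 'e \<Rightarrow> ('a, 'e) tvec"
  where "coord_vec M c x e = (\<lambda>c'. if c' \<in> charts_at M x
    then frechet_derivative (snd c' \<circ> chart_inv c) (at (snd c x)) e else 0)"

text \<open>
  The derivative of \<open>f\<close> at \<open>x\<close> along \<open>w\<close>.  For \<open>w\<close> in the tangent space at \<open>x\<close> and \<open>f\<close> differentiable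
  near \<open>x\<close> the choice of the chart is immaterial.
\<close>

definition dir_deriv ::
    "('a, 'e::euclidean_space) mfd \<Rightarrow> 'a \<Rightarrow> ('a, 'e) tvec \<Rightarrow> ('a \<Rightarrow> 'c::real_normed_vector) \<Rightarrow> 'c"
  where "dir_deriv M x w f =
    (let c = chart_at M x in frechet_derivative (f \<circ> chart_inv c) (at (snd c x)) (w c))"

definition smooth_fun :: "('a, 'e::euclidean_space) mfd \<Rightarrow> ('a \<Rightarrow> real) \<Rightarrow> bool"
  where "smooth_fun M f \<longleftrightarrow> (\<forall>c\<in>atlas M. smooth_on (snd c ` fst c) (f \<circ> chart_inv c))"

section \<open>Submanifolds and vector bundles along them\<close>

text \<open>The differential at \<open>x\<close> of the inclusion of \<open>N\<close> into \<open>M\<close>.\<close>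

definition push ::
    "('a, 'm::euclidean_space) mfd \<Rightarrow> ('a, 'e::euclidean_space) mfd \<Rightarrow> 'a
      \<Rightarrow> ('a, 'm) tvec \<Rightarrow> ('a, 'e) tvec"
  where "push N M x w = (\<lambda>k. if k \<in> charts_at M x then dir_deriv N x w (snd k) else 0)"

text \<open>\<open>N\<close> is a submanifold of \<open>M\<close>: the inclusion is an (injective) immersion.\<close>

definition submanifold ::
    "('a, 'm::euclidean_space) mfd \<Rightarrow> ('a, 'e::euclidean_space) mfd \<Rightarrow> bool"
  where "submanifold N M \<longleftrightarrow>
    smooth_manifold N \<and> smooth_manifold M \<and> points N \<subseteq> points M \<and>
    continuous_map (mtop N) (mtop M) (\<lambda>x. x) \<and>
    (\<forall>c\<in>atlas N. \<forall>k\<in>atlas M. smooth_on (snd c ` (fst c \<inter> fst k)) (snd k \<circ> chart_inv c)) \<and>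
    (\<forall>x\<in>points N. inj_on (push N M x) (tangent_space N x))"

text \<open>
  Smooth sections over the open set \<open>Q\<close> of \<open>N\<close> of the restriction of the tangent bundle of \<open>M\<close> to
  \<open>N\<close>.  For \<open>N = M\<close> these are the vector fields on \<open>Q\<close>.
\<close>

definition smooth_along ::
    "('a, 'm::euclidean_space) mfd \<Rightarrow> ('a, 'e::euclidean_space) mfd \<Rightarrow> 'a set
      \<Rightarrow> ('a \<Rightarrow> ('a, 'e) tvec) \<Rightarrow> bool"
  where "smooth_along N M Q X \<longleftrightarrow>
    (\<forall>x\<in>Q. X x \<in> tangent_space M x) \<and>
    (\<forall>c\<in>atlas N. \<forall>k\<in>atlas M.
       smooth_on (snd c ` (fst c \<inter> fst k \<inter> Q)) (\<lambda>u. X (chart_inv c u) k))"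

abbreviation field_along ::
    "('a, 'm::euclidean_space) mfd \<Rightarrow> ('a, 'e::euclidean_space) mfd
      \<Rightarrow> ('a \<Rightarrow> ('a, 'e) tvec) \<Rightarrow> bool"
  where "field_along N M X \<equiv> smooth_along N M (points N) X"

abbreviation vector_field :: "('a, 'e::euclidean_space) mfd \<Rightarrow> ('a \<Rightarrow> ('a, 'e) tvec) \<Rightarrow> bool"
  where "vector_field M X \<equiv> field_along M M X"

text \<open>The module of global smooth sections of a subbundle \<open>E\<close>.\<close>

definition sections ::
    "('a, 'm::euclidean_space) mfd \<Rightarrow> ('a, 'e::euclidean_space) mfd
      \<Rightarrow> ('a \<Rightarrow> ('a, 'e) tvec set) \<Rightarrow> ('a \<Rightarrow> ('a, 'e) tvec) set"
  where "sections N M E = {X. field_along N M X \<and> (\<forall>x\<in>points N. X x \<in> E x)}"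

definition local_frame ::
    "('a, 'm::euclidean_space) mfd \<Rightarrow> ('a, 'e::euclidean_space) mfd
      \<Rightarrow> ('a \<Rightarrow> ('a, 'e) tvec set) \<Rightarrow> nat \<Rightarrow> 'a set \<Rightarrow> (nat \<Rightarrow> 'a \<Rightarrow> ('a, 'e) tvec) \<Rightarrow> bool"
  where "local_frame N M E k Q F \<longleftrightarrow>
    openin (mtop N) Q \<and> (\<forall>i<k. smooth_along N M Q (F i)) \<and>
    (\<forall>x\<in>Q. inj_on (\<lambda>i. F i x) {..<k} \<and> independent ((\<lambda>i. F i x) ` {..<k}) \<and>
       span ((\<lambda>i. F i x) ` {..<k}) = E x)"

definition subbundle ::
    "('a, 'm::euclidean_space) mfd \<Rightarrow> ('a, 'e::euclidean_space) mfd
      \<Rightarrow> ('a \<Rightarrow> ('a, 'e) tvec set) \<Rightarrow> nat \<Rightarrow> bool"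
  where "subbundle N M E k \<longleftrightarrow> (\<forall>x\<in>points N. \<exists>Q F. x \<in> Q \<and> local_frame N M E k Q F)"

section \<open>Metallic semi-Riemannian manifolds\<close>

type_synonym ('a, 'e) metric = "'a \<Rightarrow> ('a, 'e) tvec \<Rightarrow> ('a, 'e) tvec \<Rightarrow> real"

type_synonym ('a, 'e) tensor11 = "'a \<Rightarrow> ('a, 'e) tvec \<Rightarrow> ('a, 'e) tvec"

definition nondegenerate_on :: "('v::real_vector \<Rightarrow> 'v \<Rightarrow> real) \<Rightarrow> 'v set \<Rightarrow> bool"
  where "nondegenerate_on b V \<longleftrightarrow> (\<forall>v\<in>V. (\<forall>w\<in>V. b v w = 0) \<longrightarrow> v = 0)"

definition negative_on :: "('v::real_vector \<Rightarrow> 'v \<Rightarrow> real) \<Rightarrow> 'v set \<Rightarrow> bool"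
  where "negative_on b V \<longleftrightarrow> (\<forall>v\<in>V. v \<noteq> 0 \<longrightarrow> b v v < 0)"

definition semi_riemannian :: "('a, 'e::euclidean_space) mfd \<Rightarrow> ('a, 'e) metric \<Rightarrow> bool"
  where "semi_riemannian M g \<longleftrightarrow>
    smooth_manifold M \<and>
    (\<forall>x\<in>points M.
       (\<forall>u\<in>tangent_space M x. \<forall>v\<in>tangent_space M x. \<forall>w\<in>tangent_space M x. \<forall>a b.
          g x (a *\<^sub>R u + b *\<^sub>R v) w = a * g x u w + b * g x v w) \<and>
       (\<forall>u\<in>tangent_space M x. \<forall>v\<in>tangent_space M x. g x u v = g x v u) \<and>
       nondegenerate_on (g x) (tangent_space M x)) \<and>
    (\<forall>c\<in>atlas M. \<forall>a b. smooth_on (snd c ` fst c)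
       (\<lambda>u. let x = chart_inv c u in g x (coord_vec M c x a) (coord_vec M c x b))) \<and>
    (\<exists>index. \<forall>x\<in>points M.
       (\<exists>V. subspace V \<and> V \<subseteq> tangent_space M x \<and> negative_on (g x) V \<and> dim V = index) \<and>
       (\<forall>V. subspace V \<and> V \<subseteq> tangent_space M x \<and> negative_on (g x) V \<longrightarrow> dim V \<le> index))"

definition tensor_field11 :: "('a, 'e::euclidean_space) mfd \<Rightarrow> ('a, 'e) tensor11 \<Rightarrow> bool"
  where "tensor_field11 M J \<longleftrightarrow>
    (\<forall>x\<in>points M.
       (\<forall>v\<in>tangent_space M x. J x v \<in> tangent_space M x) \<and>
       (\<forall>v\<in>tangent_space M x. \<forall>w\<in>tangent_space M x. \<forall>a b.
          J x (a *\<^sub>R v + b *\<^sub>R w) = a *\<^sub>R J x v + b *\<^sub>R J x w)) \<and>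
    (\<forall>c\<in>atlas M. \<forall>a. smooth_on (snd c ` fst c)
       (\<lambda>u. let x = chart_inv c u in J x (coord_vec M c x a) c))"

definition metallic_semi_riemannian ::
    "nat \<Rightarrow> nat \<Rightarrow> ('a, 'e::euclidean_space) mfd \<Rightarrow> ('a, 'e) metric \<Rightarrow> ('a, 'e) tensor11 \<Rightarrow> bool"
  where "metallic_semi_riemannian p q M g J \<longleftrightarrow>
    semi_riemannian M g \<and> tensor_field11 M J \<and>
    (\<forall>x\<in>points M. \<forall>v\<in>tangent_space M x. J x (J x v) = real p *\<^sub>R J x v + real q *\<^sub>R v) \<and>
    (\<forall>x\<in>points M. \<forall>v\<in>tangent_space M x. \<forall>w\<in>tangent_space M x.
       g x (J x v) w = g x v (J x w))"

section \<open>Connections\<close>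

text \<open>
  A covariant derivative is given as an operator taking a point \<open>x\<close>, a tangent vector at \<open>x\<close> and a
  field, so that \<open>\<nabla>\<^sub>W U\<close> is \<open>\<lambda>x. D x (W x) U\<close>.  \<open>connection_along N M D\<close> says that \<open>D\<close> is a linear
  connection in the restriction of the tangent bundle of \<open>M\<close> to \<open>N\<close>; for \<open>N = M\<close> it is an affine
  connection on \<open>M\<close>.  The values of \<open>D\<close> at non-smooth fields are irrelevant.
\<close>

type_synonym ('a, 'm, 'e) conn = "'a \<Rightarrow> ('a, 'm) tvec \<Rightarrow> ('a \<Rightarrow> ('a, 'e) tvec) \<Rightarrow> ('a, 'e) tvec"

definition connection_along ::
    "('a, 'm::euclidean_space) mfd \<Rightarrow> ('a, 'e::euclidean_space) mfd \<Rightarrow> ('a, 'm, 'e) conn \<Rightarrow> bool"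
  where "connection_along N M D \<longleftrightarrow>
    (\<forall>x\<in>points N. \<forall>w\<in>tangent_space N x. \<forall>X. field_along N M X \<longrightarrow> D x w X \<in> tangent_space M x) \<and>
    (\<forall>x\<in>points N. \<forall>v\<in>tangent_space N x. \<forall>w\<in>tangent_space N x. \<forall>a b X. field_along N M X \<longrightarrow>
       D x (a *\<^sub>R v + b *\<^sub>R w) X = a *\<^sub>R D x v X + b *\<^sub>R D x w X) \<and>
    (\<forall>x\<in>points N. \<forall>w\<in>tangent_space N x. \<forall>X Y. field_along N M X \<and> field_along N M Y \<longrightarrow>
       D x w (\<lambda>y. X y + Y y) = D x w X + D x w Y) \<and>
    (\<forall>x\<in>points N. \<forall>w\<in>tangent_space N x. \<forall>f X. smooth_fun N f \<and> field_along N M X \<longrightarrow>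
       D x w (\<lambda>y. f y *\<^sub>R X y) = dir_deriv N x w f *\<^sub>R X x + f x *\<^sub>R D x w X) \<and>
    (\<forall>W X. vector_field N W \<and> field_along N M X \<longrightarrow> field_along N M (\<lambda>x. D x (W x) X))"

definition lie_bracket ::
    "('a, 'e::euclidean_space) mfd \<Rightarrow> ('a \<Rightarrow> ('a, 'e) tvec) \<Rightarrow> ('a \<Rightarrow> ('a, 'e) tvec)
      \<Rightarrow> 'a \<Rightarrow> ('a, 'e) tvec"
  where "lie_bracket M X Y x = (\<lambda>c. if c \<in> charts_at M x
    then dir_deriv M x (X x) (\<lambda>y. Y y c) - dir_deriv M x (Y x) (\<lambda>y. X y c) else 0)"

definition levi_civita ::
    "('a, 'e::euclidean_space) mfd \<Rightarrow> ('a, 'e) metric \<Rightarrow> ('a, 'e, 'e) conn \<Rightarrow> bool"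
  where "levi_civita M g nabla \<longleftrightarrow>
    connection_along M M nabla \<and>
    (\<forall>X Y. vector_field M X \<and> vector_field M Y \<longrightarrow>
       (\<forall>x\<in>points M. nabla x (X x) Y - nabla x (Y x) X = lie_bracket M X Y x)) \<and>
    (\<forall>X Y Z. vector_field M X \<and> vector_field M Y \<and> vector_field M Z \<longrightarrow>
       (\<forall>x\<in>points M. dir_deriv M x (X x) (\<lambda>y. g y (Y y) (Z y)) =
          g x (nabla x (X x) Y) (Z x) + g x (Y x) (nabla x (X x) Z)))"

definition locally_metallic ::
    "('a, 'e::euclidean_space) mfd \<Rightarrow> ('a, 'e) tensor11 \<Rightarrow> ('a, 'e, 'e) conn \<Rightarrow> bool"
  where "locally_metallic M J nabla \<longleftrightarrow>
    (\<forall>W U. vector_field M W \<and> vector_field M U \<longrightarrow>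
       (\<forall>x\<in>points M. nabla x (W x) (\<lambda>y. J y (U y)) = J x (nabla x (W x) U)))"

text \<open>
  \<open>D\<close> is the pullback to \<open>N\<close> of the connection \<open>nabla\<close> on \<open>M\<close>; this gives meaning to the derivative
  of a field which is defined along \<open>N\<close> only, in directions tangent to \<open>N\<close>.  Since the restriction
  of the tangent bundle of \<open>M\<close> to \<open>N\<close> is locally spanned over the smooth functions by restrictions
  of vector fields on \<open>M\<close>, there is exactly one such \<open>D\<close> on smooth fields along \<open>N\<close>.
\<close>

definition pullback_connection ::
    "('a, 'm::euclidean_space) mfd \<Rightarrow> ('a, 'e::euclidean_space) mfd \<Rightarrow> ('a, 'e, 'e) conn
      \<Rightarrow> ('a, 'm, 'e) conn \<Rightarrow> bool"
  where "pullback_connection N M nabla D \<longleftrightarrow>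
    connection_along N M D \<and>
    (\<forall>X. vector_field M X \<longrightarrow>
       (\<forall>x\<in>points N. \<forall>w\<in>tangent_space N x. D x w X = nabla x (push N M x w) X))"

section \<open>Lightlike submanifolds\<close>

text \<open>
  All bundles over \<open>N\<close> are families of subspaces of the tangent spaces of \<open>M\<close>; in particular
  \<open>tan_bundle N M\<close> is the tangent bundle of \<open>N\<close> identified with its image in that of \<open>M\<close>.
\<close>

definition tan_bundle ::
    "('a, 'm::euclidean_space) mfd \<Rightarrow> ('a, 'e::euclidean_space) mfd \<Rightarrow> 'a \<Rightarrow> ('a, 'e) tvec set"
  where "tan_bundle N M x = push N M x ` tangent_space N x"

definition normal_bundle ::
    "('a, 'm::euclidean_space) mfd \<Rightarrow> ('a, 'e::euclidean_space) mfd \<Rightarrow> ('a, 'e) metric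
      \<Rightarrow> 'a \<Rightarrow> ('a, 'e) tvec set"
  where "normal_bundle N M g x = {v \<in> tangent_space M x. \<forall>w\<in>tan_bundle N M x. g x v w = 0}"

definition Rad ::
    "('a, 'm::euclidean_space) mfd \<Rightarrow> ('a, 'e::euclidean_space) mfd \<Rightarrow> ('a, 'e) metric
      \<Rightarrow> 'a \<Rightarrow> ('a, 'e) tvec set"
  where "Rad N M g x = tan_bundle N M x \<inter> normal_bundle N M g x"

definition lightlike_submanifold ::
    "('a, 'm::euclidean_space) mfd \<Rightarrow> ('a, 'e::euclidean_space) mfd \<Rightarrow> ('a, 'e) metric
      \<Rightarrow> nat \<Rightarrow> bool"
  where "lightlike_submanifold N M g r \<longleftrightarrow>
    submanifold N M \<and> 1 \<le> r \<and> r \<le> DIM('m) \<and> subbundle N M (Rad N M g) r"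

definition screen_distribution ::
    "('a, 'm::euclidean_space) mfd \<Rightarrow> ('a, 'e::euclidean_space) mfd \<Rightarrow> ('a, 'e) metric
      \<Rightarrow> nat \<Rightarrow> ('a \<Rightarrow> ('a, 'e) tvec set) \<Rightarrow> bool"
  where "screen_distribution N M g r S \<longleftrightarrow>
    subbundle N M S (DIM('m) - r) \<and>
    (\<forall>x\<in>points N. S x \<inter> Rad N M g x = {0} \<and> S x + Rad N M g x = tan_bundle N M x \<and>
       nondegenerate_on (g x) (S x))"

definition screen_transversal_bundle ::
    "('a, 'm::euclidean_space) mfd \<Rightarrow> ('a, 'e::euclidean_space) mfd \<Rightarrow> ('a, 'e) metric
      \<Rightarrow> nat \<Rightarrow> ('a \<Rightarrow> ('a, 'e) tvec set) \<Rightarrow> bool"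
  where "screen_transversal_bundle N M g r SP \<longleftrightarrow>
    subbundle N M SP (DIM('e) - DIM('m) - r) \<and>
    (\<forall>x\<in>points N. SP x \<inter> Rad N M g x = {0} \<and> SP x + Rad N M g x = normal_bundle N M g x \<and>
       nondegenerate_on (g x) (SP x))"

text \<open>
  The lightlike transversal bundle is determined by \<open>S\<close> and \<open>SP\<close> only up to a choice of a
  complement of \<open>Rad\<close>, hence it is a predicate.  Apart from the defining conditions it contains the
  decomposition of the ambient tangent spaces, which follows from them; that the sum is direct and
  orthogonal as indicated follows from the remaining clauses.
\<close>

definition lightlike_transversal_bundle ::
    "('a, 'm::euclidean_space) mfd \<Rightarrow> ('a, 'e::euclidean_space) mfd \<Rightarrow> ('a, 'e) metric
      \<Rightarrow> nat \<Rightarrow> ('a \<Rightarrow> ('a, 'e) tvec set) \<Rightarrow> ('a \<Rightarrow> ('a, 'e) tvec set)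
      \<Rightarrow> ('a \<Rightarrow> ('a, 'e) tvec set) \<Rightarrow> bool"
  where "lightlike_transversal_bundle N M g r S SP ltr \<longleftrightarrow>
    subbundle N M ltr r \<and>
    (\<forall>x\<in>points N. \<forall>v\<in>ltr x. \<forall>w\<in>S x \<union> SP x. g x v w = 0) \<and>
    (\<forall>Q \<xi>. local_frame N M (Rad N M g) r Q \<xi> \<longrightarrow>
       (\<exists>\<eta>. local_frame N M ltr r Q \<eta> \<and>
          (\<forall>x\<in>Q. \<forall>i<r. \<forall>j<r.
             g x (\<xi> i x) (\<eta> j x) = (if i = j then 1 else 0) \<and> g x (\<eta> i x) (\<eta> j x) = 0))) \<and>
    (\<forall>x\<in>points N. S x + Rad N M g x + ltr x + SP x = tangent_space M x)"

text \<open>The \<open>A\<close>-component of \<open>v\<close> with respect to the direct sum of \<open>A\<close> and \<open>B\<close>.\<close>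

definition component :: "'v::real_vector set \<Rightarrow> 'v set \<Rightarrow> 'v \<Rightarrow> 'v"
  where "component A B v = (THE a. a \<in> A \<and> v - a \<in> B)"

text \<open>
  The tangential part of the Gauss formula and the screen transversal part of the Weingarten
  formula for the derivative of sections of \<open>tan_bundle N M\<close> and \<open>SP\<close> respectively.
\<close>

definition induced_connection ::
    "('a, 'm::euclidean_space) mfd \<Rightarrow> ('a, 'e::euclidean_space) mfd
      \<Rightarrow> ('a \<Rightarrow> ('a, 'e) tvec set) \<Rightarrow> ('a \<Rightarrow> ('a, 'e) tvec set) \<Rightarrow> ('a, 'm, 'e) conn
      \<Rightarrow> ('a, 'm, 'e) conn"
  where "induced_connection N M SP ltr D x w U =
    component (tan_bundle N M x) (ltr x + SP x) (D x w U)"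

definition screen_transversal_connection ::
    "('a, 'm::euclidean_space) mfd \<Rightarrow> ('a, 'e::euclidean_space) mfd
      \<Rightarrow> ('a \<Rightarrow> ('a, 'e) tvec set) \<Rightarrow> ('a \<Rightarrow> ('a, 'e) tvec set) \<Rightarrow> ('a, 'm, 'e) conn
      \<Rightarrow> ('a, 'm, 'e) conn"
  where "screen_transversal_connection N M SP ltr D x w Z =
    component (SP x) (tan_bundle N M x + ltr x) (D x w Z)"

text \<open>
  A connection \<open>D\<close> in \<open>tan_bundle N M\<close> is metric if the induced (degenerate) metric on \<open>N\<close> is
  parallel, \<open>W (g(U,V)) = g(\<nabla>\<^sub>W U, V) + g(U, \<nabla>\<^sub>W V)\<close>.
\<close>

definition metric_connection ::
    "('a, 'm::euclidean_space) mfd \<Rightarrow> ('a, 'e::euclidean_space) mfd \<Rightarrow> ('a, 'e) metric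
      \<Rightarrow> ('a, 'm, 'e) conn \<Rightarrow> bool"
  where "metric_connection N M g D \<longleftrightarrow>
    (\<forall>W. vector_field N W \<longrightarrow>
       (\<forall>U\<in>sections N M (tan_bundle N M). \<forall>V\<in>sections N M (tan_bundle N M). \<forall>x\<in>points N.
          dir_deriv N x (W x) (\<lambda>y. g y (U y) (V y)) =
            g x (D x (W x) U) (V x) + g x (U x) (D x (W x) V)))"

section \<open>Screen transversal anti-invariant submanifolds\<close>

text \<open>The orthogonal complement in \<open>SP\<close> of the \<open>J\<close>-images of \<open>Rad\<close>, \<open>ltr\<close> and \<open>S\<close>.\<close>

definition D_o ::
    "('a, 'm::euclidean_space) mfd \<Rightarrow> ('a, 'e::euclidean_space) mfd \<Rightarrow> ('a, 'e) metric
      \<Rightarrow> ('a, 'e) tensor11 \<Rightarrow> ('a \<Rightarrow> ('a, 'e) tvec set) \<Rightarrow> ('a \<Rightarrow> ('a, 'e) tvec set)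
      \<Rightarrow> ('a \<Rightarrow> ('a, 'e) tvec set) \<Rightarrow> 'a \<Rightarrow> ('a, 'e) tvec set"
  where "D_o N M g J S SP ltr x =
    {z \<in> SP x. \<forall>v\<in>Rad N M g x \<union> ltr x \<union> S x. g x z (J x v) = 0}"

text \<open>
  The last clause includes the standing assumption on the decomposition of \<open>SP\<close>.  The sum is
  automatically direct: \<open>J\<close> is injective because \<open>q > 0\<close>, and \<open>D_o\<close> is non-degenerate and orthogonal
  to the other summands.
\<close>

definition screen_transversal_anti_invariant ::
    "('a, 'm::euclidean_space) mfd \<Rightarrow> ('a, 'e::euclidean_space) mfd \<Rightarrow> ('a, 'e) metric
      \<Rightarrow> ('a, 'e) tensor11 \<Rightarrow> ('a \<Rightarrow> ('a, 'e) tvec set) \<Rightarrow> ('a \<Rightarrow> ('a, 'e) tvec set)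
      \<Rightarrow> ('a \<Rightarrow> ('a, 'e) tvec set) \<Rightarrow> bool"
  where "screen_transversal_anti_invariant N M g J S SP ltr \<longleftrightarrow>
    (\<forall>x\<in>points N.
       J x ` Rad N M g x \<subseteq> SP x \<and> J x ` S x \<subseteq> SP x \<and> J x ` ltr x \<subseteq> SP x \<and>
       nondegenerate_on (g x) (D_o N M g J S SP ltr x) \<and>
       SP x = J x ` Rad N M g x + J x ` ltr x + J x ` S x + D_o N M g J S SP ltr x)"

definition T2 ::
    "('a, 'm::euclidean_space) mfd \<Rightarrow> ('a, 'e::euclidean_space) mfd \<Rightarrow> ('a, 'e) metric
      \<Rightarrow> ('a, 'e) tensor11 \<Rightarrow> ('a \<Rightarrow> ('a, 'e) tvec set) \<Rightarrow> ('a \<Rightarrow> ('a, 'e) tvec set)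
      \<Rightarrow> ('a \<Rightarrow> ('a, 'e) tvec set) \<Rightarrow> ('a, 'e) tensor11"
  where "T2 N M g J S SP ltr x =
    component (J x ` S x) (J x ` Rad N M g x + J x ` ltr x + D_o N M g J S SP ltr x)"

definition B2 ::
    "('a, 'm::euclidean_space) mfd \<Rightarrow> ('a, 'e::euclidean_space) mfd \<Rightarrow> ('a, 'e) metric
      \<Rightarrow> ('a, 'e) tensor11 \<Rightarrow> ('a \<Rightarrow> ('a, 'e) tvec set) \<Rightarrow> ('a \<Rightarrow> ('a, 'e) tvec set)
      \<Rightarrow> ('a \<Rightarrow> ('a, 'e) tvec set) \<Rightarrow> ('a, 'e) tensor11"
  where "B2 N M g J S SP ltr x z = component (S x) (J x ` S x) (J x (T2 N M g J S SP ltr x z))"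

end

theory Submission
  imports Defs
begin

text \<open>
  Write \<open>D\<close> for the derivative of fields along \<open>N\<close>, \<open>TN\<close> for the tangent bundle of \<open>N\<close> inside that of
  \<open>M\<close> and \<open>R\<close> for its radical.  Both sides of the equivalence say that \<open>D\<^sub>W \<xi>\<close> has no component in \<open>S\<close>, that
  is, \<open>g (D\<^sub>W \<xi>) u = 0\<close> for all \<open>u\<close> in \<open>S\<close> and all sections \<open>\<xi>\<close> of \<open>R\<close>.

  For the metric condition this is classical.  As \<open>D\<close> is compatible with \<open>g\<close>, the failure of the
  induced connection to be metric is \<open>g (D\<^sub>W U) V\<^sub>R + g U\<^sub>R (D\<^sub>W V)\<close>, with \<open>U\<^sub>R\<close> and \<open>V\<^sub>R\<close> the components
  in \<open>R\<close>.  Since \<open>R\<close> is orthogonal to \<open>TN\<close>, one has \<open>g (D\<^sub>W U) \<xi> = - g U (D\<^sub>W \<xi>)\<close> for sections \<open>\<xi>\<close> of \<open>R\<close>,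
  which at a point depends on the value of \<open>U\<close> only.  So it is enough to extend \<open>U\<^sub>R\<close> and \<open>V\<^sub>R\<close> from a
  single point to global sections of \<open>R\<close>, and no smoothness of the projections is needed.

  For the other condition write \<open>D\<^sub>W \<xi> = s + r + l + z\<close> with \<open>s\<close>, \<open>r\<close>, \<open>l\<close>, \<open>z\<close> in \<open>S\<close>, \<open>R\<close>, the lightlike and
  the screen transversal bundle, and \<open>z = J r' + J l' + J s' + d\<close> with \<open>d\<close> in \<open>D\<^sub>o\<close>.  As \<open>J\<close> is parallel and
  \<open>J\<^sup>2 = p J + q\<close>, the \<open>J S\<close>-component of the screen transversal part of \<open>D\<^sub>W (J \<xi>) = J (D\<^sub>W \<xi>)\<close> is
  \<open>J (s + p s')\<close>, hence \<open>B\<^sub>2\<close> of it is \<open>q (s + p s')\<close>.  Here \<open>s' = 0\<close>: the form \<open>g (D\<^sub>X Y) (J Z)\<close> on \<open>TN\<close> is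
  symmetric in \<open>X\<close> and \<open>Y\<close>, because \<open>D\<close> is torsion free, and antisymmetric in \<open>Y\<close> and \<open>Z\<close>, because \<open>J\<close>
  is self-adjoint and parallel and \<open>J TN\<close> is orthogonal to \<open>TN\<close>; such a form vanishes.  This is
  \<open>second_form_eq_0\<close>, and the pointwise computation is \<open>screen_component_eq_0_iff\<close>.

  It remains to see that the pullback \<open>D\<close> of the Levi-Civita connection is compatible with the metric
  (\<open>metric_compatible\<close>), torsion free (\<open>torsion_free_extension\<close>) and commutes with \<open>J\<close>
  (\<open>tensor_parallel\<close>).  The definition prescribes \<open>D\<close> on restrictions of global vector fields of \<open>M\<close> only.
  A bump function \<open>\<beta>\<close> at \<open>x\<close> turns the coordinate fields of \<open>M\<close> near \<open>x\<close> into such vector fields, and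
  the Leibniz rule then gives a coordinate formula for \<open>D\<close> at \<open>x\<close> (\<open>connection_formula\<close>).  For this,
  \<open>\<beta> x = 1\<close> and the vanishing of the derivative of \<open>\<beta>\<close> at \<open>x\<close> suffice.
\<close>

section \<open>Smooth functions on open sets\<close>

lemma frechet_derivative_cong_open:
  assumes "open S" "x \<in> S" "\<And>y. y \<in> S \<Longrightarrow> f y = g y"
  shows "frechet_derivative f (at x) = frechet_derivative g (at x)"
proof -
  have "(f has_derivative D) (at x) \<longleftrightarrow> (g has_derivative D) (at x)" for D
  proof
    assume "(f has_derivative D) (at x)"
    then show "(g has_derivative D) (at x)"
      by (rule has_derivative_transform_within_open[OF _ assms])
  next
    assume "(g has_derivative D) (at x)"
    then show "(f has_derivative D) (at x)"
      by (rule has_derivative_transform_within_open[OF _ assms(1,2)]) (simp add: assms(3))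
  qed
  then show ?thesis
    unfolding frechet_derivative_def by simp
qed

lemma Ck_on_cong:
  assumes "open S" "\<And>x. x \<in> S \<Longrightarrow> f x = g x" "Ck_on k S f"
  shows "Ck_on k S g"
  using assms(2,3)
proof (induction k arbitrary: f g)
  case 0
  then show ?case
    using continuous_on_cong[of S S f g] by simp
next
  case (Suc k)
  have "g differentiable at x" if "x \<in> S" for x
  proof -
    have "f differentiable at x"
      using Suc.prems(2) that by (simp add: differentiable_on_eq_differentiable_at[OF assms(1)])
    then obtain D where "(f has_derivative D) (at x)"
      by (auto simp: differentiable_def)
    from has_derivative_transform_within_open[OF this assms(1) that Suc.prems(1)] show ?thesis
      by (auto simp: differentiable_def)
  qed
  moreover have "Ck_on k S (\<lambda>u. frechet_derivative g (at u) v)" for v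
  proof (rule Suc.IH)
    show "Ck_on k S (\<lambda>u. frechet_derivative f (at u) v)"
      using Suc.prems by simp
    show "frechet_derivative f (at u) v = frechet_derivative g (at u) v" if "u \<in> S" for u
      using frechet_derivative_cong_open[OF assms(1) that Suc.prems(1)] by simp
  qed
  ultimately show ?case
    by (simp add: differentiable_on_eq_differentiable_at[OF assms(1)])
qed

lemma Ck_on_subset:
  assumes "T \<subseteq> S" "Ck_on k S f"
  shows "Ck_on k T f"
  using assms(2)
proof (induction k arbitrary: f)
  case 0
  then show ?case
    using assms continuous_on_subset by auto
next
  case (Suc k)
  then show ?case
    using assms differentiable_on_subset by auto
qed

lemma Ck_on_local:
  assumes "open S" "\<And>x. x \<in> S \<Longrightarrow> \<exists>T. open T \<and> x \<in> T \<and> Ck_on k (S \<inter> T) f"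
  shows "Ck_on k S f"
  using assms(2)
proof (induction k arbitrary: f)
  case 0
  have "isCont f x" if x: "x \<in> S" for x
  proof -
    obtain T where T: "open T" "x \<in> T" "continuous_on (S \<inter> T) f"
      using 0 x by auto
    then show ?thesis
      using x assms(1) by (metis IntI continuous_on_eq_continuous_at open_Int)
  qed
  then show ?case
    by (simp add: continuous_at_imp_continuous_on)
next
  case (Suc k)
  have "f differentiable at x" if x: "x \<in> S" for x
  proof -
    obtain T where T: "open T" "x \<in> T" "Ck_on (Suc k) (S \<inter> T) f"
      using Suc.prems x by blast
    then show ?thesis
      using x assms(1) differentiable_on_eq_differentiable_at[of "S \<inter> T" f] by auto
  qed
  moreover have "Ck_on k S (\<lambda>u. frechet_derivative f (at u) v)" for v
    by (rule Suc.IH) (use Suc.prems in fastforce)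
  ultimately show ?case
    by (simp add: differentiable_on_eq_differentiable_at[OF assms(1)])
qed

text \<open>
  The clause of \<^const>\<open>Ck_on\<close> for \<open>Suc k\<close> does not mention the continuity of \<open>f\<close>, which follows from
  differentiability.
\<close>

lemma Ck_on_SucD: "Ck_on (Suc k) S f \<Longrightarrow> Ck_on k S f"
proof (induction k arbitrary: f)
  case 0
  then show ?case
    by (simp add: differentiable_imp_continuous_on)
next
  case (Suc k)
  then have "f differentiable_on S" and "Ck_on (Suc k) S (\<lambda>u. frechet_derivative f (at u) v)" for v
    unfolding Ck_on.simps(2)[of "Suc k"] by blast+
  then show ?case
    by (subst Ck_on.simps(2)) (blast intro: Suc.IH)
qed

lemma Ck_on_Suc_has_derivative:
  assumes "open S" "Ck_on (Suc k) S f" "u \<in> S"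
  shows "(f has_derivative frechet_derivative f (at u)) (at u)"
  using assms by (simp add: differentiable_on_eq_differentiable_at flip: frechet_derivative_works)

lemma Ck_on_const: "Ck_on k S (\<lambda>u. c)"
  by (induction k arbitrary: c) (simp_all add: continuous_on_const)

lemma Ck_on_bounded_linear:
  assumes "open S" "bounded_linear L" "Ck_on k S f"
  shows "Ck_on k S (\<lambda>u. L (f u))"
  using assms(3)
proof (induction k arbitrary: f)
  case 0
  then show ?case
    using assms(2) by (simp add: bounded_linear.continuous_on)
next
  case (Suc k)
  have D: "((\<lambda>u. L (f u)) has_derivative (\<lambda>v. L (frechet_derivative f (at u) v))) (at u)"
    if "u \<in> S" for u
    by (rule bounded_linear.has_derivative[OF assms(2)
        Ck_on_Suc_has_derivative[OF assms(1) Suc.prems that]])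
  have "Ck_on k S (\<lambda>u. frechet_derivative (\<lambda>u. L (f u)) (at u) v)" for v
  proof (rule Ck_on_cong[OF assms(1)])
    show "Ck_on k S (\<lambda>u. L (frechet_derivative f (at u) v))"
      using Suc by simp
    show "L (frechet_derivative f (at u) v) = frechet_derivative (\<lambda>u. L (f u)) (at u) v"
      if "u \<in> S" for u
      using fun_cong[OF frechet_derivative_at[OF D[OF that]], of v] by simp
  qed
  then show ?case
    using D by (auto simp: differentiable_on_eq_differentiable_at[OF assms(1)] differentiable_def)
qed

lemma Ck_on_add:
  assumes "open S" "Ck_on k S f" "Ck_on k S g"
  shows "Ck_on k S (\<lambda>u. f u + g u)"
  using assms(2,3)
proof (induction k arbitrary: f g)
  case 0
  then show ?case
    by (simp add: continuous_on_add)
next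
  case (Suc k)
  have D: "((\<lambda>u. f u + g u) has_derivative
      (\<lambda>v. frechet_derivative f (at u) v + frechet_derivative g (at u) v)) (at u)"
    if "u \<in> S" for u
    using Suc.prems[THEN Ck_on_Suc_has_derivative[OF assms(1)]] that
    by (intro has_derivative_add)
  have "Ck_on k S (\<lambda>u. frechet_derivative (\<lambda>u. f u + g u) (at u) v)" for v
  proof (rule Ck_on_cong[OF assms(1)])
    show "Ck_on k S (\<lambda>u. frechet_derivative f (at u) v + frechet_derivative g (at u) v)"
      using Suc by simp
    show "frechet_derivative f (at u) v + frechet_derivative g (at u) v =
        frechet_derivative (\<lambda>u. f u + g u) (at u) v" if "u \<in> S" for u
      using fun_cong[OF frechet_derivative_at[OF D[OF that]], of v] by simp
  qed
  then show ?case
    using D by (auto simp: differentiable_on_eq_differentiable_at[OF assms(1)] differentiable_def)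
qed

lemma Ck_on_bilinear:
  assumes "open S" "bounded_bilinear B" "Ck_on k S f" "Ck_on k S g"
  shows "Ck_on k S (\<lambda>u. B (f u) (g u))"
  using assms(3,4)
proof (induction k arbitrary: f g)
  case 0
  then show ?case
    using bounded_bilinear.continuous_on[OF assms(2)] by simp
next
  case (Suc k)
  have D: "((\<lambda>u. B (f u) (g u)) has_derivative
      (\<lambda>v. B (f u) (frechet_derivative g (at u) v) + B (frechet_derivative f (at u) v) (g u))) (at u)"
    if "u \<in> S" for u
    using Suc.prems[THEN Ck_on_Suc_has_derivative[OF assms(1)]] that
    by (intro bounded_bilinear.FDERIV[OF assms(2)])
  have "Ck_on k S (\<lambda>u. frechet_derivative (\<lambda>u. B (f u) (g u)) (at u) v)" for v
  proof (rule Ck_on_cong[OF assms(1)])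
    show "Ck_on k S (\<lambda>u. B (f u) (frechet_derivative g (at u) v)
        + B (frechet_derivative f (at u) v) (g u))"
      using Suc Ck_on_SucD[OF Suc.prems(1)] Ck_on_SucD[OF Suc.prems(2)]
      by (intro Ck_on_add assms(1) Suc.IH) simp_all
    show "B (f u) (frechet_derivative g (at u) v) + B (frechet_derivative f (at u) v) (g u) =
        frechet_derivative (\<lambda>u. B (f u) (g u)) (at u) v" if "u \<in> S" for u
      using fun_cong[OF frechet_derivative_at[OF D[OF that]], of v] by simp
  qed
  then show ?case
    using D by (auto simp: differentiable_on_eq_differentiable_at[OF assms(1)] differentiable_def)
qed

lemma Ck_on_sum:
  assumes "open S" "\<And>i. i \<in> I \<Longrightarrow> Ck_on k S (f i)"
  shows "Ck_on k S (\<lambda>u. \<Sum>i\<in>I. f i u)"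
  using assms(2)
proof (induction I rule: infinite_finite_induct)
  case (insert i I)
  have "Ck_on k S (\<lambda>u. f i u + (\<Sum>i\<in>I. f i u))"
    by (intro Ck_on_add assms(1) insert) simp_all
  then show ?case
    using insert.hyps by simp
qed (simp_all add: Ck_on_const)

lemma linear_Basis_expansion:
  fixes L :: "'b::euclidean_space \<Rightarrow> 'c::real_vector"
  assumes "linear L"
  shows "L v = (\<Sum>b\<in>Basis. (v \<bullet> b) *\<^sub>R L b)"
proof -
  have "L v = L (\<Sum>b\<in>Basis. (v \<bullet> b) *\<^sub>R b)"
    by (subst euclidean_representation) (rule refl)
  also have "\<dots> = (\<Sum>b\<in>Basis. (v \<bullet> b) *\<^sub>R L b)"
    by (subst linear_sum[OF assms]) (simp only: linear_scale[OF assms])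
  finally show ?thesis .
qed

lemma Ck_on_compose:
  fixes f :: "'b::euclidean_space \<Rightarrow> 'd::euclidean_space" and g :: "'d \<Rightarrow> 'c::real_normed_vector"
  assumes "open S" "open T" "f ` S \<subseteq> T" "Ck_on k S f" "Ck_on k T g"
  shows "Ck_on k S (\<lambda>u. g (f u))"
  using assms(3-5)
proof (induction k arbitrary: f g)
  case 0
  then show ?case
    using continuous_on_compose2 by auto
next
  case (Suc k)
  have fu: "f differentiable at u" "g differentiable at (f u)" if "u \<in> S" for u
    using Suc.prems that
    by (auto simp: differentiable_on_eq_differentiable_at[OF assms(1)] differentiable_on_eq_differentiable_at[OF assms(2)])
  have D: "((\<lambda>u. g (f u)) has_derivative
      (\<lambda>v. frechet_derivative g (at (f u)) (frechet_derivative f (at u) v))) (at u)"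
    if "u \<in> S" for u
    using diff_chain_at[OF fu(1)[OF that, unfolded frechet_derivative_works]
        fu(2)[OF that, unfolded frechet_derivative_works]]
    by (simp only: o_def)
  have "Ck_on k S (\<lambda>u. frechet_derivative (\<lambda>u. g (f u)) (at u) v)" for v
  proof (rule Ck_on_cong[OF assms(1)])
    show "Ck_on k S (\<lambda>u. \<Sum>b\<in>Basis. (frechet_derivative f (at u) v \<bullet> b) *\<^sub>R
        frechet_derivative g (at (f u)) b)"
    proof (intro Ck_on_sum Ck_on_bilinear[OF _ bounded_bilinear_scaleR] assms(1)
        Ck_on_bounded_linear[OF _ bounded_linear_inner_left])
      show "Ck_on k S (\<lambda>u. frechet_derivative f (at u) v)"
        using Suc.prems by simp
      show "Ck_on k S (\<lambda>u. frechet_derivative g (at (f u)) b)" for b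
        using Suc.prems Ck_on_SucD[OF Suc.prems(2)]
        by (intro Suc.IH[of f "\<lambda>u. frechet_derivative g (at u) b"]) auto
    qed
    show "(\<Sum>b\<in>Basis. (frechet_derivative f (at u) v \<bullet> b) *\<^sub>R frechet_derivative g (at (f u)) b) =
        frechet_derivative (\<lambda>u. g (f u)) (at u) v" if "u \<in> S" for u
      unfolding fun_cong[OF frechet_derivative_at[OF D[OF that]], of v, symmetric]
      by (rule linear_Basis_expansion[OF linear_frechet_derivative[OF fu(2)[OF that]], symmetric])
  qed
  then show ?case
    using D by (auto simp: differentiable_on_eq_differentiable_at[OF assms(1)] differentiable_def)
qed

lemma Ck_on_ident: "Ck_on k S (\<lambda>u. u)"
  by (cases k) (simp_all add: Ck_on_const continuous_on_id)

lemma smooth_on_cong: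
  "\<lbrakk>open S; \<And>x. x \<in> S \<Longrightarrow> f x = g x; smooth_on S f\<rbrakk> \<Longrightarrow> smooth_on S g"
  unfolding smooth_on_def using Ck_on_cong[of S f g] by blast

lemma smooth_on_subset: "\<lbrakk>smooth_on S f; T \<subseteq> S\<rbrakk> \<Longrightarrow> smooth_on T f"
  unfolding smooth_on_def using Ck_on_subset[of T S _ f] by blast

lemma smooth_on_local:
  "\<lbrakk>open S; \<And>x. x \<in> S \<Longrightarrow> \<exists>T. open T \<and> x \<in> T \<and> smooth_on (S \<inter> T) f\<rbrakk> \<Longrightarrow> smooth_on S f"
  unfolding smooth_on_def using Ck_on_local[of S _ f] by fast

lemma smooth_on_const: "smooth_on S (\<lambda>u. c)"
  by (simp add: smooth_on_def Ck_on_const)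

lemma smooth_on_ident: "smooth_on S (\<lambda>u. u)"
  by (simp add: smooth_on_def Ck_on_ident)

lemma smooth_on_bounded_linear:
  "\<lbrakk>open S; bounded_linear L; smooth_on S f\<rbrakk> \<Longrightarrow> smooth_on S (\<lambda>u. L (f u))"
  by (simp add: smooth_on_def Ck_on_bounded_linear[of S L])

lemma smooth_on_add:
  "\<lbrakk>open S; smooth_on S f; smooth_on S g\<rbrakk> \<Longrightarrow> smooth_on S (\<lambda>u. f u + g u)"
  by (simp add: smooth_on_def Ck_on_add)

lemma smooth_on_scaleR:
  "\<lbrakk>open S; smooth_on S f; smooth_on S g\<rbrakk> \<Longrightarrow> smooth_on S (\<lambda>u. f u *\<^sub>R g u)"
  by (simp add: smooth_on_def Ck_on_bilinear[OF _ bounded_bilinear_scaleR])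

lemma smooth_on_mult:
  fixes f g :: "'b::euclidean_space \<Rightarrow> real"
  shows "\<lbrakk>open S; smooth_on S f; smooth_on S g\<rbrakk> \<Longrightarrow> smooth_on S (\<lambda>u. f u * g u)"
  by (simp add: smooth_on_def Ck_on_bilinear[OF _ bounded_bilinear_mult])

lemma smooth_on_inner:
  fixes f g :: "'b::euclidean_space \<Rightarrow> 'c::real_inner"
  shows "\<lbrakk>open S; smooth_on S f; smooth_on S g\<rbrakk> \<Longrightarrow> smooth_on S (\<lambda>u. f u \<bullet> g u)"
  by (simp add: smooth_on_def Ck_on_bilinear[OF _ bounded_bilinear_inner])

lemma smooth_on_sum:
  "\<lbrakk>open S; \<And>i. i \<in> I \<Longrightarrow> smooth_on S (f i)\<rbrakk> \<Longrightarrow> smooth_on S (\<lambda>u. \<Sum>i\<in>I. f i u)"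
  by (simp add: smooth_on_def Ck_on_sum)

lemma smooth_on_compose:
  fixes f :: "'b::euclidean_space \<Rightarrow> 'd::euclidean_space" and g :: "'d \<Rightarrow> 'c::real_normed_vector"
  shows "\<lbrakk>open S; open T; f ` S \<subseteq> T; smooth_on S f; smooth_on T g\<rbrakk> \<Longrightarrow> smooth_on S (\<lambda>u. g (f u))"
  by (simp add: smooth_on_def Ck_on_compose[of S T f])

lemma smooth_on_differentiable: "\<lbrakk>open S; smooth_on S f; x \<in> S\<rbrakk> \<Longrightarrow> f differentiable at x"
  unfolding smooth_on_def by (drule spec[of _ "Suc 0"]) (simp add: differentiable_on_eq_differentiable_at)

lemma smooth_on_frechet: "smooth_on S f \<Longrightarrow> smooth_on S (\<lambda>u. frechet_derivative f (at u) v)"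
  unfolding smooth_on_def
proof
  fix k assume "\<forall>k. Ck_on k S f"
  from spec[OF this, of "Suc k"] show "Ck_on k S (\<lambda>u. frechet_derivative f (at u) v)"
    by simp
qed

lemma smooth_on_continuous_on: "smooth_on S f \<Longrightarrow> continuous_on S f"
  unfolding smooth_on_def by (drule spec[of _ 0]) simp

subsection \<open>Symmetry of second derivatives\<close>

text \<open>
  Two applications of the mean value theorem express the second difference of \<open>f\<close> along \<open>a\<close> and \<open>b\<close>
  by an iterated derivative at a nearby point.  The second difference is symmetric in \<open>a\<close> and \<open>b\<close>, so
  the iterated derivatives in both orders agree by continuity.
\<close>

lemma second_difference_mean_value:
  fixes f :: "'b::euclidean_space \<Rightarrow> real"
  assumes S: "open S" "smooth_on S f" and h: "0 < h"
    and sub: "\<And>s t. \<lbrakk>0 \<le> s; s \<le> h; 0 \<le> t; t \<le> h\<rbrakk> \<Longrightarrow> x + s *\<^sub>R a + t *\<^sub>R b \<in> S"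
  obtains s t where "0 \<le> s" "s \<le> h" "0 \<le> t" "t \<le> h"
    "f (x + h *\<^sub>R a + h *\<^sub>R b) - f (x + h *\<^sub>R a) - f (x + h *\<^sub>R b) + f x =
      h * h * frechet_derivative (\<lambda>u. frechet_derivative f (at u) a) (at (x + s *\<^sub>R a + t *\<^sub>R b)) b"
proof -
  let ?F = "\<lambda>u. frechet_derivative f (at u) a"
  have along: "((\<lambda>t. G (y + t *\<^sub>R c)) has_real_derivative
      frechet_derivative G (at (y + t *\<^sub>R c)) c) (at t)"
    if "smooth_on S G" "y + t *\<^sub>R c \<in> S" for G :: "'b \<Rightarrow> real" and y c t
  proof -
    have G: "(G has_derivative frechet_derivative G (at (y + t *\<^sub>R c))) (at (y + t *\<^sub>R c))"
      using smooth_on_differentiable[OF S(1) that] frechet_derivative_works by blast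
    have "((\<lambda>t. y + t *\<^sub>R c) has_derivative (\<lambda>t. t *\<^sub>R c)) (at t)"
      by (auto intro!: derivative_eq_intros)
    from diff_chain_at[OF this G]
    show ?thesis
      using linear_scale[OF has_derivative_linear[OF G]]
      by (auto simp: o_def has_field_derivative_def mult.commute elim!: has_derivative_eq_rhs)
  qed
  define G where "G s = f (x + h *\<^sub>R b + s *\<^sub>R a) - f (x + s *\<^sub>R a)" for s
  have "\<exists>s>0. s < h \<and> G h - G 0 = (h - 0) * (?F (x + h *\<^sub>R b + s *\<^sub>R a) - ?F (x + s *\<^sub>R a))"
  proof (rule MVT2[OF h])
    fix s assume "0 \<le> s" "s \<le> h"
    then have "x + h *\<^sub>R b + s *\<^sub>R a \<in> S" "x + s *\<^sub>R a \<in> S"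
      using sub[of s h] sub[of s 0] h by (simp_all add: algebra_simps)
    then show "(G has_real_derivative
        ?F (x + h *\<^sub>R b + s *\<^sub>R a) - ?F (x + s *\<^sub>R a)) (at s)"
      unfolding G_def by (intro DERIV_diff along S)
  qed
  then obtain s where s: "0 < s" "s < h"
    "f (x + h *\<^sub>R a + h *\<^sub>R b) - f (x + h *\<^sub>R a) - f (x + h *\<^sub>R b) + f x =
      h * (?F (x + s *\<^sub>R a + h *\<^sub>R b) - ?F (x + s *\<^sub>R a))"
    by (auto simp: G_def algebra_simps)
  have "\<exists>t>0. t < h \<and> ?F (x + s *\<^sub>R a + h *\<^sub>R b) - ?F (x + s *\<^sub>R a + 0 *\<^sub>R b) =
      (h - 0) * frechet_derivative ?F (at (x + s *\<^sub>R a + t *\<^sub>R b)) b"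
    using s sub by (intro MVT2[OF h] along smooth_on_frechet S) auto
  then obtain t where "0 < t" "t < h" "?F (x + s *\<^sub>R a + h *\<^sub>R b) - ?F (x + s *\<^sub>R a) =
      h * frechet_derivative ?F (at (x + s *\<^sub>R a + t *\<^sub>R b)) b"
    by auto
  with s show thesis
    by (intro that[of s t]) auto
qed

lemma symmetric_second_derivative_real:
  fixes f :: "'b::euclidean_space \<Rightarrow> real"
  assumes S: "open S" "smooth_on S f" "x \<in> S"
  shows "frechet_derivative (\<lambda>u. frechet_derivative f (at u) a) (at x) b =
    frechet_derivative (\<lambda>u. frechet_derivative f (at u) b) (at x) a"
proof (rule ccontr)
  define A where "A c d u = frechet_derivative (\<lambda>u. frechet_derivative f (at u) c) (at u) d" for c d u
  assume "\<not> ?thesis"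
  then have e: "0 < \<bar>A a b x - A b a x\<bar> / 2" (is "0 < ?e")
    by (simp add: A_def)
  have "isCont (A c d) x" for c d
    unfolding A_def using S
    by (metis continuous_on_eq_continuous_at smooth_on_continuous_on smooth_on_frechet)
  then obtain d1 d2 where d: "0 < d1" "0 < d2"
    "\<And>u. dist u x < d1 \<Longrightarrow> \<bar>A a b u - A a b x\<bar> < ?e"
    "\<And>u. dist u x < d2 \<Longrightarrow> \<bar>A b a u - A b a x\<bar> < ?e"
    unfolding continuous_at_eps_delta dist_real_def using e by metis
  obtain d3 where d3: "0 < d3" "ball x d3 \<subseteq> S"
    using S openE by blast
  define m where "m = min d1 (min d2 d3)"
  define h where "h = m / (norm a + norm b + 1)"
  have m: "0 < m"
    using d d3 by (simp add: m_def)
  have h: "0 < h"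
    using m by (simp add: h_def add_nonneg_pos)
  have near: "dist (x + s *\<^sub>R c + t *\<^sub>R d) x < m"
    if "0 \<le> s" "s \<le> h" "0 \<le> t" "t \<le> h" "norm c + norm d = norm a + norm b" for s t c d
  proof -
    have "dist (x + s *\<^sub>R c + t *\<^sub>R d) x \<le> s * norm c + t * norm d"
      using that norm_triangle_ineq[of "s *\<^sub>R c" "t *\<^sub>R d"] by (simp add: dist_norm add.assoc)
    also have "\<dots> \<le> h * (norm a + norm b)"
      using add_mono[OF mult_right_mono[OF that(2), of "norm c"] mult_right_mono[OF that(4), of "norm d"]]
      by (simp add: that(5)[symmetric] distrib_left)
    also have "\<dots> < h * (norm a + norm b + 1)"
      using h by simp
    also have "\<dots> = m"
      by (simp add: h_def) (smt (verit) norm_ge_zero)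
    finally show ?thesis .
  qed
  have inS: "x + s *\<^sub>R c + t *\<^sub>R d \<in> S"
    if "0 \<le> s" "s \<le> h" "0 \<le> t" "t \<le> h" "norm c + norm d = norm a + norm b" for s t c d
    using near[OF that] d3(2) by (auto simp: m_def dist_commute)
  obtain s t where st: "0 \<le> s" "s \<le> h" "0 \<le> t" "t \<le> h"
    "f (x + h *\<^sub>R a + h *\<^sub>R b) - f (x + h *\<^sub>R a) - f (x + h *\<^sub>R b) + f x =
      h * h * A a b (x + s *\<^sub>R a + t *\<^sub>R b)"
    unfolding A_def
    by (rule second_difference_mean_value[OF S(1,2) h, of x a b]) (auto intro: inS)
  obtain s' t' where st': "0 \<le> s'" "s' \<le> h" "0 \<le> t'" "t' \<le> h"
    "f (x + h *\<^sub>R b + h *\<^sub>R a) - f (x + h *\<^sub>R b) - f (x + h *\<^sub>R a) + f x =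
      h * h * A b a (x + s' *\<^sub>R b + t' *\<^sub>R a)"
    unfolding A_def
    by (rule second_difference_mean_value[OF S(1,2) h, of x b a]) (auto intro: inS)
  have "h * h * A a b (x + s *\<^sub>R a + t *\<^sub>R b) = h * h * A b a (x + s' *\<^sub>R b + t' *\<^sub>R a)"
    using st(5) st'(5) by (simp add: algebra_simps)
  then have eq: "A a b (x + s *\<^sub>R a + t *\<^sub>R b) = A b a (x + s' *\<^sub>R b + t' *\<^sub>R a)" (is "?y = ?z")
    using h by simp
  have "\<bar>?y - A a b x\<bar> < ?e"
    by (rule d(3)) (use near[OF st(1-4)] in \<open>simp add: m_def\<close>)
  moreover have "\<bar>?z - A b a x\<bar> < ?e"
    by (rule d(4)) (use near[OF st'(1-4)] in \<open>simp add: m_def\<close>)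
  ultimately have "\<bar>?z - A a b x\<bar> + \<bar>?z - A b a x\<bar> < ?e + ?e"
    unfolding eq by (rule add_strict_mono)
  moreover have "\<bar>A a b x - A b a x\<bar> \<le> \<bar>?z - A a b x\<bar> + \<bar>?z - A b a x\<bar>"
    by simp
  ultimately show False
    by simp
qed

lemma symmetric_second_derivative:
  fixes f :: "'b::euclidean_space \<Rightarrow> 'c::euclidean_space"
  assumes S: "open S" "smooth_on S f" "x \<in> S"
  shows "frechet_derivative (\<lambda>u. frechet_derivative f (at u) a) (at x) b =
    frechet_derivative (\<lambda>u. frechet_derivative f (at u) b) (at x) a"
proof (rule euclidean_eqI)
  fix i :: 'c
  have inner: "frechet_derivative (\<lambda>u. G u \<bullet> i) (at u) v = frechet_derivative G (at u) v \<bullet> i"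
    if "smooth_on S G" "u \<in> S" for G :: "'b \<Rightarrow> 'c" and u v
  proof -
    have "((\<lambda>u. G u \<bullet> i) has_derivative (\<lambda>v. frechet_derivative G (at u) v \<bullet> i)) (at u)"
      using smooth_on_differentiable[OF S(1) that]
      by (auto simp: frechet_derivative_works intro: has_derivative_inner_left)
    from fun_cong[OF frechet_derivative_at[OF this], of v] show ?thesis
      by simp
  qed
  have "frechet_derivative (\<lambda>u. frechet_derivative f (at u) c) (at x) d \<bullet> i =
      frechet_derivative (\<lambda>u. frechet_derivative (\<lambda>u. f u \<bullet> i) (at u) c) (at x) d" for c d
  proof -
    have "frechet_derivative (\<lambda>u. frechet_derivative (\<lambda>u. f u \<bullet> i) (at u) c) (at x) =
        frechet_derivative (\<lambda>u. frechet_derivative f (at u) c \<bullet> i) (at x)"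
      using S inner by (intro frechet_derivative_cong_open[of S]) auto
    then show ?thesis
      using inner[OF smooth_on_frechet[OF S(2)] S(3)] by simp
  qed
  then show "frechet_derivative (\<lambda>u. frechet_derivative f (at u) a) (at x) b \<bullet> i =
      frechet_derivative (\<lambda>u. frechet_derivative f (at u) b) (at x) a \<bullet> i"
    using symmetric_second_derivative_real[of S "\<lambda>u. f u \<bullet> i" x a b] S
    by (simp add: smooth_on_inner smooth_on_const)
qed

section \<open>Bump functions\<close>

text \<open>
  The function \<open>t\<^sup>-\<^sup>n e\<^sup>-\<^sup>1\<^sup>/\<^sup>t\<close> for \<open>t > 0\<close>, extended by \<open>0\<close>.  The exponent \<open>n\<close> makes the family closed
  under differentiation up to linear combinations.
\<close>

definition flat_exp :: "nat \<Rightarrow> real \<Rightarrow> real"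
  where "flat_exp n t = (if t \<le> 0 then 0 else inverse t ^ n * exp (- inverse t))"

lemma flat_exp_tendsto_0: "(flat_exp n \<longlongrightarrow> 0) (at 0)"
proof (rule filterlim_split_at)
  show "(flat_exp n \<longlongrightarrow> 0) (at_left 0)"
    by (rule tendsto_eventually)
      (auto simp: eventually_at_filter flat_exp_def intro: always_eventually)
  have "((\<lambda>t. inverse t ^ n / exp (inverse t)) \<longlongrightarrow> (0::real)) (at_right 0)"
    by (rule filterlim_compose[OF tendsto_power_div_exp_0 filterlim_inverse_at_top_right])
  then show "(flat_exp n \<longlongrightarrow> 0) (at_right 0)"
  proof (rule Lim_transform_eventually)
    show "\<forall>\<^sub>F t in at_right 0. inverse t ^ n / exp (inverse t) = flat_exp n t"
      by (auto simp: eventually_at_filter flat_exp_def exp_minus divide_inverse intro: always_eventually)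
  qed
qed

lemma DERIV_flat_exp:
  "(flat_exp n has_real_derivative flat_exp (n + 2) t - of_nat n * flat_exp (n + 1) t) (at t)"
proof -
  consider "t < 0" | "t = 0" | "0 < t"
    by linarith
  then show ?thesis
  proof cases
    case 1
    have "((\<lambda>t. 0) has_real_derivative 0) (at t)"
      by simp
    then have "(flat_exp n has_real_derivative 0) (at t)"
      by (rule has_field_derivative_transform_within_open[where S = "{..<0}"])
        (use 1 in \<open>auto simp: flat_exp_def\<close>)
    then show ?thesis
      using 1 by (simp add: flat_exp_def)
  next
    case 2
    have "((\<lambda>y. (flat_exp n y - flat_exp n 0) / (y - 0)) \<longlongrightarrow> 0) (at 0)"
      using flat_exp_tendsto_0[of "Suc n"]
    proof (rule Lim_transform_eventually)
      show "\<forall>\<^sub>F y in at 0. flat_exp (Suc n) y = (flat_exp n y - flat_exp n 0) / (y - 0)"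
        by (auto simp: eventually_at_filter flat_exp_def divide_inverse intro: always_eventually)
    qed
    then show ?thesis
      using 2 by (simp add: has_field_derivative_iff flat_exp_def)
  next
    case 3
    have "((\<lambda>t. inverse t ^ n * exp (- inverse t)) has_real_derivative
        inverse t ^ (n + 2) * exp (- inverse t) - of_nat n * (inverse t ^ (n + 1) * exp (- inverse t))) (at t)"
      using 3 by (auto intro!: derivative_eq_intros simp: power2_eq_square field_simps)
        (cases n; simp add: field_simps)
    then have "(flat_exp n has_real_derivative
        inverse t ^ (n + 2) * exp (- inverse t) - of_nat n * (inverse t ^ (n + 1) * exp (- inverse t))) (at t)"
      by (rule has_field_derivative_transform_within_open[where S = "{0<..}"])
        (use 3 in \<open>auto simp: flat_exp_def\<close>)
    then show ?thesis
      using 3 by (simp add: flat_exp_def)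
  qed
qed

lemma smooth_flat_exp: "smooth_on UNIV (flat_exp n)"
proof -
  have "Ck_on k UNIV (flat_exp n)" for k n
  proof (induction k arbitrary: n)
    case 0
    show ?case
      unfolding Ck_on.simps
      by (intro continuous_at_imp_continuous_on ballI DERIV_isCont[OF DERIV_flat_exp])
  next
    case (Suc k)
    have D: "(flat_exp n has_derivative
        (*) (flat_exp (n + 2) u - of_nat n * flat_exp (n + 1) u)) (at u)" for u
      using DERIV_flat_exp[of n u] by (simp add: has_field_derivative_def)
    have "Ck_on k UNIV (\<lambda>u. frechet_derivative (flat_exp n) (at u) v)" for v
    proof -
      have "Ck_on k UNIV (\<lambda>u. v * flat_exp (n + 2) u + (- v * of_nat n) * flat_exp (n + 1) u)"
        by (intro Ck_on_add Ck_on_bounded_linear[OF _ bounded_linear_mult_right] Suc) simp_all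
      also have "(\<lambda>u. v * flat_exp (n + 2) u + (- v * of_nat n) * flat_exp (n + 1) u) =
          (\<lambda>u. frechet_derivative (flat_exp n) (at u) v)"
        unfolding frechet_derivative_at[OF D, symmetric] by (simp add: algebra_simps)
      finally show ?thesis .
    qed
    moreover have "flat_exp n differentiable_on UNIV"
      using D by (auto simp: differentiable_on_def differentiable_def)
    ultimately show ?case
      by simp
  qed
  then show ?thesis
    by (simp add: smooth_on_def)
qed

text \<open>
  The bump function is \<open>1\<close> at its centre only, not in a neighbourhood of it.
\<close>

lemma euclidean_bump:
  fixes a :: "'b::euclidean_space"
  assumes "0 < \<epsilon>"
  obtains \<psi> :: "'b \<Rightarrow> real" where "smooth_on UNIV \<psi>" "\<psi> a = 1" "\<And>u. u \<notin> ball a \<epsilon> \<Longrightarrow> \<psi> u = 0"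
    "(\<psi> has_derivative (\<lambda>v. 0)) (at a)"
proof
  define \<psi> where "\<psi> u = exp (inverse (\<epsilon>\<^sup>2)) * flat_exp 0 (\<epsilon>\<^sup>2 - (u - a) \<bullet> (u - a))" for u
  have "smooth_on UNIV (\<lambda>u::'b. u + (- a))"
    by (intro smooth_on_add smooth_on_ident smooth_on_const) simp
  then have d: "smooth_on UNIV (\<lambda>u::'b. u - a)"
    by simp
  have "smooth_on UNIV (\<lambda>u. \<epsilon>\<^sup>2 + (- 1) * ((u - a) \<bullet> (u - a)))"
    by (intro smooth_on_add smooth_on_mult smooth_on_inner smooth_on_const d) simp_all
  then have "smooth_on UNIV (\<lambda>u. \<epsilon>\<^sup>2 - (u - a) \<bullet> (u - a))"
    by simp
  then have "smooth_on UNIV (\<lambda>u. flat_exp 0 (\<epsilon>\<^sup>2 - (u - a) \<bullet> (u - a)))"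
    by (intro smooth_on_compose[of UNIV UNIV "\<lambda>u. \<epsilon>\<^sup>2 - (u - a) \<bullet> (u - a)" "flat_exp 0"] smooth_flat_exp)
      simp_all
  then show "smooth_on UNIV \<psi>"
    unfolding \<psi>_def by (intro smooth_on_mult smooth_on_const) simp_all
  show "\<psi> a = 1"
    using assms by (simp add: \<psi>_def flat_exp_def exp_minus)
  show "\<psi> u = 0" if "u \<notin> ball a \<epsilon>" for u
  proof -
    have "\<epsilon> \<le> norm (u - a)"
      using that by (simp add: dist_norm norm_minus_commute)
    then have "\<epsilon>\<^sup>2 \<le> (norm (u - a))\<^sup>2"
      using assms by (intro power_mono) simp_all
    then show ?thesis
      by (simp add: \<psi>_def flat_exp_def power2_norm_eq_inner)
  qed
  obtain D where "(flat_exp 0 has_real_derivative D) (at (\<epsilon>\<^sup>2 - (a - a) \<bullet> (a - a)))"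
    using DERIV_flat_exp by blast
  then have F: "(flat_exp 0 has_derivative (*) D) (at (\<epsilon>\<^sup>2 - (a - a) \<bullet> (a - a)))"
    by (simp add: has_field_derivative_def)
  have "((\<lambda>u. \<epsilon>\<^sup>2 - (u - a) \<bullet> (u - a)) has_derivative (\<lambda>v. 0)) (at a)"
    by (auto intro!: derivative_eq_intros)
  from diff_chain_at[OF this F]
  have "((\<lambda>u. flat_exp 0 (\<epsilon>\<^sup>2 - (u - a) \<bullet> (u - a))) has_derivative (\<lambda>v. 0)) (at a)"
    by (simp add: o_def)
  from has_derivative_mult_right[OF this, of "exp (inverse (\<epsilon>\<^sup>2))"]
  show "(\<psi> has_derivative (\<lambda>v. 0)) (at a)"
    by (simp add: \<psi>_def[abs_def])
qed

section \<open>Manifolds and inclusions\<close>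

lemma smooth_manifold_chart:
  assumes "smooth_manifold M" "c \<in> atlas M"
  shows "openin (mtop M) (fst c)" "open (snd c ` fst c)"
    "homeomorphic_map (subtopology (mtop M) (fst c)) (top_of_set (snd c ` fst c)) (snd c)"
  using assms by (auto simp: smooth_manifold_def)

lemma chart_subset_points:
  "\<lbrakk>smooth_manifold M; c \<in> atlas M\<rbrakk> \<Longrightarrow> fst c \<subseteq> points M"
  by (simp add: openin_subset smooth_manifold_chart)

lemma chart_inj_on:
  assumes "smooth_manifold M" "c \<in> atlas M"
  shows "inj_on (snd c) (fst c)"
  using homeomorphic_imp_injective_map[OF smooth_manifold_chart(3)[OF assms]]
    chart_subset_points[OF assms] by (simp add: Int_absorb1)

lemma chart_inv_chart [simp]:
  "\<lbrakk>smooth_manifold M; c \<in> atlas M; x \<in> fst c\<rbrakk> \<Longrightarrow> chart_inv c (snd c x) = x"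
  by (simp add: chart_inv_def chart_inj_on inv_into_f_f)

lemma chart_image_open:
  assumes "smooth_manifold M" "c \<in> atlas M" "openin (mtop M) Q" "Q \<subseteq> fst c"
  shows "open (snd c ` Q)"
proof -
  have "openin (subtopology (mtop M) (fst c)) Q"
    using assms by (metis openin_subtopology inf.absorb1)
  then have "openin (top_of_set (snd c ` fst c)) (snd c ` Q)"
    using homeomorphic_imp_open_map[OF smooth_manifold_chart(3)[OF assms(1,2)]]
    by (simp add: open_map_def)
  then show ?thesis
    using openin_open_trans smooth_manifold_chart(2)[OF assms(1,2)] by blast
qed

lemma chart_inv_compactin:
  assumes "smooth_manifold M" "c \<in> atlas M" "compact K" "K \<subseteq> snd c ` fst c"
  shows "compactin (mtop M) {x \<in> fst c. snd c x \<in> K}"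
proof -
  obtain f where f: "homeomorphic_maps (subtopology (mtop M) (fst c)) (top_of_set (snd c ` fst c)) (snd c) f"
    using smooth_manifold_chart(3)[OF assms(1,2)] homeomorphic_map_maps by blast
  have ts: "topspace (subtopology (mtop M) (fst c)) = fst c"
    using chart_subset_points[OF assms(1,2)] by auto
  have "compactin (top_of_set (snd c ` fst c)) K"
    using assms(3,4) by (simp add: compactin_subtopology)
  then have "compactin (subtopology (mtop M) (fst c)) (f ` K)"
    using f image_compactin unfolding homeomorphic_maps_def by blast
  moreover have "f ` K = {x \<in> fst c. snd c x \<in> K}"
    using f assms(4) unfolding homeomorphic_maps_def ts
    by (auto simp: image_iff continuous_map_def ts) (metis imageE subsetD)+
  ultimately show ?thesis
    by (simp add: compactin_subtopology)
qed

lemma charts_atD: "c \<in> charts_at M x \<Longrightarrow> c \<in> atlas M" "c \<in> charts_at M x \<Longrightarrow> x \<in> fst c"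
  by (simp_all add: charts_at_def)

lemma charts_atI: "\<lbrakk>c \<in> atlas M; x \<in> fst c\<rbrakk> \<Longrightarrow> c \<in> charts_at M x"
  by (simp add: charts_at_def)

lemma charts_at_points:
  assumes "smooth_manifold M" "c \<in> charts_at M x"
  shows "x \<in> points M"
  using chart_subset_points[OF assms(1) charts_atD(1)[OF assms(2)]] charts_atD(2)[OF assms(2)]
  by blast

lemma chart_at_in:
  assumes "smooth_manifold M" "x \<in> points M"
  shows "chart_at M x \<in> charts_at M x"
proof -
  have "(\<Union>c\<in>atlas M. fst c) = points M"
    using assms(1) unfolding smooth_manifold_def by blast
  then obtain c where "c \<in> atlas M" "x \<in> fst c"
    using assms(2) by blast
  then have "\<exists>c. c \<in> charts_at M x"
    by (blast intro: charts_atI)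
  then show ?thesis
    unfolding chart_at_def by (rule someI_ex)
qed

text \<open>
  The inclusion of \<open>N\<close> into \<open>M\<close> is smooth, not necessarily an immersion.  Since it covers the case
  \<open>N = M\<close>, the chain rule for the inclusion contains the one for a change of charts.
\<close>

definition smooth_inclusion ::
    "('a, 'm::euclidean_space) mfd \<Rightarrow> ('a, 'e::euclidean_space) mfd \<Rightarrow> bool"
  where "smooth_inclusion N M \<longleftrightarrow>
    smooth_manifold N \<and> smooth_manifold M \<and> points N \<subseteq> points M \<and>
    continuous_map (mtop N) (mtop M) (\<lambda>x. x) \<and>
    (\<forall>c\<in>atlas N. \<forall>k\<in>atlas M. smooth_on (snd c ` (fst c \<inter> fst k)) (snd k \<circ> chart_inv c))"

lemma smooth_inclusion_refl: "smooth_manifold M \<Longrightarrow> smooth_inclusion M M"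
  by (auto simp: smooth_inclusion_def smooth_manifold_def)

lemma submanifold_imp_smooth_inclusion: "submanifold N M \<Longrightarrow> smooth_inclusion N M"
  by (simp add: smooth_inclusion_def submanifold_def)

lemma smooth_inclusion_manifold:
  "smooth_inclusion N M \<Longrightarrow> smooth_manifold N" "smooth_inclusion N M \<Longrightarrow> smooth_manifold M"
  "smooth_inclusion N M \<Longrightarrow> points N \<subseteq> points M"
  by (simp_all add: smooth_inclusion_def)

lemma smooth_inclusion_openin:
  assumes "smooth_inclusion N M" "openin (mtop M) Q"
  shows "openin (mtop N) (points N \<inter> Q)"
proof -
  have "openin (mtop N) {x \<in> points N. x \<in> Q}"
    using assms by (simp add: smooth_inclusion_def continuous_map_def)
  then show ?thesis
    by (simp add: Int_def)
qed

lemma smooth_inclusion_openin_chart: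
  assumes "smooth_inclusion N M" "openin (mtop N) Q" "k \<in> atlas M"
  shows "openin (mtop N) (Q \<inter> fst k)"
proof -
  have "openin (mtop N) (Q \<inter> (points N \<inter> fst k))"
    using assms smooth_inclusion_openin smooth_manifold_chart(1) smooth_inclusion_manifold(2)
    by blast
  moreover have "Q \<inter> (points N \<inter> fst k) = Q \<inter> fst k"
    using assms(2) openin_subset by auto
  ultimately show ?thesis
    by simp
qed

lemma smooth_inclusion_transition:
  assumes "smooth_inclusion N M" "c \<in> atlas N" "k \<in> atlas M"
  shows "open (snd c ` (fst c \<inter> fst k))"
    "smooth_on (snd c ` (fst c \<inter> fst k)) (snd k \<circ> chart_inv c)"
    "(snd k \<circ> chart_inv c) ` (snd c ` (fst c \<inter> fst k)) \<subseteq> snd k ` fst k"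
proof -
  show "open (snd c ` (fst c \<inter> fst k))"
    using assms
    by (intro chart_image_open[of N c] smooth_inclusion_openin_chart[of N M] smooth_manifold_chart(1))
      (auto dest: smooth_inclusion_manifold)
  show "smooth_on (snd c ` (fst c \<inter> fst k)) (snd k \<circ> chart_inv c)"
    using assms by (simp add: smooth_inclusion_def)
  show "(snd k \<circ> chart_inv c) ` (snd c ` (fst c \<inter> fst k)) \<subseteq> snd k ` fst k"
  proof -
    have "(snd k \<circ> chart_inv c) (snd c y) \<in> snd k ` fst k" if "y \<in> fst c" "y \<in> fst k" for y
      using that assms(2) smooth_inclusion_manifold(1)[OF assms(1)] by simp
    then show ?thesis
      by blast
  qed
qed

text \<open>Chain rule for the restriction to \<open>N\<close> of a function on \<open>M\<close>.\<close>

lemma inclusion_chain: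
  assumes inc: "smooth_inclusion N M" and c: "c \<in> charts_at N x" and k: "k \<in> charts_at M x"
    and F: "((f \<circ> chart_inv k) has_derivative F) (at (snd k x))"
  shows "((f \<circ> chart_inv c) has_derivative
    (\<lambda>v. F (frechet_derivative (snd k \<circ> chart_inv c) (at (snd c x)) v))) (at (snd c x))"
proof -
  note ck = charts_atD(1)[OF c] charts_atD(1)[OF k]
  note xck = charts_atD(2)[OF c] charts_atD(2)[OF k]
  note mf = smooth_inclusion_manifold[OF inc]
  note tr = smooth_inclusion_transition[OF inc ck]
  have x: "snd c x \<in> snd c ` (fst c \<inter> fst k)"
    using xck by simp
  have T: "((snd k \<circ> chart_inv c) has_derivative
      frechet_derivative (snd k \<circ> chart_inv c) (at (snd c x))) (at (snd c x))"
    using smooth_on_differentiable[OF tr(1,2) x] by (simp only: frechet_derivative_works)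
  have x': "(snd k \<circ> chart_inv c) (snd c x) = snd k x"
    using mf ck xck by simp
  have "((f \<circ> chart_inv k \<circ> (snd k \<circ> chart_inv c)) has_derivative
      (F \<circ> frechet_derivative (snd k \<circ> chart_inv c) (at (snd c x)))) (at (snd c x))"
    by (rule diff_chain_at[OF T]) (simp only: x' F)
  then have "((f \<circ> chart_inv c) has_derivative
      (F \<circ> frechet_derivative (snd k \<circ> chart_inv c) (at (snd c x)))) (at (snd c x))"
    by (rule has_derivative_transform_within_open[OF _ tr(1) x]) (use mf ck in auto)
  then show ?thesis
    by (simp add: o_def)
qed

lemma inclusion_transition_compose:
  assumes "smooth_inclusion N M" "c \<in> charts_at N x" "k \<in> charts_at M x" "k' \<in> charts_at M x"
  shows "frechet_derivative (snd k' \<circ> chart_inv c) (at (snd c x)) v =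
    frechet_derivative (snd k' \<circ> chart_inv k) (at (snd k x))
      (frechet_derivative (snd k \<circ> chart_inv c) (at (snd c x)) v)"
proof -
  have "(snd k' \<circ> chart_inv k) differentiable at (snd k x)"
    using smooth_inclusion_transition[OF smooth_inclusion_refl, of M k k'] assms
    by (intro smooth_on_differentiable[of "snd k ` (fst k \<inter> fst k')"])
      (auto dest: charts_atD smooth_inclusion_manifold)
  then have "((snd k' \<circ> chart_inv k) has_derivative
      frechet_derivative (snd k' \<circ> chart_inv k) (at (snd k x))) (at (snd k x))"
    by (simp only: frechet_derivative_works)
  from frechet_derivative_at[OF inclusion_chain[OF assms(1-3) this]] show ?thesis
    by (rule fun_cong[symmetric])
qed

lemma transition_linear:
  assumes "smooth_inclusion N M" "c \<in> charts_at N x" "k \<in> charts_at M x"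
  shows "linear (frechet_derivative (snd k \<circ> chart_inv c) (at (snd c x)))"
  using smooth_inclusion_transition[OF assms(1), of c k] assms
  by (intro linear_frechet_derivative smooth_on_differentiable[of "snd c ` (fst c \<inter> fst k)"])
    (auto dest: charts_atD)

lemma transition_self:
  assumes "smooth_manifold M" "c \<in> charts_at M x"
  shows "frechet_derivative (snd c \<circ> chart_inv c) (at (snd c x)) v = v"
proof -
  have "frechet_derivative (snd c \<circ> chart_inv c) (at (snd c x)) =
      frechet_derivative (\<lambda>u. u) (at (snd c x))"
    using assms smooth_manifold_chart(2)[OF assms(1)]
    by (intro frechet_derivative_cong_open[of "snd c ` fst c"]) (auto dest: charts_atD)
  then show ?thesis
    by simp
qed

subsection \<open>Tangent vectors\<close>

lemma tangent_spaceI: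
  assumes "\<And>c. c \<notin> charts_at M x \<Longrightarrow> v c = 0"
    and "\<And>c c'. \<lbrakk>c \<in> charts_at M x; c' \<in> charts_at M x\<rbrakk> \<Longrightarrow>
      v c' = frechet_derivative (snd c' \<circ> chart_inv c) (at (snd c x)) (v c)"
  shows "v \<in> tangent_space M x"
  unfolding tangent_space_def using assms by blast

lemma tangent_space_transition:
  "\<lbrakk>v \<in> tangent_space M x; c \<in> charts_at M x; c' \<in> charts_at M x\<rbrakk> \<Longrightarrow>
    v c' = frechet_derivative (snd c' \<circ> chart_inv c) (at (snd c x)) (v c)"
  unfolding tangent_space_def by blast

lemma tangent_space_outside:
  "\<lbrakk>v \<in> tangent_space M x; c \<notin> charts_at M x\<rbrakk> \<Longrightarrow> v c = 0"
  unfolding tangent_space_def by blast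

lemma coord_vec_in_tangent_space:
  assumes "smooth_manifold M" "c \<in> charts_at M x"
  shows "coord_vec M c x e \<in> tangent_space M x"
proof (rule tangent_spaceI)
  show "coord_vec M c x e c' = 0" if "c' \<notin> charts_at M x" for c'
    using that by (simp add: coord_vec_def)
  show "coord_vec M c x e c'' =
      frechet_derivative (snd c'' \<circ> chart_inv c') (at (snd c' x)) (coord_vec M c x e c')"
    if "c' \<in> charts_at M x" "c'' \<in> charts_at M x" for c' c''
    unfolding coord_vec_def if_P[OF that(1)] if_P[OF that(2)]
    by (rule inclusion_transition_compose[OF smooth_inclusion_refl[OF assms(1)] assms(2) that])
qed

lemma coord_vec_self:
  assumes "smooth_manifold M" "c \<in> charts_at M x"
  shows "coord_vec M c x e c = e"
  using assms by (simp add: coord_vec_def transition_self)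

lemma coord_vec_component:
  assumes "v \<in> tangent_space M x" "c \<in> charts_at M x"
  shows "coord_vec M c x (v c) = v"
proof
  fix c'
  show "coord_vec M c x (v c) c' = v c'"
  proof (cases "c' \<in> charts_at M x")
    case True
    then show ?thesis
      unfolding coord_vec_def if_P[OF True] by (rule tangent_space_transition[OF assms, symmetric])
  next
    case False
    then show ?thesis
      by (simp add: coord_vec_def tangent_space_outside[OF assms(1)])
  qed
qed

lemma tangent_space_eqI:
  assumes "v \<in> tangent_space M x" "w \<in> tangent_space M x" "c \<in> charts_at M x" "v c = w c"
  shows "v = w"
  by (rule box_equals[OF arg_cong[OF assms(4), of "coord_vec M c x"]
      coord_vec_component[OF assms(1,3)] coord_vec_component[OF assms(2,3)]])

lemma subspace_tangent_space:
  assumes "smooth_manifold M"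
  shows "subspace (tangent_space M x)"
  unfolding subspace_def
proof (intro conjI ballI allI)
  note lin = transition_linear[OF smooth_inclusion_refl[OF assms]]
  show "0 \<in> tangent_space M x"
    by (rule tangent_spaceI) (simp_all add: linear_0[OF lin])
  show "v + w \<in> tangent_space M x" if "v \<in> tangent_space M x" "w \<in> tangent_space M x" for v w
  proof (rule tangent_spaceI)
    show "(v + w) c = 0" if "c \<notin> charts_at M x" for c
      using \<open>v \<in> _\<close> \<open>w \<in> _\<close> that by (simp add: tangent_space_outside)
    show "(v + w) c' = frechet_derivative (snd c' \<circ> chart_inv c) (at (snd c x)) ((v + w) c)"
      if "c \<in> charts_at M x" "c' \<in> charts_at M x" for c c'
      using tangent_space_transition[OF \<open>v \<in> _\<close> that] tangent_space_transition[OF \<open>w \<in> _\<close> that]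
      by (simp only: plus_fun_apply linear_add[OF lin[OF that]])
  qed
  show "a *\<^sub>R v \<in> tangent_space M x" if "v \<in> tangent_space M x" for v a
  proof (rule tangent_spaceI)
    show "(a *\<^sub>R v) c = 0" if "c \<notin> charts_at M x" for c
      using \<open>v \<in> _\<close> that by (simp add: scaleR_fun_def tangent_space_outside)
    show "(a *\<^sub>R v) c' = frechet_derivative (snd c' \<circ> chart_inv c) (at (snd c x)) ((a *\<^sub>R v) c)"
      if "c \<in> charts_at M x" "c' \<in> charts_at M x" for c c'
      using tangent_space_transition[OF \<open>v \<in> _\<close> that]
      by (simp only: scaleR_fun_def linear_scale[OF lin[OF that]])
  qed
qed

lemma linear_coord_vec:
  assumes "smooth_manifold M" "c \<in> charts_at M x"
  shows "linear (coord_vec M c x)"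
  using transition_linear[OF smooth_inclusion_refl[OF assms(1)] assms(2)]
  by (intro linearI)
    (auto simp: coord_vec_def fun_eq_iff scaleR_fun_def linear_add linear_scale)

subsection \<open>Directional derivatives\<close>

lemma dir_deriv_eq:
  assumes "((f \<circ> chart_inv (chart_at N x)) has_derivative F) (at (snd (chart_at N x) x))"
  shows "dir_deriv N x w f = F (w (chart_at N x))"
  using frechet_derivative_at[OF assms] by (simp add: dir_deriv_def Let_def)

lemma push_component:
  assumes inc: "smooth_inclusion N M" and w: "w \<in> tangent_space N x"
    and c: "c \<in> charts_at N x" and k: "k \<in> charts_at M x"
  shows "push N M x w k = frechet_derivative (snd k \<circ> chart_inv c) (at (snd c x)) (w c)"
proof -
  have N: "smooth_manifold N"
    using inc by (rule smooth_inclusion_manifold)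
  have "x \<in> points N"
    by (rule charts_at_points[OF N c])
  then have c0: "chart_at N x \<in> charts_at N x"
    by (rule chart_at_in[OF N])
  let ?c = "chart_at N x"
  have "(snd k \<circ> chart_inv c) differentiable at (snd c x)"
    using smooth_inclusion_transition[OF inc, of c k] c k
    by (intro smooth_on_differentiable[of "snd c ` (fst c \<inter> fst k)"]) (auto dest: charts_atD)
  then have "((snd k \<circ> chart_inv c) has_derivative
      frechet_derivative (snd k \<circ> chart_inv c) (at (snd c x))) (at (snd c x))"
    by (simp only: frechet_derivative_works)
  note chain = inclusion_chain[OF smooth_inclusion_refl[OF N] c0 c this]
  show ?thesis
    using dir_deriv_eq[OF chain] tangent_space_transition[OF w c0 c] k by (simp add: push_def)
qed

lemma push_in_tangent_space:
  assumes inc: "smooth_inclusion N M" and x: "x \<in> points N" and w: "w \<in> tangent_space N x"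
  shows "push N M x w \<in> tangent_space M x"
proof -
  have c: "chart_at N x \<in> charts_at N x"
    using chart_at_in[OF smooth_inclusion_manifold(1)[OF inc] x] .
  show ?thesis
  proof (rule tangent_spaceI)
    show "push N M x w k = 0" if "k \<notin> charts_at M x" for k
      using that by (simp add: push_def)
    show "push N M x w k' = frechet_derivative (snd k' \<circ> chart_inv k) (at (snd k x)) (push N M x w k)"
      if "k \<in> charts_at M x" "k' \<in> charts_at M x" for k k'
      unfolding push_component[OF inc w c that(1)] push_component[OF inc w c that(2)]
      by (rule inclusion_transition_compose[OF inc c that])
  qed
qed

subsection \<open>Smooth functions on open subsets\<close>

text \<open>
  Smoothness on the open set \<open>Q\<close> of \<open>N\<close>, for functions with values in any normed space, so that it
  applies to the components of vector fields too.
\<close>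

definition smooth_fun_on ::
    "('a, 'm::euclidean_space) mfd \<Rightarrow> 'a set \<Rightarrow> ('a \<Rightarrow> 'c::real_normed_vector) \<Rightarrow> bool"
  where "smooth_fun_on N Q f \<longleftrightarrow> (\<forall>c\<in>atlas N. smooth_on (snd c ` (fst c \<inter> Q)) (f \<circ> chart_inv c))"

lemma smooth_fun_iff:
  assumes "smooth_manifold N"
  shows "smooth_fun N f \<longleftrightarrow> smooth_fun_on N (points N) f"
proof -
  have "fst c \<inter> points N = fst c" if "c \<in> atlas N" for c
    using chart_subset_points[OF assms that] by blast
  then show ?thesis
    by (simp add: smooth_fun_def smooth_fun_on_def)
qed

lemma smooth_along_iff:
  "smooth_along N M Q X \<longleftrightarrow> (\<forall>x\<in>Q. X x \<in> tangent_space M x) \<and>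
    (\<forall>k\<in>atlas M. smooth_fun_on N (fst k \<inter> Q) (\<lambda>y. X y k))"
  by (auto simp: smooth_along_def smooth_fun_on_def o_def Int_assoc)

lemma chart_inter_image_open:
  assumes "smooth_manifold N" "c \<in> atlas N" "openin (mtop N) Q"
  shows "open (snd c ` (fst c \<inter> Q))"
  using assms by (intro chart_image_open[of N]) (auto intro: smooth_manifold_chart(1))

lemma smooth_fun_on_cong:
  assumes "smooth_manifold N" "openin (mtop N) Q" "\<And>x. x \<in> Q \<Longrightarrow> f x = h x" "smooth_fun_on N Q f"
  shows "smooth_fun_on N Q h"
  unfolding smooth_fun_on_def
proof
  fix c assume c: "c \<in> atlas N"
  show "smooth_on (snd c ` (fst c \<inter> Q)) (h \<circ> chart_inv c)"
  proof (rule smooth_on_cong[OF chart_inter_image_open[OF assms(1) c assms(2)]])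
    show "smooth_on (snd c ` (fst c \<inter> Q)) (f \<circ> chart_inv c)"
      using assms(4) c by (simp add: smooth_fun_on_def)
    show "(f \<circ> chart_inv c) u = (h \<circ> chart_inv c) u" if "u \<in> snd c ` (fst c \<inter> Q)" for u
      using that assms(1,3) c by auto
  qed
qed

lemma smooth_fun_on_subset:
  assumes "smooth_fun_on N Q f" "P \<subseteq> Q"
  shows "smooth_fun_on N P f"
  unfolding smooth_fun_on_def
proof
  fix c assume "c \<in> atlas N"
  then have "smooth_on (snd c ` (fst c \<inter> Q)) (f \<circ> chart_inv c)"
    using assms(1) by (simp add: smooth_fun_on_def)
  then show "smooth_on (snd c ` (fst c \<inter> P)) (f \<circ> chart_inv c)"
    by (rule smooth_on_subset) (use assms(2) in blast)
qed

lemma smooth_fun_on_local: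
  assumes N: "smooth_manifold N" and Q: "openin (mtop N) Q"
    and loc: "\<And>x. x \<in> Q \<Longrightarrow> \<exists>P. openin (mtop N) P \<and> x \<in> P \<and> smooth_fun_on N (Q \<inter> P) f"
  shows "smooth_fun_on N Q f"
  unfolding smooth_fun_on_def
proof
  fix c assume c: "c \<in> atlas N"
  show "smooth_on (snd c ` (fst c \<inter> Q)) (f \<circ> chart_inv c)"
  proof (rule smooth_on_local[OF chart_inter_image_open[OF N c Q]])
    fix u assume "u \<in> snd c ` (fst c \<inter> Q)"
    then obtain x where x: "x \<in> fst c" "x \<in> Q" "u = snd c x"
      by auto
    then obtain P where P: "openin (mtop N) P" "x \<in> P" "smooth_fun_on N (Q \<inter> P) f"
      using loc by blast
    have "snd c ` (fst c \<inter> Q) \<inter> snd c ` (fst c \<inter> P) = snd c ` (fst c \<inter> (Q \<inter> P))"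
      using chart_inj_on[OF N c] by (auto simp: inj_on_def)
    then have "smooth_on (snd c ` (fst c \<inter> Q) \<inter> snd c ` (fst c \<inter> P)) (f \<circ> chart_inv c)"
      using P(3) c by (simp add: smooth_fun_on_def)
    moreover have "open (snd c ` (fst c \<inter> P))" "u \<in> snd c ` (fst c \<inter> P)"
      using chart_inter_image_open[OF N c P(1)] x P(2) by auto
    ultimately show "\<exists>T. open T \<and> u \<in> T \<and> smooth_on (snd c ` (fst c \<inter> Q) \<inter> T) (f \<circ> chart_inv c)"
      by blast
  qed
qed

lemma smooth_fun_on_restrict:
  assumes inc: "smooth_inclusion N M" and P: "openin (mtop N) P" and Q: "openin (mtop M) Q"
    and PQ: "P \<subseteq> Q" and f: "smooth_fun_on M Q f"
  shows "smooth_fun_on N P f"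
proof (rule smooth_fun_on_local[OF _ P])
  note mf = smooth_inclusion_manifold[OF inc]
  show "smooth_manifold N"
    by (rule mf)
  fix x assume x: "x \<in> P"
  then have "x \<in> points M"
    using P mf(3) openin_subset by blast
  then have "chart_at M x \<in> charts_at M x"
    by (rule chart_at_in[OF mf(2)])
  from charts_atD[OF this] obtain k where k: "k \<in> atlas M" "x \<in> fst k"
    by blast
  have "smooth_fun_on N (P \<inter> fst k) f"
    unfolding smooth_fun_on_def
  proof
    fix c assume c: "c \<in> atlas N"
    note tr = smooth_inclusion_transition[OF inc c k(1)]
    have op: "open (snd c ` (fst c \<inter> (P \<inter> fst k)))"
      by (intro chart_inter_image_open[OF mf(1) c] smooth_inclusion_openin_chart[OF inc] P k(1))
    have sub: "snd c ` (fst c \<inter> (P \<inter> fst k)) \<subseteq> snd c ` (fst c \<inter> fst k)"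
      by auto
    have "smooth_on (snd c ` (fst c \<inter> (P \<inter> fst k)))
        (\<lambda>u. (f \<circ> chart_inv k) ((snd k \<circ> chart_inv c) u))"
    proof (rule smooth_on_compose[OF op])
      show "open (snd k ` (fst k \<inter> Q))"
        by (rule chart_inter_image_open[OF mf(2) k(1) Q])
      show "smooth_on (snd k ` (fst k \<inter> Q)) (f \<circ> chart_inv k)"
        using f k by (simp add: smooth_fun_on_def)
      show "smooth_on (snd c ` (fst c \<inter> (P \<inter> fst k))) (snd k \<circ> chart_inv c)"
        by (rule smooth_on_subset[OF tr(2) sub])
      show "(snd k \<circ> chart_inv c) ` (snd c ` (fst c \<inter> (P \<inter> fst k))) \<subseteq> snd k ` (fst k \<inter> Q)"
        using PQ mf(1) c by auto
    qed
    then show "smooth_on (snd c ` (fst c \<inter> (P \<inter> fst k))) (f \<circ> chart_inv c)"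
      by (rule smooth_on_cong[OF op, rotated]) (use mf c k in auto)
  qed
  then show "\<exists>Pa. openin (mtop N) Pa \<and> x \<in> Pa \<and> smooth_fun_on N (P \<inter> Pa) f"
    using smooth_inclusion_openin_chart[OF inc P k(1)] x k(2)
    by (intro exI[of _ "P \<inter> fst k"]) (simp add: Int_assoc[symmetric])
qed

lemma smooth_fun_on_chart:
  assumes N: "smooth_manifold N" and k: "k \<in> atlas N"
    and Q: "openin (mtop N) Q" "Q \<subseteq> fst k" and F: "smooth_on (snd k ` Q) F"
  shows "smooth_fun_on N Q (\<lambda>y. F (snd k y))"
  unfolding smooth_fun_on_def
proof
  fix c assume c: "c \<in> atlas N"
  note tr = smooth_inclusion_transition[OF smooth_inclusion_refl[OF N] c k]
  have "smooth_on (snd c ` (fst c \<inter> Q)) (\<lambda>u. F ((snd k \<circ> chart_inv c) u))"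
  proof (rule smooth_on_compose[OF chart_inter_image_open[OF N c Q(1)] chart_image_open[OF N k Q] _ _ F])
    show "smooth_on (snd c ` (fst c \<inter> Q)) (snd k \<circ> chart_inv c)"
      by (rule smooth_on_subset[OF tr(2)]) (use Q(2) in blast)
    show "(snd k \<circ> chart_inv c) ` (snd c ` (fst c \<inter> Q)) \<subseteq> snd k ` Q"
      using N c by auto
  qed
  then show "smooth_on (snd c ` (fst c \<inter> Q)) ((\<lambda>y. F (snd k y)) \<circ> chart_inv c)"
    by (simp add: o_def)
qed

lemma smooth_fun_on_const: "smooth_fun_on N Q (\<lambda>y. a)"
  by (simp add: smooth_fun_on_def o_def smooth_on_const)

lemma smooth_fun_on_bounded_linear:
  assumes "smooth_manifold N" "openin (mtop N) Q" "bounded_linear L" "smooth_fun_on N Q f"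
  shows "smooth_fun_on N Q (\<lambda>y. L (f y))"
  unfolding smooth_fun_on_def o_def
  by (intro ballI smooth_on_bounded_linear[OF _ assms(3)] chart_inter_image_open[OF assms(1) _ assms(2)])
    (use assms(4) in \<open>auto simp: smooth_fun_on_def o_def\<close>)

lemma smooth_fun_on_add:
  assumes "smooth_manifold N" "openin (mtop N) Q" "smooth_fun_on N Q f" "smooth_fun_on N Q h"
  shows "smooth_fun_on N Q (\<lambda>y. f y + h y)"
  unfolding smooth_fun_on_def o_def
  by (intro ballI smooth_on_add chart_inter_image_open[OF assms(1) _ assms(2)])
    (use assms(3,4) in \<open>auto simp: smooth_fun_on_def o_def\<close>)

lemma smooth_fun_on_scaleR:
  assumes "smooth_manifold N" "openin (mtop N) Q" "smooth_fun_on N Q f" "smooth_fun_on N Q h"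
  shows "smooth_fun_on N Q (\<lambda>y. f y *\<^sub>R h y)"
  unfolding smooth_fun_on_def o_def
  by (intro ballI smooth_on_scaleR chart_inter_image_open[OF assms(1) _ assms(2)])
    (use assms(3,4) in \<open>auto simp: smooth_fun_on_def o_def\<close>)

lemma smooth_fun_on_sum:
  assumes "smooth_manifold N" "openin (mtop N) Q" "\<And>i. i \<in> I \<Longrightarrow> smooth_fun_on N Q (f i)"
  shows "smooth_fun_on N Q (\<lambda>y. \<Sum>i\<in>I. f i y)"
  unfolding smooth_fun_on_def o_def
  by (intro ballI smooth_on_sum chart_inter_image_open[OF assms(1) _ assms(2)])
    (use assms(3) in \<open>auto simp: smooth_fun_on_def o_def\<close>)

lemma smooth_fun_on_differentiable:
  assumes "smooth_manifold N" "openin (mtop N) Q" "smooth_fun_on N Q f" "x \<in> Q" "c \<in> charts_at N x"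
  shows "(f \<circ> chart_inv c) differentiable at (snd c x)"
  using assms chart_inter_image_open[OF assms(1) _ assms(2), of c]
  by (intro smooth_on_differentiable[of "snd c ` (fst c \<inter> Q)"])
    (auto simp: smooth_fun_on_def dest: charts_atD)

section \<open>Vector fields along a submanifold\<close>

lemma tangent_vector_expansion:
  assumes "smooth_manifold M" "v \<in> tangent_space M x" "k \<in> charts_at M x"
  shows "v = (\<Sum>b\<in>Basis. (v k \<bullet> b) *\<^sub>R coord_vec M k x b)"
  using linear_Basis_expansion[OF linear_coord_vec[OF assms(1,3)], of "v k"]
    coord_vec_component[OF assms(2,3)] by (rule box_equals[OF _ _ refl])

lemma smooth_alongD:
  assumes "smooth_along N M Q X"
  shows "x \<in> Q \<Longrightarrow> X x \<in> tangent_space M x"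
    "k \<in> atlas M \<Longrightarrow> smooth_fun_on N (fst k \<inter> Q) (\<lambda>y. X y k)"
  using assms unfolding smooth_along_iff by blast+

lemma smooth_alongI:
  assumes "\<And>x. x \<in> Q \<Longrightarrow> X x \<in> tangent_space M x"
    and "\<And>k. k \<in> atlas M \<Longrightarrow> smooth_fun_on N (fst k \<inter> Q) (\<lambda>y. X y k)"
  shows "smooth_along N M Q X"
  using assms unfolding smooth_along_iff by blast

text \<open>In the domain of a chart of \<open>M\<close> it suffices to look at the components in that chart.\<close>

lemma smooth_along_chartI:
  assumes inc: "smooth_inclusion N M" and Q: "openin (mtop N) Q" "Q \<subseteq> fst k" and k: "k \<in> atlas M"
    and X: "\<And>x. x \<in> Q \<Longrightarrow> X x \<in> tangent_space M x" and Xk: "smooth_fun_on N Q (\<lambda>y. X y k)"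
  shows "smooth_along N M Q X"
proof (rule smooth_alongI)
  note mf = smooth_inclusion_manifold[OF inc]
  fix k' assume k': "k' \<in> atlas M"
  note tr = smooth_inclusion_transition[OF smooth_inclusion_refl[OF mf(2)] k k']
  let ?P = "fst k' \<inter> Q"
  have P: "openin (mtop N) ?P"
    using smooth_inclusion_openin_chart[OF inc Q(1) k'] by (simp add: Int_commute)
  have kk': "openin (mtop M) (fst k \<inter> fst k')"
    using smooth_manifold_chart(1)[OF mf(2)] k k' by blast
  have "smooth_fun_on N ?P (\<lambda>y. frechet_derivative (snd k' \<circ> chart_inv k) (at (snd k y)) b)" for b
  proof (rule smooth_fun_on_restrict[OF inc P kk'])
    show "?P \<subseteq> fst k \<inter> fst k'"
      using Q(2) by blast
    show "smooth_fun_on M (fst k \<inter> fst k') (\<lambda>y. frechet_derivative (snd k' \<circ> chart_inv k) (at (snd k y)) b)"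
      by (rule smooth_fun_on_chart[OF mf(2) k kk' _ smooth_on_frechet[OF tr(2)]]) blast
  qed
  moreover have "smooth_fun_on N ?P (\<lambda>y. X y k \<bullet> b)" for b
    by (rule smooth_fun_on_bounded_linear[OF mf(1) P bounded_linear_inner_left])
      (rule smooth_fun_on_subset[OF Xk], blast)
  ultimately have "smooth_fun_on N ?P (\<lambda>y. \<Sum>b\<in>Basis. (X y k \<bullet> b) *\<^sub>R
      frechet_derivative (snd k' \<circ> chart_inv k) (at (snd k y)) b)"
    by (intro smooth_fun_on_sum smooth_fun_on_scaleR mf P)
  then show "smooth_fun_on N ?P (\<lambda>y. X y k')"
  proof (rule smooth_fun_on_cong[OF mf(1) P, rotated])
    fix x assume x: "x \<in> ?P"
    then have c: "k \<in> charts_at M x" "k' \<in> charts_at M x" and xQ: "x \<in> Q"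
      using Q(2) k k' by (auto intro: charts_atI)
    show "(\<Sum>b\<in>Basis. (X x k \<bullet> b) *\<^sub>R frechet_derivative (snd k' \<circ> chart_inv k) (at (snd k x)) b) = X x k'"
      unfolding tangent_space_transition[OF X[OF xQ] c]
      by (rule linear_Basis_expansion[symmetric])
        (rule transition_linear[OF smooth_inclusion_refl[OF mf(2)] c])
  qed
qed (rule X)

lemma smooth_along_local:
  assumes inc: "smooth_inclusion N M" and Q: "openin (mtop N) Q"
    and loc: "\<And>x. x \<in> Q \<Longrightarrow> \<exists>P. openin (mtop N) P \<and> x \<in> P \<and> smooth_along N M (Q \<inter> P) X"
  shows "smooth_along N M Q X"
proof (rule smooth_alongI)
  show "X x \<in> tangent_space M x" if "x \<in> Q" for x
  proof -
    from loc[OF that] obtain P where P: "x \<in> P" "smooth_along N M (Q \<inter> P) X"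
      by blast
    show ?thesis
      by (rule smooth_alongD(1)[OF P(2)]) (use that P(1) in blast)
  qed
  fix k assume k: "k \<in> atlas M"
  show "smooth_fun_on N (fst k \<inter> Q) (\<lambda>y. X y k)"
  proof (rule smooth_fun_on_local)
    show "smooth_manifold N"
      by (rule smooth_inclusion_manifold[OF inc])
    show "openin (mtop N) (fst k \<inter> Q)"
      using smooth_inclusion_openin_chart[OF inc Q k] by (simp add: Int_commute)
    fix x assume "x \<in> fst k \<inter> Q"
    then obtain P where P: "openin (mtop N) P" "x \<in> P" "smooth_along N M (Q \<inter> P) X"
      using loc by blast
    from smooth_alongD(2)[OF P(3) k] P(1,2)
    show "\<exists>P. openin (mtop N) P \<and> x \<in> P \<and> smooth_fun_on N (fst k \<inter> Q \<inter> P) (\<lambda>y. X y k)"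
      by (intro exI[of _ P]) (simp add: Int_assoc)
  qed
qed

lemma smooth_along_cong:
  assumes inc: "smooth_inclusion N M" and Q: "openin (mtop N) Q"
    and eq: "\<And>x. x \<in> Q \<Longrightarrow> X x = Y x" and X: "smooth_along N M Q X"
  shows "smooth_along N M Q Y"
proof (rule smooth_alongI)
  show "Y x \<in> tangent_space M x" if "x \<in> Q" for x
    using smooth_alongD(1)[OF X that] eq[OF that] by simp
  show "smooth_fun_on N (fst k \<inter> Q) (\<lambda>y. Y y k)" if k: "k \<in> atlas M" for k
    using smooth_inclusion_openin_chart[OF inc Q k]
    by (intro smooth_fun_on_cong[OF smooth_inclusion_manifold(1)[OF inc] _ _ smooth_alongD(2)[OF X k]])
      (simp_all add: eq Int_commute)
qed

lemma smooth_along_add: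
  assumes inc: "smooth_inclusion N M" and Q: "openin (mtop N) Q"
    and X: "smooth_along N M Q X" and Y: "smooth_along N M Q Y"
  shows "smooth_along N M Q (\<lambda>y. X y + Y y)"
proof (rule smooth_alongI)
  show "X x + Y x \<in> tangent_space M x" if "x \<in> Q" for x
    using subspace_add[OF subspace_tangent_space[OF smooth_inclusion_manifold(2)[OF inc]]]
      smooth_alongD(1)[OF X that] smooth_alongD(1)[OF Y that] .
  show "smooth_fun_on N (fst k \<inter> Q) (\<lambda>y. (X y + Y y) k)" if k: "k \<in> atlas M" for k
    unfolding plus_fun_apply using smooth_inclusion_openin_chart[OF inc Q k]
    by (intro smooth_fun_on_add smooth_inclusion_manifold(1)[OF inc]
        smooth_alongD(2)[OF X k] smooth_alongD(2)[OF Y k]) (simp add: Int_commute)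
qed

lemma smooth_along_scaleR:
  assumes inc: "smooth_inclusion N M" and Q: "openin (mtop N) Q"
    and f: "smooth_fun_on N Q f" and X: "smooth_along N M Q X"
  shows "smooth_along N M Q (\<lambda>y. f y *\<^sub>R X y)"
proof (rule smooth_alongI)
  show "f x *\<^sub>R X x \<in> tangent_space M x" if "x \<in> Q" for x
    using subspace_scale[OF subspace_tangent_space[OF smooth_inclusion_manifold(2)[OF inc]]]
      smooth_alongD(1)[OF X that] .
  show "smooth_fun_on N (fst k \<inter> Q) (\<lambda>y. (f y *\<^sub>R X y) k)" if k: "k \<in> atlas M" for k
    unfolding scaleR_fun_def using smooth_inclusion_openin_chart[OF inc Q k]
    by (intro smooth_fun_on_scaleR smooth_inclusion_manifold(1)[OF inc]
        smooth_alongD(2)[OF X k] smooth_fun_on_subset[OF f]) (simp_all add: Int_commute)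
qed

lemma smooth_along_zero:
  assumes "smooth_inclusion N M"
  shows "smooth_along N M Q (\<lambda>y. 0)"
  by (rule smooth_alongI)
    (simp_all add: subspace_0 subspace_tangent_space smooth_inclusion_manifold(2)[OF assms]
      smooth_fun_on_const)

lemma smooth_along_sum:
  assumes inc: "smooth_inclusion N M" and Q: "openin (mtop N) Q"
    and X: "\<And>i. i \<in> I \<Longrightarrow> smooth_along N M Q (X i)"
  shows "smooth_along N M Q (\<lambda>y. \<Sum>i\<in>I. X i y)"
  using X
proof (induction I rule: infinite_finite_induct)
  case (insert i I)
  have "smooth_along N M Q (\<lambda>y. X i y + (\<Sum>i\<in>I. X i y))"
    by (intro smooth_along_add[OF inc Q] insert) simp_all
  then show ?case
    by (simp only: sum.insert[OF insert.hyps])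
qed (simp_all only: sum.infinite sum.empty smooth_along_zero[OF inc] not_False_eq_True)

lemma sum_fun_apply: "(\<Sum>i\<in>I. f i) k = (\<Sum>i\<in>I. f i k)"
  by (induction I rule: infinite_finite_induct) simp_all

lemma smooth_along_restrict:
  assumes inc: "smooth_inclusion N M" and P: "openin (mtop N) P" and Q: "openin (mtop M) Q"
    and PQ: "P \<subseteq> Q" and X: "smooth_along M M Q X"
  shows "smooth_along N M P X"
proof (rule smooth_alongI)
  show "X x \<in> tangent_space M x" if "x \<in> P" for x
    using smooth_alongD(1)[OF X] PQ that by blast
  fix k assume k: "k \<in> atlas M"
  have "openin (mtop N) (fst k \<inter> P)" "openin (mtop M) (fst k \<inter> Q)"
    using smooth_inclusion_openin_chart[OF inc P k]
      smooth_manifold_chart(1)[OF smooth_inclusion_manifold(2)[OF inc] k] Q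
    by (simp_all add: Int_commute openin_Int)
  then show "smooth_fun_on N (fst k \<inter> P) (\<lambda>y. X y k)"
    by (rule smooth_fun_on_restrict[OF inc _ _ _ smooth_alongD(2)[OF X k]]) (use PQ in blast)
qed

lemma vector_field_restrict:
  assumes "smooth_inclusion N M" "vector_field M X"
  shows "field_along N M X"
  by (rule smooth_along_restrict[OF assms(1) _ _ _ assms(2)])
    (simp_all add: smooth_inclusion_manifold(3)[OF assms(1)])

lemma smooth_along_coord_vec:
  assumes M: "smooth_manifold M" and k: "k \<in> atlas M"
  shows "smooth_along M M (fst k) (\<lambda>y. coord_vec M k y e)"
proof (rule smooth_along_chartI[OF smooth_inclusion_refl[OF M] smooth_manifold_chart(1)[OF M k] order_refl k])
  show "coord_vec M k x e \<in> tangent_space M x" if "x \<in> fst k" for x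
    by (rule coord_vec_in_tangent_space[OF M charts_atI[OF k that]])
  show "smooth_fun_on M (fst k) (\<lambda>y. coord_vec M k y e k)"
    by (rule smooth_fun_on_cong[OF M smooth_manifold_chart(1)[OF M k] _ smooth_fun_on_const[of _ _ e]])
      (rule coord_vec_self[OF M charts_atI[OF k], symmetric])
qed

lemma tensor_field11D:
  assumes "tensor_field11 M J" "x \<in> points M"
  shows "v \<in> tangent_space M x \<Longrightarrow> J x v \<in> tangent_space M x"
    "\<lbrakk>v \<in> tangent_space M x; w \<in> tangent_space M x\<rbrakk> \<Longrightarrow>
      J x (a *\<^sub>R v + b *\<^sub>R w) = a *\<^sub>R J x v + b *\<^sub>R J x w"
  using assms unfolding tensor_field11_def by blast+

lemma tensor_field11_sum:
  assumes M: "smooth_manifold M" and J: "tensor_field11 M J" and x: "x \<in> points M"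
    and v: "\<And>i. i \<in> I \<Longrightarrow> v i \<in> tangent_space M x"
  shows "J x (\<Sum>i\<in>I. a i *\<^sub>R v i) = (\<Sum>i\<in>I. a i *\<^sub>R J x (v i))"
  using v
proof (induction I rule: infinite_finite_induct)
  have 0: "J x 0 = 0"
    using tensor_field11D(2)[OF J x, of 0 0 0 0] subspace_0[OF subspace_tangent_space[OF M]] by simp
  {
    case (infinite I)
    then show ?case
      by (simp only: sum.infinite 0 not_False_eq_True)
  next
    case empty
    show ?case
      by (simp only: sum.empty 0)
  next
    case (insert i I)
    have "(\<Sum>i\<in>I. a i *\<^sub>R v i) \<in> tangent_space M x"
      using insert.prems by (intro subspace_sum subspace_scale subspace_tangent_space M) simp
    from tensor_field11D(2)[OF J x insert.prems[OF insertI1] this, of "a i" 1]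
    show ?case
      by (simp only: sum.insert[OF insert.hyps] scaleR_one insert.IH[OF insert.prems[OF insertI2]])
  }
qed

lemma smooth_along_tensor:
  assumes inc: "smooth_inclusion N M" and J: "tensor_field11 M J"
    and Q: "openin (mtop N) Q" and X: "smooth_along N M Q X"
  shows "smooth_along N M Q (\<lambda>y. J y (X y))"
proof (rule smooth_along_local[OF inc Q])
  note mf = smooth_inclusion_manifold[OF inc]
  fix x assume x: "x \<in> Q"
  have QM: "Q \<subseteq> points M"
    using openin_subset[OF Q] mf(3) by blast
  have "chart_at M x \<in> charts_at M x"
    using chart_at_in[OF mf(2)] QM x by blast
  from charts_atD[OF this] obtain k where k: "k \<in> atlas M" "x \<in> fst k"
    by blast
  let ?P = "Q \<inter> fst k"
  have P: "openin (mtop N) ?P"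
    by (rule smooth_inclusion_openin_chart[OF inc Q k(1)])
  have "smooth_along N M ?P (\<lambda>y. J y (X y))"
  proof (rule smooth_along_chartI[OF inc P _ k(1)])
    show "?P \<subseteq> fst k"
      by blast
    show "J y (X y) \<in> tangent_space M y" if "y \<in> ?P" for y
      using that QM by (intro tensor_field11D(1)[OF J] smooth_alongD(1)[OF X]) auto
    have Jb: "smooth_fun_on N ?P (\<lambda>y. J y (coord_vec M k y b) k)" for b
    proof (rule smooth_fun_on_restrict[OF inc P smooth_manifold_chart(1)[OF mf(2) k(1)]])
      have "smooth_on (snd k ` fst k) (\<lambda>u. J (chart_inv k u) (coord_vec M k (chart_inv k u) b) k)"
        using J k(1) unfolding tensor_field11_def Let_def by blast
      from smooth_fun_on_chart[OF mf(2) k(1) smooth_manifold_chart(1)[OF mf(2) k(1)] order_refl this]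
      show "smooth_fun_on M (fst k) (\<lambda>y. J y (coord_vec M k y b) k)"
        by (rule smooth_fun_on_cong[OF mf(2) smooth_manifold_chart(1)[OF mf(2) k(1)], rotated])
          (simp add: chart_inv_chart[OF mf(2) k(1)])
    qed blast
    have "smooth_fun_on N ?P (\<lambda>y. X y k \<bullet> b)" for b
      using smooth_alongD(2)[OF X k(1)]
      by (intro smooth_fun_on_bounded_linear[OF mf(1) P bounded_linear_inner_left])
        (simp add: Int_commute)
    with Jb have "smooth_fun_on N ?P (\<lambda>y. \<Sum>b\<in>Basis. (X y k \<bullet> b) *\<^sub>R J y (coord_vec M k y b) k)"
      by (intro smooth_fun_on_sum smooth_fun_on_scaleR mf P)
    then show "smooth_fun_on N ?P (\<lambda>y. J y (X y) k)"
    proof (rule smooth_fun_on_cong[OF mf(1) P, rotated])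
      fix y assume y: "y \<in> ?P"
      then have ky: "k \<in> charts_at M y"
        using k(1) by (auto intro: charts_atI)
      have yM: "y \<in> points M"
        using y QM by blast
      have Xy: "X y \<in> tangent_space M y"
        using smooth_alongD(1)[OF X] y by blast
      have "J y (X y) = J y (\<Sum>b\<in>Basis. (X y k \<bullet> b) *\<^sub>R coord_vec M k y b)"
        by (rule arg_cong[OF tangent_vector_expansion[OF mf(2) Xy ky]])
      also have "\<dots> = (\<Sum>b\<in>Basis. (X y k \<bullet> b) *\<^sub>R J y (coord_vec M k y b))"
        by (rule tensor_field11_sum[OF mf(2) J yM coord_vec_in_tangent_space[OF mf(2) ky]])
      finally show "(\<Sum>b\<in>Basis. (X y k \<bullet> b) *\<^sub>R J y (coord_vec M k y b) k) = J y (X y) k"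
        by (simp add: scaleR_fun_def sum_fun_apply)
    qed
  qed
  with P x k(2) show "\<exists>P. openin (mtop N) P \<and> x \<in> P \<and> smooth_along N M (Q \<inter> P) (\<lambda>y. J y (X y))"
    by (intro exI[of _ ?P]) (simp add: Int_assoc[symmetric])
qed

lemma field_along_push:
  assumes inc: "smooth_inclusion N M" and w: "vector_field N w"
  shows "field_along N M (\<lambda>y. push N M y (w y))"
proof (rule smooth_along_local[OF inc])
  note mf = smooth_inclusion_manifold[OF inc]
  fix x assume x: "x \<in> points N"
  have "chart_at M x \<in> charts_at M x"
    using chart_at_in[OF mf(2)] mf(3) x by blast
  from charts_atD[OF this] obtain k where k: "k \<in> atlas M" "x \<in> fst k"
    by blast
  from charts_atD[OF chart_at_in[OF mf(1) x]] obtain c where c: "c \<in> atlas N" "x \<in> fst c"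
    by blast
  note tr = smooth_inclusion_transition[OF inc c(1) k(1)]
  let ?P = "fst c \<inter> fst k"
  have P: "openin (mtop N) ?P"
    by (rule smooth_inclusion_openin_chart[OF inc smooth_manifold_chart(1)[OF mf(1) c(1)] k(1)])
  have PN: "?P \<subseteq> points N"
    using openin_subset[OF P] .
  have "smooth_along N M ?P (\<lambda>y. push N M y (w y))"
  proof (rule smooth_along_chartI[OF inc P _ k(1)])
    show "?P \<subseteq> fst k"
      by blast
    show "push N M y (w y) \<in> tangent_space M y" if "y \<in> ?P" for y
      using that PN by (intro push_in_tangent_space[OF inc] smooth_alongD(1)[OF w]) auto
    have "smooth_fun_on N ?P (\<lambda>y. w y c)"
      by (rule smooth_fun_on_subset[OF smooth_alongD(2)[OF w c(1)]]) (use PN in auto)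
    then have "smooth_fun_on N ?P (\<lambda>y. w y c \<bullet> b)" for b
      by (rule smooth_fun_on_bounded_linear[OF mf(1) P bounded_linear_inner_left])
    moreover have "smooth_fun_on N ?P (\<lambda>y. frechet_derivative (snd k \<circ> chart_inv c) (at (snd c y)) b)" for b
      by (rule smooth_fun_on_chart[OF mf(1) c(1) P _ smooth_on_frechet[OF tr(2)]]) blast
    ultimately have "smooth_fun_on N ?P (\<lambda>y. \<Sum>b\<in>Basis. (w y c \<bullet> b) *\<^sub>R
        frechet_derivative (snd k \<circ> chart_inv c) (at (snd c y)) b)"
      by (intro smooth_fun_on_sum smooth_fun_on_scaleR mf P)
    then show "smooth_fun_on N ?P (\<lambda>y. push N M y (w y) k)"
    proof (rule smooth_fun_on_cong[OF mf(1) P, rotated])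
      fix y assume y: "y \<in> ?P"
      then have cy: "c \<in> charts_at N y" and ky: "k \<in> charts_at M y"
        using c(1) k(1) by (auto intro: charts_atI)
      have "w y \<in> tangent_space N y"
        using smooth_alongD(1)[OF w] y PN by blast
      from push_component[OF inc this cy ky]
      show "(\<Sum>b\<in>Basis. (w y c \<bullet> b) *\<^sub>R frechet_derivative (snd k \<circ> chart_inv c) (at (snd c y)) b) =
          push N M y (w y) k"
        using linear_Basis_expansion[OF transition_linear[OF inc cy ky], of "w y c"] by (simp only:)
    qed
  qed
  with P x c(2) k(2) PN
  show "\<exists>P. openin (mtop N) P \<and> x \<in> P \<and> smooth_along N M (points N \<inter> P) (\<lambda>y. push N M y (w y))"
    by (intro exI[of _ ?P]) (simp add: Int_absorb1)
qed simp

subsection \<open>Extension of tangent vectors to global fields\<close>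

text \<open>
  The support condition is stated with a closed set \<open>C\<close> inside \<open>Q\<close>; this is where the Hausdorff
  property enters.
\<close>

lemma mfd_bump:
  assumes M: "smooth_manifold M" and Q: "openin (mtop M) Q" and x: "x \<in> Q"
  obtains \<beta> :: "'a \<Rightarrow> real" and C where "smooth_fun_on M (points M) \<beta>" "\<beta> x = 1"
    "\<And>c. c \<in> charts_at M x \<Longrightarrow> ((\<beta> \<circ> chart_inv c) has_derivative (\<lambda>v. 0)) (at (snd c x))"
    "closedin (mtop M) C" "C \<subseteq> Q" "\<And>y. y \<notin> C \<Longrightarrow> \<beta> y = 0"
proof -
  have xM: "x \<in> points M"
    using openin_subset[OF Q] x by blast
  from charts_atD[OF chart_at_in[OF M xM]] obtain k where k: "k \<in> atlas M" "x \<in> fst k"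
    by blast
  note kM = smooth_manifold_chart[OF M k(1)]
  have "open (snd k ` (fst k \<inter> Q))"
    by (rule chart_inter_image_open[OF M k(1) Q])
  then obtain \<epsilon> where \<epsilon>: "0 < \<epsilon>" "cball (snd k x) \<epsilon> \<subseteq> snd k ` (fst k \<inter> Q)"
    using x k(2) open_contains_cball_eq by blast
  obtain \<psi> :: "_ \<Rightarrow> real" where \<psi>: "smooth_on UNIV \<psi>" "\<psi> (snd k x) = 1"
      "\<And>u. u \<notin> ball (snd k x) \<epsilon> \<Longrightarrow> \<psi> u = 0" "(\<psi> has_derivative (\<lambda>v. 0)) (at (snd k x))"
    using euclidean_bump[OF \<epsilon>(1), of "snd k x"] by blast
  define \<beta> where "\<beta> y = (if y \<in> fst k then \<psi> (snd k y) else 0)" for y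
  define C where "C = {y \<in> fst k. snd k y \<in> cball (snd k x) \<epsilon>}"
  have "compactin (mtop M) C"
    unfolding C_def using \<epsilon>(2) by (intro chart_inv_compactin[OF M k(1)]) auto
  moreover have "Hausdorff_space (mtop M)"
    using M by (simp add: smooth_manifold_def)
  ultimately have C: "closedin (mtop M) C"
    by (simp add: compactin_imp_closedin)
  have off: "\<beta> y = 0" if "y \<notin> C" for y
    using that \<psi>(3)[of "snd k y"] by (auto simp: \<beta>_def C_def)
  have CQ: "C \<subseteq> Q"
  proof
    fix y assume y: "y \<in> C"
    then obtain z where "z \<in> fst k" "z \<in> Q" "snd k y = snd k z"
      using \<epsilon>(2) by (auto simp: C_def)
    then show "y \<in> Q"
      using inj_onD[OF chart_inj_on[OF M k(1)], of y z] y by (simp add: C_def)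
  qed
  have 1: "smooth_fun_on M (fst k) \<beta>"
    by (rule smooth_fun_on_cong[OF M kM(1) _ smooth_fun_on_chart[OF M k(1) kM(1) order_refl
            smooth_on_subset[OF \<psi>(1) subset_UNIV]]]) (simp add: \<beta>_def)
  have MC: "openin (mtop M) (points M - C)"
    using C by blast
  have 2: "smooth_fun_on M (points M - C) \<beta>"
    by (rule smooth_fun_on_cong[OF M MC _ smooth_fun_on_const[of _ _ 0]]) (simp add: off)
  have "smooth_fun_on M (points M) \<beta>"
  proof (rule smooth_fun_on_local[OF M])
    fix y assume y: "y \<in> points M"
    show "\<exists>P. openin (mtop M) P \<and> y \<in> P \<and> smooth_fun_on M (points M \<inter> P) \<beta>"
    proof (cases "y \<in> C")
      case True
      then show ?thesis
        using 1 kM(1) chart_subset_points[OF M k(1)]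
        by (intro exI[of _ "fst k"]) (simp add: C_def Int_absorb1)
    next
      case False
      then show ?thesis
        using 2 MC y by (intro exI[of _ "points M - C"]) (simp add: Int_absorb1)
    qed
  qed simp
  moreover have "((\<beta> \<circ> chart_inv c) has_derivative (\<lambda>v. 0)) (at (snd c x))" if "c \<in> charts_at M x" for c
  proof (rule inclusion_chain[OF smooth_inclusion_refl[OF M] that charts_atI[OF k]])
    show "((\<beta> \<circ> chart_inv k) has_derivative (\<lambda>v. 0)) (at (snd k x))"
      by (rule has_derivative_transform_within_open[OF \<psi>(4) kM(2)])
        (auto simp: \<beta>_def chart_inv_chart[OF M k(1)] k(2))
  qed
  ultimately show thesis
    using that[of \<beta> C] C CQ off \<psi>(2) k(2) by (simp add: \<beta>_def)
qed

text \<open>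
  Multiplication with a bump function extends a field from an open set to all of \<open>N\<close>.
\<close>

lemma smooth_along_bump:
  assumes inc: "smooth_inclusion N M" and \<beta>: "smooth_fun_on N (points N) \<beta>"
    and C: "closedin (mtop N) C" "C \<subseteq> Q" "\<And>y. \<lbrakk>y \<in> points N; y \<notin> C\<rbrakk> \<Longrightarrow> \<beta> y = 0"
    and Q: "openin (mtop N) Q" and X: "smooth_along N M Q X"
  shows "field_along N M (\<lambda>y. \<beta> y *\<^sub>R X y)"
proof (rule smooth_along_local[OF inc])
  have QN: "Q \<subseteq> points N"
    using openin_subset[OF Q] .
  have 1: "smooth_along N M Q (\<lambda>y. \<beta> y *\<^sub>R X y)"
    by (intro smooth_along_scaleR[OF inc Q] smooth_fun_on_subset[OF \<beta> QN] X)
  have NC: "openin (mtop N) (points N - C)"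
    using C(1) by blast
  have 2: "smooth_along N M (points N - C) (\<lambda>y. \<beta> y *\<^sub>R X y)"
    by (rule smooth_along_cong[OF inc NC _ smooth_along_zero[OF inc]]) (simp add: C(3))
  fix y assume y: "y \<in> points N"
  show "\<exists>P. openin (mtop N) P \<and> y \<in> P \<and> smooth_along N M (points N \<inter> P) (\<lambda>y. \<beta> y *\<^sub>R X y)"
  proof (cases "y \<in> C")
    case True
    then show ?thesis
      using 1 Q C(2) QN by (intro exI[of _ Q]) (auto simp: Int_absorb1)
  next
    case False
    then show ?thesis
      using 2 NC y by (intro exI[of _ "points N - C"]) (simp add: Int_absorb1)
  qed
qed simp

lemma subbundle_subspace:
  assumes "subbundle N M E r" "x \<in> points N"
  shows "subspace (E x)"
proof -
  obtain Q F where QF: "x \<in> Q" "local_frame N M E r Q F"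
    using assms unfolding subbundle_def by blast
  then have "E x = span ((\<lambda>i. F i x) ` {..<r})"
    by (simp add: local_frame_def)
  then show ?thesis
    by (simp add: subspace_span)
qed

lemma subbundle_section_through:
  assumes inc: "smooth_inclusion N M" and E: "subbundle N M E r" and x: "x \<in> points N" and v: "v \<in> E x"
  obtains X where "X \<in> sections N M E" "X x = v"
proof -
  obtain Q F where QF: "x \<in> Q" "local_frame N M E r Q F"
    using E x unfolding subbundle_def by blast
  then have Q: "openin (mtop N) Q" and F: "\<And>i. i < r \<Longrightarrow> smooth_along N M Q (F i)"
    and sp: "\<And>y. y \<in> Q \<Longrightarrow> span ((\<lambda>i. F i y) ` {..<r}) = E y"
    by (auto simp: local_frame_def)
  obtain a where a: "v = (\<Sum>i<r. a i *\<^sub>R F i x)"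
  proof -
    have inj: "inj_on (\<lambda>i. F i x) {..<r}"
      using QF by (simp add: local_frame_def)
    have "v \<in> span ((\<lambda>i. F i x) ` {..<r})"
      using v sp[OF QF(1)] by simp
    then obtain u where "v = (\<Sum>w\<in>(\<lambda>i. F i x) ` {..<r}. u w *\<^sub>R w)"
      by (auto simp: span_finite)
    then have "v = (\<Sum>i<r. u (F i x) *\<^sub>R F i x)"
      by (simp add: sum.reindex[OF inj] o_def)
    then show thesis
      by (rule that)
  qed
  note mf = smooth_inclusion_manifold[OF inc]
  obtain \<beta> :: "_ \<Rightarrow> real" and C where \<beta>: "smooth_fun_on N (points N) \<beta>" "\<beta> x = 1"
      "closedin (mtop N) C" "C \<subseteq> Q" "\<And>y. y \<notin> C \<Longrightarrow> \<beta> y = 0"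
    using mfd_bump[OF mf(1) Q QF(1)] by metis
  let ?X = "\<lambda>y. \<Sum>i<r. a i *\<^sub>R F i y"
  have "smooth_along N M Q ?X"
    using F by (intro smooth_along_sum[OF inc Q] smooth_along_scaleR[OF inc Q] smooth_fun_on_const) simp
  then have "field_along N M (\<lambda>y. \<beta> y *\<^sub>R ?X y)"
    using \<beta> by (intro smooth_along_bump[OF inc _ _ _ _ Q]) auto
  moreover have "\<beta> y *\<^sub>R ?X y \<in> E y" if y: "y \<in> points N" for y
  proof (cases "y \<in> Q")
    case True
    then have "?X y \<in> E y"
      unfolding sp[OF True, symmetric] by (intro span_sum span_scale span_base) auto
    then show ?thesis
      by (rule subspace_scale[OF subbundle_subspace[OF E y]])
  next
    case False
    then have "\<beta> y = 0"
      using \<beta>(4,5) by blast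
    then show ?thesis
      using subspace_0[OF subbundle_subspace[OF E y]] by simp
  qed
  ultimately have "(\<lambda>y. \<beta> y *\<^sub>R ?X y) \<in> sections N M E"
    by (simp add: sections_def)
  then show thesis
    by (rule that) (simp add: \<beta>(2) a)
qed

section \<open>Symmetric bilinear forms\<close>

locale symmetric_form =
  fixes T :: "'v::real_vector set" and B :: "'v \<Rightarrow> 'v \<Rightarrow> real"
  assumes T: "subspace T"
    and lin: "\<lbrakk>u \<in> T; v \<in> T; w \<in> T\<rbrakk> \<Longrightarrow> B (a *\<^sub>R u + b *\<^sub>R v) w = a * B u w + b * B v w"
    and sym: "\<lbrakk>u \<in> T; v \<in> T\<rbrakk> \<Longrightarrow> B u v = B v u"
begin

lemma add_left: "\<lbrakk>u \<in> T; v \<in> T; w \<in> T\<rbrakk> \<Longrightarrow> B (u + v) w = B u w + B v w"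
  using lin[of u v w 1 1] by simp

lemma scale_left: "\<lbrakk>u \<in> T; w \<in> T\<rbrakk> \<Longrightarrow> B (a *\<^sub>R u) w = a * B u w"
  using lin[of u u w a 0] by simp

lemma zero_left: "w \<in> T \<Longrightarrow> B 0 w = 0"
  using scale_left[of 0 w 0] subspace_0[OF T] by simp

lemma add_right: "\<lbrakk>u \<in> T; v \<in> T; w \<in> T\<rbrakk> \<Longrightarrow> B w (u + v) = B w u + B w v"
  using add_left[of u v w] sym[of w "u + v"] sym[of w u] sym[of w v] subspace_add[OF T] by simp

lemma scale_right: "\<lbrakk>u \<in> T; w \<in> T\<rbrakk> \<Longrightarrow> B w (a *\<^sub>R u) = a * B w u"
  using scale_left[of u w a] sym[of w "a *\<^sub>R u"] sym[of w u] subspace_scale[OF T] by simp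

lemma zero_right: "w \<in> T \<Longrightarrow> B w 0 = 0"
  using zero_left[of w] sym[of w 0] subspace_0[OF T] by simp

lemma sum_left: "\<lbrakk>\<And>i. i \<in> I \<Longrightarrow> u i \<in> T; w \<in> T\<rbrakk> \<Longrightarrow> B (\<Sum>i\<in>I. u i) w = (\<Sum>i\<in>I. B (u i) w)"
proof (induction I rule: infinite_finite_induct)
  case (insert i I)
  then show ?case
    using add_left[of "u i" "\<Sum>i\<in>I. u i" w] subspace_sum[OF T, of I u] by simp
qed (simp_all add: zero_left)

lemma sum_both:
  assumes "\<And>i. i \<in> I \<Longrightarrow> u i \<in> T" "\<And>j. j \<in> I' \<Longrightarrow> v j \<in> T"
  shows "B (\<Sum>i\<in>I. u i) (\<Sum>j\<in>I'. v j) = (\<Sum>i\<in>I. \<Sum>j\<in>I'. B (u i) (v j))"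
proof -
  have v: "(\<Sum>j\<in>I'. v j) \<in> T"
    using assms(2) by (rule subspace_sum[OF T])
  have "B (u i) (\<Sum>j\<in>I'. v j) = (\<Sum>j\<in>I'. B (u i) (v j))" if "i \<in> I" for i
    using sum_left[of I' v "u i"] assms that v by (simp add: sym[of "u i"])
  moreover have "B (\<Sum>i\<in>I. u i) (\<Sum>j\<in>I'. v j) = (\<Sum>i\<in>I. B (u i) (\<Sum>j\<in>I'. v j))"
    by (rule sum_left) (use assms v in auto)
  ultimately show ?thesis
    by simp
qed

lemma combination_product:
  assumes "u \<in> T" "u' \<in> T" "v \<in> T" "v' \<in> T"
  shows "B (a *\<^sub>R u + s *\<^sub>R u') (t *\<^sub>R v) + B (s *\<^sub>R u) (b *\<^sub>R v + t *\<^sub>R v') =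
    s * (t * (B u' v + B u v') + b * B u v) + a * (t * B u v)"
proof -
  note mem = assms subspace_scale[OF T] subspace_add[OF T]
  have "B (a *\<^sub>R u + s *\<^sub>R u') (t *\<^sub>R v) = t * (a * B u v + s * B u' v)"
    by (subst scale_right) (simp_all only: mem lin)
  moreover have "B (s *\<^sub>R u) (b *\<^sub>R v + t *\<^sub>R v') = s * (b * B u v + t * B u v')"
    by (subst scale_left, simp_all only: mem, subst add_right, simp_all only: mem scale_right)
  ultimately show ?thesis
    by (simp add: algebra_simps)
qed

end

lemma semi_riemannian_form:
  assumes "semi_riemannian M g" "x \<in> points M"
  shows "symmetric_form (tangent_space M x) (g x)"
proof
  show "subspace (tangent_space M x)"
    using assms(1) by (intro subspace_tangent_space) (simp add: semi_riemannian_def)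
qed (use assms in \<open>unfold semi_riemannian_def, blast\<close>)+

section \<open>Connections along a submanifold\<close>

lemma
  assumes "connection_along N M D" "x \<in> points N" "w \<in> tangent_space N x"
  shows connection_in_tangent_space: "field_along N M X \<Longrightarrow> D x w X \<in> tangent_space M x"
    and connection_linear: "\<lbrakk>v \<in> tangent_space N x; field_along N M X\<rbrakk> \<Longrightarrow>
      D x (a *\<^sub>R v + b *\<^sub>R w) X = a *\<^sub>R D x v X + b *\<^sub>R D x w X"
    and connection_add: "\<lbrakk>field_along N M X; field_along N M Y\<rbrakk> \<Longrightarrow>
      D x w (\<lambda>y. X y + Y y) = D x w X + D x w Y"
    and connection_Leibniz: "\<lbrakk>smooth_fun N f; field_along N M X\<rbrakk> \<Longrightarrow>
      D x w (\<lambda>y. f y *\<^sub>R X y) = dir_deriv N x w f *\<^sub>R X x + f x *\<^sub>R D x w X"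
proof -
  note * = assms(1)[unfolded connection_along_def]
  note 1 = conjunct1[OF *] and 2 = conjunct1[OF conjunct2[OF *]]
    and 3 = conjunct1[OF conjunct2[OF conjunct2[OF *]]]
    and 4 = conjunct1[OF conjunct2[OF conjunct2[OF conjunct2[OF *]]]]
  show "field_along N M X \<Longrightarrow> D x w X \<in> tangent_space M x"
    using 1[rule_format, OF assms(2,3)] .
  show "\<lbrakk>v \<in> tangent_space N x; field_along N M X\<rbrakk> \<Longrightarrow>
      D x (a *\<^sub>R v + b *\<^sub>R w) X = a *\<^sub>R D x v X + b *\<^sub>R D x w X"
    using 2[rule_format, OF assms(2) _ assms(3)] .
  show "\<lbrakk>field_along N M X; field_along N M Y\<rbrakk> \<Longrightarrow> D x w (\<lambda>y. X y + Y y) = D x w X + D x w Y"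
    using 3[rule_format, OF assms(2,3)] by simp
  show "\<lbrakk>smooth_fun N f; field_along N M X\<rbrakk> \<Longrightarrow>
      D x w (\<lambda>y. f y *\<^sub>R X y) = dir_deriv N x w f *\<^sub>R X x + f x *\<^sub>R D x w X"
    using 4[rule_format, OF assms(2,3)] by simp
qed

text \<open>
  A field along \<open>N\<close> is a function on the whole point type; its values off \<open>N\<close> do not matter.
\<close>

lemma connection_cong:
  assumes inc: "smooth_inclusion N M" and D: "connection_along N M D"
    and x: "x \<in> points N" and w: "w \<in> tangent_space N x"
    and X: "field_along N M X" and Y: "field_along N M Y"
    and eq: "\<And>y. y \<in> points N \<Longrightarrow> X y = Y y"
  shows "D x w X = D x w Y"
proof -
  note N = smooth_inclusion_manifold(1)[OF inc]
  \<comment> \<open>multiplication with this function, which is constant on \<open>N\<close>, kills the values off \<open>N\<close>\<close>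
  define f :: "'a \<Rightarrow> real" where "f y = (if y \<in> points N then 1 else 0)" for y
  have f: "smooth_fun N f"
    unfolding smooth_fun_iff[OF N]
    by (rule smooth_fun_on_cong[OF N _ _ smooth_fun_on_const[of _ _ 1]]) (simp_all add: f_def)
  note c = chart_at_in[OF N x]
  have "((f \<circ> chart_inv (chart_at N x)) has_derivative (\<lambda>v. 0)) (at (snd (chart_at N x) x))"
  proof (rule has_derivative_transform_within_open[OF has_derivative_const[of 1]
        smooth_manifold_chart(2)[OF N charts_atD(1)[OF c]]])
    show "snd (chart_at N x) x \<in> snd (chart_at N x) ` fst (chart_at N x)"
      using charts_atD(2)[OF c] by simp
    show "1 = (f \<circ> chart_inv (chart_at N x)) u" if "u \<in> snd (chart_at N x) ` fst (chart_at N x)" for u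
      using that chart_subset_points[OF N charts_atD(1)[OF c]]
      by (auto simp: f_def chart_inv_chart[OF N charts_atD(1)[OF c]])
  qed
  from dir_deriv_eq[OF this] have "dir_deriv N x w f = 0" .
  then have kill: "D x w (\<lambda>y. f y *\<^sub>R Z y) = D x w Z" if "field_along N M Z" for Z
    using connection_Leibniz[OF D x w f that] x by (simp add: f_def)
  have "(\<lambda>y. f y *\<^sub>R X y) = (\<lambda>y. f y *\<^sub>R Y y)"
    using eq by (intro HOL.ext) (simp add: f_def)
  from arg_cong[OF this, of "D x w"] show ?thesis
    by (rule box_equals[OF _ kill[OF X] kill[OF Y]])
qed

lemma connection_zero:
  assumes inc: "smooth_inclusion N M" and D: "connection_along N M D"
    and x: "x \<in> points N" and w: "w \<in> tangent_space N x"
  shows "D x w (\<lambda>y. 0) = 0"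
  using connection_add[OF D x w smooth_along_zero[OF inc] smooth_along_zero[OF inc]]
  by (simp only: add_0_left) (metis add_cancel_right_right)

lemma connection_sum:
  assumes inc: "smooth_inclusion N M" and D: "connection_along N M D"
    and x: "x \<in> points N" and w: "w \<in> tangent_space N x"
    and X: "\<And>i. i \<in> I \<Longrightarrow> field_along N M (X i)"
  shows "D x w (\<lambda>y. \<Sum>i\<in>I. X i y) = (\<Sum>i\<in>I. D x w (X i))"
  using X
proof (induction I rule: infinite_finite_induct)
  case (insert i I)
  have "D x w (\<lambda>y. X i y + (\<Sum>i\<in>I. X i y)) = D x w (X i) + D x w (\<lambda>y. \<Sum>i\<in>I. X i y)"
    by (intro connection_add[OF D x w] smooth_along_sum[OF inc] insert) (use insert.prems in auto)
  then show ?case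
    by (simp only: sum.insert[OF insert.hyps] insert.IH[OF insert.prems[OF insertI2]])
qed (simp_all only: sum.infinite sum.empty connection_zero[OF inc D x w] not_False_eq_True)

lemma connection_sum_direction:
  assumes M: "smooth_manifold N" and D: "connection_along N M D" and x: "x \<in> points N"
    and w: "\<And>i. i \<in> I \<Longrightarrow> w i \<in> tangent_space N x" and X: "field_along N M X"
  shows "D x (\<Sum>i\<in>I. a i *\<^sub>R w i) X = (\<Sum>i\<in>I. a i *\<^sub>R D x (w i) X)"
  using w
proof (induction I rule: infinite_finite_induct)
  note T = subspace_tangent_space[OF M]
  have "D x 0 X = 0"
    using connection_linear[OF D x subspace_0[OF T] subspace_0[OF T] X, of 0 0]
    by (simp only: scaleR_zero_left add_0_left)
  note 0 = this
  {
    case (infinite I)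
    then show ?case
      by (simp only: sum.infinite 0 not_False_eq_True)
  next
    case empty
    show ?case
      by (simp only: sum.empty 0)
  next
    case (insert i I)
    have "(\<Sum>i\<in>I. a i *\<^sub>R w i) \<in> tangent_space N x"
      using insert.prems by (intro subspace_sum subspace_scale T) simp
    from connection_linear[OF D x this insert.prems[OF insertI1] X, of "a i" 1]
    show ?case
      by (simp only: sum.insert[OF insert.hyps] scaleR_one insert.IH[OF insert.prems[OF insertI2]])
  }
qed

text \<open>
  If a multiple \<open>\<rho> X\<close> of a field is written as a combination of fields \<open>E i\<close>, where \<open>\<rho>\<close> has value \<open>1\<close>
  and vanishing derivative at \<open>x\<close>, then the Leibniz rule computes the derivative of \<open>X\<close> at \<open>x\<close>.
\<close>

lemma connection_expansion:
  assumes inc: "smooth_inclusion N M" and D: "connection_along N M D"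
    and x: "x \<in> points N" and w: "w \<in> tangent_space N x"
    and X: "field_along N M X"
    and f: "\<And>i. i \<in> I \<Longrightarrow> smooth_fun N (f i)" and E: "\<And>i. i \<in> I \<Longrightarrow> field_along N M (E i)"
    and \<rho>: "smooth_fun N \<rho>" "\<rho> x = 1"
      "((\<rho> \<circ> chart_inv (chart_at N x)) has_derivative (\<lambda>v. 0)) (at (snd (chart_at N x) x))"
    and eq: "\<And>y. y \<in> points N \<Longrightarrow> \<rho> y *\<^sub>R X y = (\<Sum>i\<in>I. f i y *\<^sub>R E i y)"
  shows "D x w X = (\<Sum>i\<in>I. dir_deriv N x w (f i) *\<^sub>R E i x + f i x *\<^sub>R D x w (E i))"
proof -
  note N = smooth_inclusion_manifold(1)[OF inc]
  have op: "openin (mtop N) (points N)"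
    by simp
  have fE: "field_along N M (\<lambda>y. f i y *\<^sub>R E i y)" if "i \<in> I" for i
    using f[OF that] by (intro smooth_along_scaleR[OF inc op _ E[OF that]]) (simp add: smooth_fun_iff[OF N])
  have \<rho>X: "field_along N M (\<lambda>y. \<rho> y *\<^sub>R X y)"
    using \<rho>(1) by (intro smooth_along_scaleR[OF inc op _ X]) (simp add: smooth_fun_iff[OF N])
  have "D x w (\<lambda>y. \<rho> y *\<^sub>R X y) = D x w X"
    using connection_Leibniz[OF D x w \<rho>(1) X] dir_deriv_eq[OF \<rho>(3), of w] \<rho>(2) by simp
  then have "D x w X = D x w (\<lambda>y. \<rho> y *\<^sub>R X y)"
    by (rule sym)
  also have "\<dots> = D x w (\<lambda>y. \<Sum>i\<in>I. f i y *\<^sub>R E i y)"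
    by (rule connection_cong[OF inc D x w \<rho>X smooth_along_sum[OF inc op fE] eq])
  also have "\<dots> = (\<Sum>i\<in>I. D x w (\<lambda>y. f i y *\<^sub>R E i y))"
    by (rule connection_sum[OF inc D x w fE])
  also have "\<dots> = (\<Sum>i\<in>I. dir_deriv N x w (f i) *\<^sub>R E i x + f i x *\<^sub>R D x w (E i))"
    by (rule sum.cong[OF refl connection_Leibniz[OF D x w f E]])
  finally show ?thesis .
qed

subsection \<open>Global fields extending a coordinate frame\<close>

text \<open>
  The fields \<open>\<beta> \<partial>\<^sub>b\<close>, for a bump function \<open>\<beta>\<close> at a point \<open>x\<close> of \<open>N\<close> and the coordinate fields of the
  chart of \<open>M\<close> at \<open>x\<close>, are global, and near \<open>x\<close> they span all fields along \<open>N\<close> over the functions on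
  \<open>N\<close>.  The set \<open>C\<close> contains the support of \<open>\<beta>\<close>.
\<close>

locale ambient_frame =
  fixes N :: "('a, 'm::euclidean_space) mfd" and M :: "('a, 'e::euclidean_space) mfd"
    and x :: 'a and \<beta> :: "'a \<Rightarrow> real" and C :: "'a set"
  assumes inc: "smooth_inclusion N M" and x: "x \<in> points N"
    and \<beta>_smooth: "smooth_fun_on M (points M) \<beta>" and \<beta>_x: "\<beta> x = 1"
    and \<beta>_deriv: "\<And>c. c \<in> charts_at M x \<Longrightarrow>
      ((\<beta> \<circ> chart_inv c) has_derivative (\<lambda>v. 0)) (at (snd c x))"
    and C: "closedin (mtop M) C" "C \<subseteq> fst (chart_at M x)" "\<And>y. y \<notin> C \<Longrightarrow> \<beta> y = 0"
begin

abbreviation k where "k \<equiv> chart_at M x"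
abbreviation c where "c \<equiv> chart_at N x"

definition frame :: "'e \<Rightarrow> 'a \<Rightarrow> ('a, 'e) tvec"
  where "frame e y = \<beta> y *\<^sub>R coord_vec M k y e"

lemma N: "smooth_manifold N" and M: "smooth_manifold M" and NM: "points N \<subseteq> points M"
  using smooth_inclusion_manifold[OF inc] by blast+

lemma xM: "x \<in> points M"
  using x NM by blast

lemma c: "c \<in> charts_at N x" and k: "k \<in> charts_at M x"
  using chart_at_in[OF N x] chart_at_in[OF M xM] by blast+

lemmas c_atlas = charts_atD(1)[OF c] and k_atlas = charts_atD(1)[OF k]
  and x_c = charts_atD(2)[OF c] and x_k = charts_atD(2)[OF k]

lemma frame_x: "frame e x = coord_vec M k x e"
  by (simp add: frame_def \<beta>_x)

lemma frame_in_tangent_space: "frame e x \<in> tangent_space M x"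
  unfolding frame_x by (rule coord_vec_in_tangent_space[OF M k])

lemma frame_component: "y \<in> fst k \<Longrightarrow> frame e y k = \<beta> y *\<^sub>R e"
  using coord_vec_self[OF M charts_atI[OF k_atlas]] by (simp add: frame_def scaleR_fun_def)

lemma vector_field_frame: "vector_field M (frame e)"
  unfolding frame_def
  by (rule smooth_along_bump[OF smooth_inclusion_refl[OF M] \<beta>_smooth C
        smooth_manifold_chart(1)[OF M k_atlas] smooth_along_coord_vec[OF M k_atlas]])

lemma field_along_frame: "field_along N M (frame e)"
  by (rule vector_field_restrict[OF inc vector_field_frame])

lemma \<beta>_smooth_N: "smooth_fun_on N (points N) \<beta>"
  by (rule smooth_fun_on_restrict[OF inc _ _ NM \<beta>_smooth]) simp_all

lemma \<beta>_deriv_N: "((\<beta> \<circ> chart_inv c) has_derivative (\<lambda>v. 0)) (at (snd c x))"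
  using inclusion_chain[OF inc c k \<beta>_deriv[OF k]] .

lemma smooth_fun_coefficient:
  assumes X: "field_along N M X"
  shows "smooth_fun N (\<lambda>y. \<beta> y * (X y k \<bullet> b))"
  unfolding smooth_fun_iff[OF N]
proof (rule smooth_fun_on_local[OF N])
  let ?f = "\<lambda>y. \<beta> y * (X y k \<bullet> b)"
  let ?P = "points N \<inter> fst k"
  have P: "openin (mtop N) ?P"
    by (rule smooth_inclusion_openin_chart[OF inc _ k_atlas]) simp
  have "smooth_fun_on N ?P (\<lambda>y. X y k)"
    using smooth_alongD(2)[OF X k_atlas] by (simp add: Int_commute)
  then have "smooth_fun_on N ?P (\<lambda>y. X y k \<bullet> b)"
    by (rule smooth_fun_on_bounded_linear[OF N P bounded_linear_inner_left])
  then have "smooth_fun_on N ?P (\<lambda>y. \<beta> y *\<^sub>R (X y k \<bullet> b))"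
    by (rule smooth_fun_on_scaleR[OF N P smooth_fun_on_subset[OF \<beta>_smooth_N Int_lower1]])
  then have 1: "smooth_fun_on N (points N \<inter> ?P) ?f"
    by (simp add: Int_absorb1)
  have "openin (mtop M) (points M - C)"
    using C(1) by blast
  note NC = smooth_inclusion_openin[OF inc this]
  then have "smooth_fun_on N (points N \<inter> (points M - C)) ?f"
    by (rule smooth_fun_on_cong[OF N _ _ smooth_fun_on_const[of _ _ 0]]) (simp add: C(3))
  then have 2: "smooth_fun_on N (points N \<inter> (points N \<inter> (points M - C))) ?f"
    by (simp add: Int_assoc[symmetric])
  fix y assume y: "y \<in> points N"
  show "\<exists>P. openin (mtop N) P \<and> y \<in> P \<and> smooth_fun_on N (points N \<inter> P) ?f"
  proof (cases "y \<in> C")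
    case True
    then show ?thesis
      using 1 P y C(2) by (intro exI[of _ ?P]) blast
  next
    case False
    then show ?thesis
      using 2 NC y NM by (intro exI[of _ "points N \<inter> (points M - C)"]) blast
  qed
qed simp

lemma smooth_fun_\<beta>\<beta>: "smooth_fun N (\<lambda>y. \<beta> y * \<beta> y)"
  using smooth_fun_on_scaleR[OF N _ \<beta>_smooth_N \<beta>_smooth_N] by (simp add: smooth_fun_iff[OF N])

lemma \<beta>\<beta>_deriv: "(((\<lambda>y. \<beta> y * \<beta> y) \<circ> chart_inv c) has_derivative (\<lambda>v. 0)) (at (snd c x))"
  using has_derivative_mult[OF \<beta>_deriv_N \<beta>_deriv_N] by (simp add: o_def)

lemma frame_expansion:
  assumes X: "field_along N M X" and y: "y \<in> points N"
  shows "(\<beta> y * \<beta> y) *\<^sub>R X y = (\<Sum>b\<in>Basis. (\<beta> y * (X y k \<bullet> b)) *\<^sub>R frame b y)"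
proof (cases "y \<in> fst k")
  case True
  have "(\<beta> y * \<beta> y) *\<^sub>R X y = (\<beta> y * \<beta> y) *\<^sub>R (\<Sum>b\<in>Basis. (X y k \<bullet> b) *\<^sub>R coord_vec M k y b)"
    by (rule arg_cong[OF tangent_vector_expansion[OF M smooth_alongD(1)[OF X y] charts_atI[OF k_atlas True]]])
  also have "\<dots> = (\<Sum>b\<in>Basis. (\<beta> y * (X y k \<bullet> b)) *\<^sub>R frame b y)"
    unfolding scaleR_sum_right frame_def scaleR_scaleR by (intro sum.cong refl) (simp only: ac_simps)
  finally show ?thesis .
next
  case False
  then have "\<beta> y = 0"
    using C(2,3) by blast
  then show ?thesis
    by simp
qed

lemma component_has_derivative:
  assumes X: "field_along N M X"
  shows "((\<lambda>u. X (chart_inv c u) k) has_derivative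
    frechet_derivative ((\<lambda>y. X y k) \<circ> chart_inv c) (at (snd c x))) (at (snd c x))"
proof -
  have "openin (mtop N) (fst k \<inter> points N)"
    using smooth_inclusion_openin_chart[OF inc _ k_atlas, of "points N"] by (simp add: Int_commute)
  from smooth_fun_on_differentiable[OF N this smooth_alongD(2)[OF X k_atlas] _ c]
  have "((\<lambda>y. X y k) \<circ> chart_inv c) differentiable at (snd c x)"
    using x x_k by simp
  then show ?thesis
    by (simp add: frechet_derivative_works o_def)
qed

lemma dir_deriv_component:
  "dir_deriv N x w (\<lambda>y. X y k) = frechet_derivative ((\<lambda>y. X y k) \<circ> chart_inv c) (at (snd c x)) (w c)"
  by (simp add: dir_deriv_def Let_def)

lemma dir_deriv_coefficient:
  assumes X: "field_along N M X"
  shows "dir_deriv N x w (\<lambda>y. \<beta> y * (X y k \<bullet> b)) = dir_deriv N x w (\<lambda>y. X y k) \<bullet> b"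
proof -
  from has_derivative_mult[OF \<beta>_deriv_N has_derivative_inner_left[OF component_has_derivative[OF X], of b]]
  have "(((\<lambda>y. \<beta> y * (X y k \<bullet> b)) \<circ> chart_inv c) has_derivative
      (\<lambda>h. frechet_derivative ((\<lambda>y. X y k) \<circ> chart_inv c) (at (snd c x)) h \<bullet> b)) (at (snd c x))"
    by (simp add: o_def chart_inv_chart[OF N c_atlas x_c] \<beta>_x)
  from dir_deriv_eq[OF this] show ?thesis
    by (simp only: dir_deriv_component)
qed

text \<open>
  In terms of the coordinate frame \<open>e\<^sub>b\<close> at \<open>x\<close> this is the formula
  \<open>D\<^sub>w X = dX\<^sup>b(w) e\<^sub>b + X\<^sup>b D\<^sub>w e\<^sub>b\<close>.
\<close>

lemma connection_formula:
  assumes D: "connection_along N M D" and w: "w \<in> tangent_space N x" and X: "field_along N M X"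
  shows "D x w X = (\<Sum>b\<in>Basis. (dir_deriv N x w (\<lambda>y. X y k) \<bullet> b) *\<^sub>R frame b x
    + (X x k \<bullet> b) *\<^sub>R D x w (frame b))"
proof -
  have "D x w X = (\<Sum>b\<in>Basis. dir_deriv N x w (\<lambda>y. \<beta> y * (X y k \<bullet> b)) *\<^sub>R frame b x
      + (\<beta> x * (X x k \<bullet> b)) *\<^sub>R D x w (frame b))"
  proof (rule connection_expansion[OF inc D x w X _ _ smooth_fun_\<beta>\<beta> _ \<beta>\<beta>_deriv])
    show "smooth_fun N (\<lambda>y. \<beta> y * (X y k \<bullet> b))" for b
      by (rule smooth_fun_coefficient[OF X])
    show "field_along N M (frame b)" for b
      by (rule field_along_frame)
    show "\<beta> x * \<beta> x = 1"
      by (simp add: \<beta>_x)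
    show "(\<beta> y * \<beta> y) *\<^sub>R X y = (\<Sum>b\<in>Basis. (\<beta> y * (X y k \<bullet> b)) *\<^sub>R frame b y)"
      if "y \<in> points N" for y
      by (rule frame_expansion[OF X that])
  qed
  then show ?thesis
    by (simp only: dir_deriv_coefficient[OF X] \<beta>_x mult_1_left)
qed

end

lemma ambient_frame_exists:
  assumes inc: "smooth_inclusion N M" and x: "x \<in> points N"
  obtains \<beta> C where "ambient_frame N M x \<beta> C"
proof -
  note mf = smooth_inclusion_manifold[OF inc]
  have "chart_at M x \<in> charts_at M x"
    using chart_at_in[OF mf(2)] mf(3) x by blast
  from charts_atD[OF this] have k: "chart_at M x \<in> atlas M" "x \<in> fst (chart_at M x)" .
  obtain \<beta> :: "_ \<Rightarrow> real" and C where \<beta>: "smooth_fun_on M (points M) \<beta>" "\<beta> x = 1"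
    "\<And>c. c \<in> charts_at M x \<Longrightarrow> ((\<beta> \<circ> chart_inv c) has_derivative (\<lambda>v. 0)) (at (snd c x))"
    "closedin (mtop M) C" "C \<subseteq> fst (chart_at M x)" "\<And>y. y \<notin> C \<Longrightarrow> \<beta> y = 0"
    by (rule mfd_bump[OF mf(2) smooth_manifold_chart(1)[OF mf(2) k(1)] k(2)]) blast
  show thesis
    by (rule that) (unfold_locales; fact inc x \<beta>)
qed

section \<open>The pullback of the Levi-Civita connection\<close>

lemma pullback_connectionD:
  assumes "pullback_connection N M nabla D"
  shows "connection_along N M D"
    and "\<lbrakk>vector_field M X; x \<in> points N; w \<in> tangent_space N x\<rbrakk> \<Longrightarrow>
      D x w X = nabla x (push N M x w) X"
  using assms unfolding pullback_connection_def by blast+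

lemma levi_civitaD:
  assumes "levi_civita M g nabla"
  shows "connection_along M M nabla"
    and "\<lbrakk>vector_field M X; vector_field M Y; x \<in> points M\<rbrakk> \<Longrightarrow>
      nabla x (X x) Y - nabla x (Y x) X = lie_bracket M X Y x"
    and "\<lbrakk>vector_field M X; vector_field M Y; vector_field M Z; x \<in> points M\<rbrakk> \<Longrightarrow>
      dir_deriv M x (X x) (\<lambda>y. g y (Y y) (Z y)) =
        g x (nabla x (X x) Y) (Z x) + g x (Y x) (nabla x (X x) Z)"
proof -
  note * = assms[unfolded levi_civita_def]
  show "connection_along M M nabla"
    by (rule conjunct1[OF *])
  show "\<lbrakk>vector_field M X; vector_field M Y; x \<in> points M\<rbrakk> \<Longrightarrow>
      nabla x (X x) Y - nabla x (Y x) X = lie_bracket M X Y x"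
    using conjunct1[OF conjunct2[OF *]] by simp
  show "\<lbrakk>vector_field M X; vector_field M Y; vector_field M Z; x \<in> points M\<rbrakk> \<Longrightarrow>
      dir_deriv M x (X x) (\<lambda>y. g y (Y y) (Z y)) =
        g x (nabla x (X x) Y) (Z x) + g x (Y x) (nabla x (X x) Z)"
    using conjunct2[OF conjunct2[OF *]] by simp
qed

lemma locally_metallicD:
  "\<lbrakk>locally_metallic M J nabla; vector_field M W; vector_field M U; x \<in> points M\<rbrakk> \<Longrightarrow>
    nabla x (W x) (\<lambda>y. J y (U y)) = J x (nabla x (W x) U)"
  by (simp add: locally_metallic_def)

context ambient_frame
begin

lemma frame_push:
  assumes "w \<in> tangent_space N x"
  shows "frame (push N M x w k) x = push N M x w"
  unfolding frame_x by (rule coord_vec_component[OF push_in_tangent_space[OF inc x assms] k])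

lemma pullback_frame:
  assumes "pullback_connection N M nabla D" "w \<in> tangent_space N x"
  shows "D x w (frame b) = nabla x (push N M x w) (frame b)"
  by (rule pullback_connectionD(2)[OF assms(1) vector_field_frame x assms(2)])

text \<open>
  Differentiate \<open>g(X, Y) = X\<^sup>b Y\<^sup>c g\<^sub>b\<^sub>c\<close> with the product rule.
\<close>

lemma metric_compatible:
  assumes g: "semi_riemannian M g" and lc: "levi_civita M g nabla"
    and pb: "pullback_connection N M nabla D" and w: "w \<in> tangent_space N x"
    and X: "field_along N M X" and Y: "field_along N M Y"
  shows "dir_deriv N x w (\<lambda>y. g y (X y) (Y y)) = g x (D x w X) (Y x) + g x (X x) (D x w Y)"
proof -
  note D = pullback_connectionD(1)[OF pb]
  define G where "G b b' u = g (chart_inv k u) (coord_vec M k (chart_inv k u) b)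
    (coord_vec M k (chart_inv k u) b')" for b b' u
  define dG where "dG b b' = frechet_derivative (G b b') (at (snd k x))" for b b'
  define dX where "dX = frechet_derivative ((\<lambda>y. X y k) \<circ> chart_inv c) (at (snd c x))"
  define dY where "dY = frechet_derivative ((\<lambda>y. Y y k) \<circ> chart_inv c) (at (snd c x))"
  define \<Phi> where "\<Phi> = frechet_derivative (snd k \<circ> chart_inv c) (at (snd c x))"
  let ?\<Gamma> = "\<lambda>b. D x w (frame b)"
  note kM = smooth_manifold_chart[OF M k_atlas]
  note tr = smooth_inclusion_transition[OF inc c_atlas k_atlas]
  have xk: "snd k x \<in> snd k ` fst k"
    using x_k by simp
  have xP: "snd c x \<in> snd c ` (fst c \<inter> fst k)"
    using x_c x_k by simp
  have "smooth_on (snd k ` fst k) (G b b')" for b b'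
    using g k_atlas unfolding semi_riemannian_def Let_def G_def by blast
  then have G: "(G b b' has_derivative dG b b') (at (snd k x))" for b b'
    unfolding dG_def frechet_derivative_works[symmetric] by (rule smooth_on_differentiable[OF kM(2) _ xk])
  have Gk: "(((\<lambda>y. G b b' (snd k y)) \<circ> chart_inv k) has_derivative dG b b') (at (snd k x))" for b b'
    by (rule has_derivative_transform_within_open[OF G kM(2) xk])
      (auto simp: chart_inv_chart[OF M k_atlas])
  have Gc: "((\<lambda>u. G b b' (snd k (chart_inv c u))) has_derivative (\<lambda>h. dG b b' (\<Phi> h))) (at (snd c x))" for b b'
    using inclusion_chain[OF inc c k Gk] by (simp add: o_def \<Phi>_def)
  \<comment> \<open>the derivative of the metric coefficients, by metric compatibility for the frame fields\<close>
  have dG: "dG b b' (push N M x w k) = g x (?\<Gamma> b) (frame b' x) + g x (frame b x) (?\<Gamma> b')" for b b'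
  proof -
    have "((\<lambda>u. \<beta> (chart_inv k u) * (\<beta> (chart_inv k u) * G b b' u)) has_derivative dG b b') (at (snd k x))"
      using has_derivative_mult[OF \<beta>_deriv[OF k, unfolded o_def]
          has_derivative_mult[OF \<beta>_deriv[OF k, unfolded o_def] G]]
      by (simp add: \<beta>_x chart_inv_chart[OF M k_atlas x_k])
    then have "(((\<lambda>y. g y (frame b y) (frame b' y)) \<circ> chart_inv k) has_derivative dG b b') (at (snd k x))"
    proof (rule has_derivative_transform_within_open[OF _ kM(2) xk])
      fix u assume "u \<in> snd k ` fst k"
      then obtain y where y: "y \<in> fst k" "u = snd k y"
        by blast
      then have yM: "y \<in> points M" and ky: "k \<in> charts_at M y"
        using chart_subset_points[OF M k_atlas] k_atlas by (auto intro: charts_atI)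
      interpret symmetric_form "tangent_space M y" "g y"
        by (rule semi_riemannian_form[OF g yM])
      note ce = coord_vec_in_tangent_space[OF M ky]
      show "\<beta> (chart_inv k u) * (\<beta> (chart_inv k u) * G b b' u) =
          ((\<lambda>y. g y (frame b y) (frame b' y)) \<circ> chart_inv k) u"
        by (simp add: y(2) chart_inv_chart[OF M k_atlas y(1)] frame_def G_def
            scale_left scale_right ce subspace_scale[OF T])
    qed
    from dir_deriv_eq[OF this, of "push N M x w"] show ?thesis
      using levi_civitaD(3)[OF lc vector_field_frame vector_field_frame vector_field_frame xM,
          of "push N M x w k" b b'] by (simp add: frame_push[OF w] pullback_frame[OF pb w])
  qed
  have expand: "g y (X y) (Y y) = (\<Sum>b\<in>Basis. \<Sum>b'\<in>Basis. (X y k \<bullet> b) * ((Y y k \<bullet> b') * G b b' (snd k y)))"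
    if y: "y \<in> points N" "y \<in> fst k" for y
  proof -
    have yM: "y \<in> points M" and ky: "k \<in> charts_at M y"
      using y NM k_atlas by (auto intro: charts_atI)
    interpret symmetric_form "tangent_space M y" "g y"
      by (rule semi_riemannian_form[OF g yM])
    note ce = coord_vec_in_tangent_space[OF M ky]
    have "g y (X y) (Y y) = g y (\<Sum>b\<in>Basis. (X y k \<bullet> b) *\<^sub>R coord_vec M k y b)
        (\<Sum>b'\<in>Basis. (Y y k \<bullet> b') *\<^sub>R coord_vec M k y b')"
      by (rule arg_cong2[OF tangent_vector_expansion[OF M smooth_alongD(1)[OF X y(1)] ky]
            tangent_vector_expansion[OF M smooth_alongD(1)[OF Y y(1)] ky]])
    also have "\<dots> = (\<Sum>b\<in>Basis. \<Sum>b'\<in>Basis. g y ((X y k \<bullet> b) *\<^sub>R coord_vec M k y b)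
        ((Y y k \<bullet> b') *\<^sub>R coord_vec M k y b'))"
      by (rule sum_both) (simp_all add: ce subspace_scale[OF T])
    also have "\<dots> = (\<Sum>b\<in>Basis. \<Sum>b'\<in>Basis. (X y k \<bullet> b) * ((Y y k \<bullet> b') * G b b' (snd k y)))"
      by (simp add: scale_left scale_right ce subspace_scale[OF T] G_def
          chart_inv_chart[OF M k_atlas y(2)] mult.left_commute)
    finally show ?thesis .
  qed
  have Xc: "((\<lambda>u. X (chart_inv c u) k) has_derivative dX) (at (snd c x))"
    and Yc: "((\<lambda>u. Y (chart_inv c u) k) has_derivative dY) (at (snd c x))"
    unfolding dX_def dY_def by (rule component_has_derivative[OF X], rule component_has_derivative[OF Y])
  have cx: "chart_inv c (snd c x) = x"
    by (rule chart_inv_chart[OF N c_atlas x_c])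
  have "((\<lambda>u. \<Sum>b\<in>Basis. \<Sum>b'\<in>Basis. (X (chart_inv c u) k \<bullet> b) *
      ((Y (chart_inv c u) k \<bullet> b') * G b b' (snd k (chart_inv c u)))) has_derivative
      (\<lambda>h. \<Sum>b\<in>Basis. \<Sum>b'\<in>Basis. (X x k \<bullet> b) * ((Y x k \<bullet> b') * dG b b' (\<Phi> h) + (dY h \<bullet> b') * G b b' (snd k x)) +
        (dX h \<bullet> b) * ((Y x k \<bullet> b') * G b b' (snd k x)))) (at (snd c x))" (is "(_ has_derivative ?F) _")
    using has_derivative_sum[of Basis, OF has_derivative_sum[of Basis, OF
      has_derivative_mult[OF has_derivative_inner_left[OF Xc]
        has_derivative_mult[OF has_derivative_inner_left[OF Yc] Gc]]]]
    unfolding cx .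
  then have "(((\<lambda>y. g y (X y) (Y y)) \<circ> chart_inv c) has_derivative ?F) (at (snd c x))"
  proof (rule has_derivative_transform_within_open[OF _ tr(1) xP])
    fix u assume "u \<in> snd c ` (fst c \<inter> fst k)"
    then obtain y where y: "y \<in> fst c" "y \<in> fst k" "u = snd c y"
      by blast
    have yN: "y \<in> points N"
      using y(1) chart_subset_points[OF N c_atlas] by blast
    show "(\<Sum>b\<in>Basis. \<Sum>b'\<in>Basis. (X (chart_inv c u) k \<bullet> b) *
      ((Y (chart_inv c u) k \<bullet> b') * G b b' (snd k (chart_inv c u)))) =
      ((\<lambda>y. g y (X y) (Y y)) \<circ> chart_inv c) u"
      by (simp add: y(3) chart_inv_chart[OF N c_atlas y(1)] expand[OF yN y(2)])
  qed
  from dir_deriv_eq[OF this]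
  have "dir_deriv N x w (\<lambda>y. g y (X y) (Y y)) = ?F (w c)" .
  also have "\<Phi> (w c) = push N M x w k"
    unfolding \<Phi>_def by (rule push_component[OF inc w c k, symmetric])
  also have "(\<Sum>b\<in>Basis. \<Sum>b'\<in>Basis.
      (X x k \<bullet> b) * ((Y x k \<bullet> b') * dG b b' (push N M x w k) + (dY (w c) \<bullet> b') * G b b' (snd k x)) +
        (dX (w c) \<bullet> b) * ((Y x k \<bullet> b') * G b b' (snd k x))) =
      g x (D x w X) (Y x) + g x (X x) (D x w Y)"
  proof -
    interpret symmetric_form "tangent_space M x" "g x"
      by (rule semi_riemannian_form[OF g xM])
    note e = frame_in_tangent_space
    have \<Gamma>: "?\<Gamma> b \<in> tangent_space M x" for b
      by (rule connection_in_tangent_space[OF D x w field_along_frame])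
    note mem = e \<Gamma> subspace_scale[OF T] subspace_add[OF T]
    have val: "Z x = (\<Sum>b\<in>Basis. (Z x k \<bullet> b) *\<^sub>R frame b x)" if "field_along N M Z" for Z
      unfolding frame_x by (rule tangent_vector_expansion[OF M smooth_alongD(1)[OF that x] k])
    have G_x: "G b b' (snd k x) = g x (frame b x) (frame b' x)" for b b'
      by (simp add: G_def frame_x chart_inv_chart[OF M k_atlas x_k])
    have DX: "D x w X = (\<Sum>b\<in>Basis. (dX (w c) \<bullet> b) *\<^sub>R frame b x + (X x k \<bullet> b) *\<^sub>R ?\<Gamma> b)"
      using connection_formula[OF D w X] unfolding dir_deriv_component dX_def .
    have DY: "D x w Y = (\<Sum>b\<in>Basis. (dY (w c) \<bullet> b) *\<^sub>R frame b x + (Y x k \<bullet> b) *\<^sub>R ?\<Gamma> b)"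
      using connection_formula[OF D w Y] unfolding dir_deriv_component dY_def .
    have "g x (D x w X) (Y x) = (\<Sum>b\<in>Basis. \<Sum>b'\<in>Basis.
        g x ((dX (w c) \<bullet> b) *\<^sub>R frame b x + (X x k \<bullet> b) *\<^sub>R ?\<Gamma> b) ((Y x k \<bullet> b') *\<^sub>R frame b' x))"
      unfolding DX by (subst val[OF Y], rule sum_both) (simp_all add: mem)
    moreover have "g x (X x) (D x w Y) = (\<Sum>b\<in>Basis. \<Sum>b'\<in>Basis.
        g x ((X x k \<bullet> b) *\<^sub>R frame b x) ((dY (w c) \<bullet> b') *\<^sub>R frame b' x + (Y x k \<bullet> b') *\<^sub>R ?\<Gamma> b'))"
      unfolding DY by (subst val[OF X], rule sum_both) (simp_all add: mem)
    ultimately show ?thesis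
      unfolding dG G_x sum.distrib[symmetric]
    proof (simp only: sum.distrib[symmetric], intro sum.cong refl)
      fix b b' :: 'e
      show "(X x k \<bullet> b) * ((Y x k \<bullet> b') * (g x (?\<Gamma> b) (frame b' x) + g x (frame b x) (?\<Gamma> b'))
          + (dY (w c) \<bullet> b') * g x (frame b x) (frame b' x))
          + (dX (w c) \<bullet> b) * ((Y x k \<bullet> b') * g x (frame b x) (frame b' x)) =
        g x ((dX (w c) \<bullet> b) *\<^sub>R frame b x + (X x k \<bullet> b) *\<^sub>R ?\<Gamma> b) ((Y x k \<bullet> b') *\<^sub>R frame b' x) +
        g x ((X x k \<bullet> b) *\<^sub>R frame b x) ((dY (w c) \<bullet> b') *\<^sub>R frame b' x + (Y x k \<bullet> b') *\<^sub>R ?\<Gamma> b')"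
        by (rule combination_product[OF e \<Gamma> e \<Gamma>, symmetric])
    qed
  qed
  finally show ?thesis .
qed

lemma tensor_parallel:
  assumes J: "tensor_field11 M J" and lm: "locally_metallic M J nabla"
    and lc: "levi_civita M g nabla"
    and pb: "pullback_connection N M nabla D" and w: "w \<in> tangent_space N x"
    and X: "field_along N M X"
  shows "D x w (\<lambda>y. J y (X y)) = J x (D x w X)"
proof -
  note D = pullback_connectionD(1)[OF pb]
  let ?f = "\<lambda>b y. \<beta> y * (X y k \<bullet> b)"
  have op: "openin (mtop N) (points N)"
    by simp
  have Jframe: "vector_field M (\<lambda>y. J y (frame b y))" for b
    by (rule smooth_along_tensor[OF smooth_inclusion_refl[OF M] J _ vector_field_frame]) simp
  have fr: "frame b y \<in> tangent_space M y" if "y \<in> points N" for b y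
    by (rule smooth_alongD(1)[OF field_along_frame that])
  have \<beta>\<beta>_x: "\<beta> x * \<beta> x = 1"
    by (simp add: \<beta>_x)
  have "D x w (\<lambda>y. J y (X y)) =
      (\<Sum>b\<in>Basis. dir_deriv N x w (?f b) *\<^sub>R J x (frame b x) + ?f b x *\<^sub>R D x w (\<lambda>y. J y (frame b y)))"
  proof (rule connection_expansion[OF inc D x w _ _ _ smooth_fun_\<beta>\<beta> \<beta>\<beta>_x \<beta>\<beta>_deriv])
    show "field_along N M (\<lambda>y. J y (X y))"
      by (rule smooth_along_tensor[OF inc J op X])
    show "smooth_fun N (?f b)" for b
      by (rule smooth_fun_coefficient[OF X])
    show "field_along N M (\<lambda>y. J y (frame b y))" for b
      by (rule vector_field_restrict[OF inc Jframe])
    fix y assume y: "y \<in> points N"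
    then have yM: "y \<in> points M"
      using NM by blast
    have Xy: "X y \<in> tangent_space M y"
      by (rule smooth_alongD(1)[OF X y])
    have "(\<beta> y * \<beta> y) *\<^sub>R J y (X y) = J y ((\<beta> y * \<beta> y) *\<^sub>R X y)"
      using tensor_field11D(2)[OF J yM Xy Xy, of "\<beta> y * \<beta> y" 0] by simp
    also have "\<dots> = (\<Sum>b\<in>Basis. ?f b y *\<^sub>R J y (frame b y))"
      unfolding frame_expansion[OF X y] by (rule tensor_field11_sum[OF M J yM fr[OF y]])
    finally show "(\<beta> y * \<beta> y) *\<^sub>R J y (X y) = (\<Sum>b\<in>Basis. ?f b y *\<^sub>R J y (frame b y))" .
  qed
  also have "\<dots> = (\<Sum>b\<in>Basis. J x (dir_deriv N x w (?f b) *\<^sub>R frame b x + ?f b x *\<^sub>R D x w (frame b)))"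
  proof (rule sum.cong[OF refl])
    fix b
    have "D x w (\<lambda>y. J y (frame b y)) = nabla x (push N M x w) (\<lambda>y. J y (frame b y))"
      by (rule pullback_connectionD(2)[OF pb Jframe x w])
    also have "\<dots> = J x (nabla x (push N M x w) (frame b))"
      using locally_metallicD[OF lm vector_field_frame vector_field_frame xM, of "push N M x w k" b]
      unfolding frame_push[OF w] .
    also have "\<dots> = J x (D x w (frame b))"
      by (simp only: pullback_frame[OF pb w])
    finally show "dir_deriv N x w (?f b) *\<^sub>R J x (frame b x) + ?f b x *\<^sub>R D x w (\<lambda>y. J y (frame b y)) =
        J x (dir_deriv N x w (?f b) *\<^sub>R frame b x + ?f b x *\<^sub>R D x w (frame b))"
      by (simp only: tensor_field11D(2)[OF J xM frame_in_tangent_space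
            connection_in_tangent_space[OF D x w field_along_frame]])
  qed
  also have "\<dots> = J x (\<Sum>b\<in>Basis. dir_deriv N x w (?f b) *\<^sub>R frame b x + ?f b x *\<^sub>R D x w (frame b))"
  proof -
    note T = subspace_tangent_space[OF M]
    have "dir_deriv N x w (?f b) *\<^sub>R frame b x + ?f b x *\<^sub>R D x w (frame b) \<in> tangent_space M x" for b
      by (intro subspace_add subspace_scale T frame_in_tangent_space
          connection_in_tangent_space[OF D x w field_along_frame])
    then have "J x (\<Sum>b\<in>Basis. 1 *\<^sub>R (dir_deriv N x w (?f b) *\<^sub>R frame b x + ?f b x *\<^sub>R D x w (frame b))) =
        (\<Sum>b\<in>Basis. 1 *\<^sub>R J x (dir_deriv N x w (?f b) *\<^sub>R frame b x + ?f b x *\<^sub>R D x w (frame b)))"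
      by (rule tensor_field11_sum[OF M J xM])
    then show ?thesis
      unfolding scaleR_one by (rule HOL.sym)
  qed
  also have "(\<Sum>b\<in>Basis. dir_deriv N x w (?f b) *\<^sub>R frame b x + ?f b x *\<^sub>R D x w (frame b)) = D x w X"
    by (rule connection_expansion[OF inc D x w X smooth_fun_coefficient[OF X] field_along_frame
      smooth_fun_\<beta>\<beta> \<beta>\<beta>_x \<beta>\<beta>_deriv frame_expansion[OF X], symmetric])
  finally show ?thesis .
qed

text \<open>
  The components of the frame fields have vanishing derivative at \<open>x\<close>, hence their Lie brackets
  vanish there.
\<close>

lemma frame_torsion_free:
  assumes lc: "levi_civita M g nabla"
  shows "nabla x (frame a x) (frame b) = nabla x (frame b x) (frame a)"
proof -
  note D = levi_civitaD(1)[OF lc]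
  have "dir_deriv M x v (\<lambda>y. frame e y k) = 0" for v e
  proof -
    have "((\<lambda>u. \<beta> (chart_inv k u) *\<^sub>R e) has_derivative (\<lambda>h. 0)) (at (snd k x))"
      using has_derivative_scaleR_left[OF \<beta>_deriv[OF k], of e] by (simp add: o_def)
    then have "(((\<lambda>y. frame e y k) \<circ> chart_inv k) has_derivative (\<lambda>h. 0)) (at (snd k x))"
    proof (rule has_derivative_transform_within_open[OF _ smooth_manifold_chart(2)[OF M k_atlas]])
      show "snd k x \<in> snd k ` fst k"
        using x_k by simp
      show "\<beta> (chart_inv k u) *\<^sub>R e = ((\<lambda>y. frame e y k) \<circ> chart_inv k) u" if "u \<in> snd k ` fst k" for u
        using that by (auto simp: chart_inv_chart[OF M k_atlas] frame_component)
    qed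
    from dir_deriv_eq[OF this] show ?thesis .
  qed
  then have "lie_bracket M (frame a) (frame b) x k = 0"
    by (simp add: lie_bracket_def)
  then have "nabla x (frame a x) (frame b) k = nabla x (frame b x) (frame a) k"
    using arg_cong[OF levi_civitaD(2)[OF lc vector_field_frame vector_field_frame xM, of a b], of "\<lambda>v. v k"]
    by simp
  then show ?thesis
    by (rule tangent_space_eqI[OF
        connection_in_tangent_space[OF D xM frame_in_tangent_space vector_field_frame]
        connection_in_tangent_space[OF D xM frame_in_tangent_space vector_field_frame] k])
qed

text \<open>
  The tangent vectors to \<open>N\<close> at \<open>x\<close> extend to vector fields on \<open>N\<close> whose brackets vanish at \<open>x\<close>,
  hence their covariant derivatives at \<open>x\<close> are symmetric.
\<close>

lemma torsion_free_extension:
  assumes lc: "levi_civita M g nabla" and pb: "pullback_connection N M nabla D"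
  obtains ext where "\<And>v. v \<in> tangent_space N x \<Longrightarrow> vector_field N (ext v)"
    "\<And>v. v \<in> tangent_space N x \<Longrightarrow> ext v x = v"
    "\<And>v w. \<lbrakk>v \<in> tangent_space N x; w \<in> tangent_space N x\<rbrakk> \<Longrightarrow>
      D x v (\<lambda>y. push N M y (ext w y)) = D x w (\<lambda>y. push N M y (ext v y))"
proof -
  note D = pullback_connectionD(1)[OF pb]
  obtain \<gamma> :: "'a \<Rightarrow> real" and C' where \<gamma>: "smooth_fun_on N (points N) \<gamma>" "\<gamma> x = 1"
    "\<And>c. c \<in> charts_at N x \<Longrightarrow> ((\<gamma> \<circ> chart_inv c) has_derivative (\<lambda>v. 0)) (at (snd c x))"
    "closedin (mtop N) C'" "C' \<subseteq> fst c" "\<And>y. y \<notin> C' \<Longrightarrow> \<gamma> y = 0"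
    by (rule mfd_bump[OF N smooth_manifold_chart(1)[OF N c_atlas] x_c]) blast
  define ext where "ext v y = \<gamma> y *\<^sub>R coord_vec N c y (v c)" for v :: "('a, 'm) tvec" and y
  let ?P = "\<lambda>v y. push N M y (ext v y)"
  have vf: "vector_field N (ext v)" for v
    unfolding ext_def
    by (rule smooth_along_bump[OF smooth_inclusion_refl[OF N] \<gamma>(1,4,5,6)
          smooth_manifold_chart(1)[OF N c_atlas] smooth_along_coord_vec[OF N c_atlas]])
  have ext_x: "ext v x = v" if "v \<in> tangent_space N x" for v
    by (simp add: ext_def \<gamma>(2) coord_vec_component[OF that c])
  have P: "field_along N M (?P v)" for v
    by (rule field_along_push[OF inc vf])
  let ?\<phi> = "snd k \<circ> chart_inv c"
  note tr = smooth_inclusion_transition[OF inc c_atlas k_atlas]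
  have xP: "snd c x \<in> snd c ` (fst c \<inter> fst k)"
    using x_c x_k by simp
  \<comment> \<open>near \<open>x\<close> the components of the field are \<open>\<gamma>\<close> times a derivative of the inclusion in coordinates\<close>
  have dP: "dir_deriv N x w (\<lambda>y. ?P v y k) =
      frechet_derivative (\<lambda>u. frechet_derivative ?\<phi> (at u) (v c)) (at (snd c x)) (w c)" for v w
  proof -
    let ?F = "frechet_derivative (\<lambda>u. frechet_derivative ?\<phi> (at u) (v c)) (at (snd c x))"
    have "((\<lambda>u. frechet_derivative ?\<phi> (at u) (v c)) has_derivative ?F) (at (snd c x))"
      using smooth_on_differentiable[OF tr(1) smooth_on_frechet[OF tr(2)] xP]
      by (simp only: frechet_derivative_works)
    from has_derivative_scaleR[OF \<gamma>(3)[OF c] this]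
    have "((\<lambda>u. \<gamma> (chart_inv c u) *\<^sub>R frechet_derivative ?\<phi> (at u) (v c)) has_derivative ?F) (at (snd c x))"
      by (simp add: \<gamma>(2) chart_inv_chart[OF N c_atlas x_c])
    then have "(((\<lambda>y. ?P v y k) \<circ> chart_inv c) has_derivative ?F) (at (snd c x))"
    proof (rule has_derivative_transform_within_open[OF _ tr(1) xP])
      fix u assume "u \<in> snd c ` (fst c \<inter> fst k)"
      then obtain y where y: "y \<in> fst c" "y \<in> fst k" "u = snd c y"
        by blast
      have cy: "c \<in> charts_at N y" and ky: "k \<in> charts_at M y"
        using y c_atlas k_atlas by (auto intro: charts_atI)
      have e: "ext v y \<in> tangent_space N y"
        unfolding ext_def
        by (intro subspace_scale subspace_tangent_space[OF N] coord_vec_in_tangent_space[OF N cy])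
      have "?P v y k = frechet_derivative ?\<phi> (at (snd c y)) (\<gamma> y *\<^sub>R v c)"
        unfolding push_component[OF inc e cy ky]
        by (simp add: ext_def scaleR_fun_def coord_vec_self[OF N cy])
      also have "\<dots> = \<gamma> y *\<^sub>R frechet_derivative ?\<phi> (at (snd c y)) (v c)"
        by (rule linear_scale[OF transition_linear[OF inc cy ky]])
      finally show "\<gamma> (chart_inv c u) *\<^sub>R frechet_derivative ?\<phi> (at u) (v c) =
          ((\<lambda>y. ?P v y k) \<circ> chart_inv c) u"
        by (simp add: y(3) chart_inv_chart[OF N c_atlas y(1)])
    qed
    from dir_deriv_eq[OF this] show ?thesis .
  qed
  have push_x: "?P v x = push N M x v" if "v \<in> tangent_space N x" for v
    by (simp only: ext_x[OF that])
  have form: "D x w (?P v) = (\<Sum>b\<in>Basis. (frechet_derivative (\<lambda>u. frechet_derivative ?\<phi> (at u) (v c)) (at (snd c x)) (w c) \<bullet> b) *\<^sub>R frame b x)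
      + (\<Sum>b\<in>Basis. \<Sum>a\<in>Basis. ((push N M x v k \<bullet> b) * (push N M x w k \<bullet> a)) *\<^sub>R nabla x (frame a x) (frame b))"
    if v: "v \<in> tangent_space N x" and w: "w \<in> tangent_space N x" for v w
  proof -
    have "D x w (frame b) = (\<Sum>a\<in>Basis. (push N M x w k \<bullet> a) *\<^sub>R nabla x (frame a x) (frame b))" for b
    proof -
      have "push N M x w = (\<Sum>a\<in>Basis. (push N M x w k \<bullet> a) *\<^sub>R frame a x)"
        unfolding frame_x by (rule tangent_vector_expansion[OF M push_in_tangent_space[OF inc x w] k])
      from arg_cong[OF this, of "\<lambda>v. nabla x v (frame b)"]
      show ?thesis
        unfolding pullback_frame[OF pb w]
          connection_sum_direction[OF M levi_civitaD(1)[OF lc] xM frame_in_tangent_space vector_field_frame] .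
    qed
    then show ?thesis
      unfolding connection_formula[OF D w P] push_x[OF v] dP sum.distrib
      by (simp only: scaleR_sum_right scaleR_scaleR)
  qed
  have "D x v (?P w) = D x w (?P v)" if v: "v \<in> tangent_space N x" and w: "w \<in> tangent_space N x" for v w
  proof -
    have 1: "frechet_derivative (\<lambda>u. frechet_derivative ?\<phi> (at u) (v c)) (at (snd c x)) (w c) =
        frechet_derivative (\<lambda>u. frechet_derivative ?\<phi> (at u) (w c)) (at (snd c x)) (v c)"
      by (rule symmetric_second_derivative[OF tr(1,2) xP])
    have 2: "(\<Sum>b\<in>Basis. \<Sum>a\<in>Basis. ((push N M x v k \<bullet> b) * (push N M x w k \<bullet> a)) *\<^sub>R nabla x (frame a x) (frame b)) =
        (\<Sum>b\<in>Basis. \<Sum>a\<in>Basis. ((push N M x w k \<bullet> b) * (push N M x v k \<bullet> a)) *\<^sub>R nabla x (frame a x) (frame b))"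
    proof (subst sum.swap, intro sum.cong refl)
      fix a b :: 'e
      show "((push N M x v k \<bullet> a) * (push N M x w k \<bullet> b)) *\<^sub>R nabla x (frame b x) (frame a) =
          ((push N M x w k \<bullet> b) * (push N M x v k \<bullet> a)) *\<^sub>R nabla x (frame a x) (frame b)"
        by (simp only: frame_torsion_free[OF lc, of b a] mult.commute)
    qed
    show ?thesis
      by (simp only: form[OF v w] form[OF w v] 1 2)
  qed
  then show thesis
    by (intro that[of ext] vf ext_x)
qed

end

section \<open>Linear algebra at a point\<close>

lemma subspace_set_plus:
  assumes "subspace A" "subspace C"
  shows "subspace (A + C)"
proof -
  have "A + C = {x + y |x y. x \<in> A \<and> y \<in> C}"
    by (auto simp: set_plus_def)
  then show ?thesis
    using subspace_sums[OF assms] by simp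
qed

lemma component_eqI:
  assumes "subspace A" "subspace C" and zero: "\<And>v. \<lbrakk>v \<in> A; v \<in> C\<rbrakk> \<Longrightarrow> v = 0"
    and v: "v = a + c" "a \<in> A" "c \<in> C"
  shows "component A C v = a"
  unfolding component_def
proof (rule the_equality)
  show "a \<in> A \<and> v - a \<in> C"
    using v by simp
  fix b assume b: "b \<in> A \<and> v - b \<in> C"
  have "b - a \<in> A"
    using b v(2) by (intro subspace_diff[OF assms(1)]) simp_all
  moreover have "c - (v - b) \<in> C"
    using b v(3) subspace_diff[OF assms(2), of c "v - b"] by blast
  then have "b - a \<in> C"
    by (simp add: v(1))
  ultimately show "b = a"
    using zero[of "b - a"] by simp
qed

text \<open>
  The situation in one tangent space: \<open>T\<close> is decomposed into the screen space \<open>S\<close>, the radical \<open>R\<close>, the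
  lightlike transversal space \<open>L\<close> and the screen transversal space \<open>P\<close>, and \<open>J\<close> is a self-adjoint
  solution of \<open>J\<^sup>2 = p J + q\<close> that maps \<open>S\<close>, \<open>R\<close> and \<open>L\<close> into \<open>P\<close>.  The images and the orthogonal
  complement of their sum in \<open>P\<close> span \<open>P\<close>.
\<close>

locale metallic_point = symmetric_form T B
  for T :: "'v::real_vector set" and B :: "'v \<Rightarrow> 'v \<Rightarrow> real" +
  fixes J :: "'v \<Rightarrow> 'v" and p q :: real and S R L P :: "'v set"
  assumes q: "0 < q"
    and J_in: "v \<in> T \<Longrightarrow> J v \<in> T"
    and J_lin: "\<lbrakk>v \<in> T; w \<in> T\<rbrakk> \<Longrightarrow> J (a *\<^sub>R v + b *\<^sub>R w) = a *\<^sub>R J v + b *\<^sub>R J w"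
    and J_sq: "v \<in> T \<Longrightarrow> J (J v) = p *\<^sub>R J v + q *\<^sub>R v"
    and J_sym: "\<lbrakk>v \<in> T; w \<in> T\<rbrakk> \<Longrightarrow> B (J v) w = B v (J w)"
    and nondegenerate: "nondegenerate_on B T" "nondegenerate_on B S"
    and subspaces: "subspace S" "subspace R" "subspace L" "subspace P"
    and T_sum: "S + R + L + P = T"
    and orth: "\<lbrakk>r \<in> R; s \<in> S\<rbrakk> \<Longrightarrow> B r s = 0" "\<lbrakk>r \<in> R; r' \<in> R\<rbrakk> \<Longrightarrow> B r r' = 0"
      "\<lbrakk>z \<in> P; s \<in> S\<rbrakk> \<Longrightarrow> B z s = 0" "\<lbrakk>z \<in> P; r \<in> R\<rbrakk> \<Longrightarrow> B z r = 0"
      "\<lbrakk>l \<in> L; s \<in> S\<rbrakk> \<Longrightarrow> B l s = 0" "\<lbrakk>l \<in> L; z \<in> P\<rbrakk> \<Longrightarrow> B l z = 0"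
      "\<lbrakk>l \<in> L; l' \<in> L\<rbrakk> \<Longrightarrow> B l l' = 0"
    and J_sub: "J ` S \<subseteq> P" "J ` R \<subseteq> P" "J ` L \<subseteq> P"
    and P_sum: "P = J ` R + J ` L + J ` S + {z \<in> P. \<forall>v\<in>R \<union> L \<union> S. B z (J v) = 0}"
begin

text \<open>
  The complement \<open>D\<^sub>o\<close> of \<open>J R + J L + J S\<close> in \<open>P\<close>.
\<close>

definition Do where "Do = {z \<in> P. \<forall>v\<in>R \<union> L \<union> S. B z (J v) = 0}"

lemma in_T: "s \<in> S \<Longrightarrow> s \<in> T" "r \<in> R \<Longrightarrow> r \<in> T" "l \<in> L \<Longrightarrow> l \<in> T" "z \<in> P \<Longrightarrow> z \<in> T"
proof -
  note 0 = subspaces[THEN subspace_0]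
  show "s \<in> S \<Longrightarrow> s \<in> T"
    using set_plus_intro[OF set_plus_intro[OF set_plus_intro[OF _ 0(2)] 0(3)] 0(4), of s S] T_sum by simp
  show "r \<in> R \<Longrightarrow> r \<in> T"
    using set_plus_intro[OF set_plus_intro[OF set_plus_intro[OF 0(1)] 0(3)] 0(4), of r R] T_sum by simp
  show "l \<in> L \<Longrightarrow> l \<in> T"
    using set_plus_intro[OF set_plus_intro[OF set_plus_intro[OF 0(1) 0(2)]] 0(4), of l L] T_sum by simp
  show "z \<in> P \<Longrightarrow> z \<in> T"
    using set_plus_intro[OF set_plus_intro[OF set_plus_intro[OF 0(1) 0(2)] 0(3)], of z P] T_sum by simp
qed

lemma orth':
  "\<lbrakk>r \<in> R; s \<in> S\<rbrakk> \<Longrightarrow> B s r = 0" "\<lbrakk>z \<in> P; s \<in> S\<rbrakk> \<Longrightarrow> B s z = 0" "\<lbrakk>z \<in> P; r \<in> R\<rbrakk> \<Longrightarrow> B r z = 0"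
  "\<lbrakk>l \<in> L; s \<in> S\<rbrakk> \<Longrightarrow> B s l = 0" "\<lbrakk>l \<in> L; z \<in> P\<rbrakk> \<Longrightarrow> B z l = 0"
  using orth sym[OF in_T(1,2)] sym[OF in_T(1,4)] sym[OF in_T(2,4)] sym[OF in_T(1,3)] sym[OF in_T(4,3)]
  by simp_all

lemma decompose:
  assumes "v \<in> T"
  obtains s r l z where "s \<in> S" "r \<in> R" "l \<in> L" "z \<in> P" "v = s + r + l + z"
  using assms unfolding T_sum[symmetric] by (elim set_plus_elim) blast

lemma pairing:
  assumes "s \<in> S" "r \<in> R" "l \<in> L" "z \<in> P"
  shows "u \<in> S \<Longrightarrow> B (s + r + l + z) u = B s u"
    and "r' \<in> R \<Longrightarrow> B (s + r + l + z) r' = B l r'"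
    and "l' \<in> L \<Longrightarrow> B (s + r + l + z) l' = B r l'"
    and "z' \<in> P \<Longrightarrow> B (s + r + l + z) z' = B z z'"
proof -
  note mem = in_T(1)[OF assms(1)] in_T(2)[OF assms(2)] in_T(3)[OF assms(3)] in_T(4)[OF assms(4)]
    subspace_add[OF T]
  have *: "B (s + r + l + z) w = B s w + B r w + B l w + B z w" if "w \<in> T" for w
    using that mem by (simp add: add_left)
  show "u \<in> S \<Longrightarrow> B (s + r + l + z) u = B s u"
    using *[OF in_T(1)] assms by (simp add: orth)
  show "r' \<in> R \<Longrightarrow> B (s + r + l + z) r' = B l r'"
    using *[OF in_T(2)] assms by (simp add: orth orth')
  show "l' \<in> L \<Longrightarrow> B (s + r + l + z) l' = B r l'"
    using *[OF in_T(3)] assms by (simp add: orth orth')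
  show "z' \<in> P \<Longrightarrow> B (s + r + l + z) z' = B z z'"
    using *[OF in_T(4)] assms by (simp add: orth orth')
qed

lemma S_eq_0: "\<lbrakk>s \<in> S; \<And>u. u \<in> S \<Longrightarrow> B s u = 0\<rbrakk> \<Longrightarrow> s = 0"
  using nondegenerate(2) unfolding nondegenerate_on_def by blast

lemma T_eq_0: "\<lbrakk>v \<in> T; \<And>u. u \<in> T \<Longrightarrow> B u v = 0\<rbrakk> \<Longrightarrow> v = 0"
  using nondegenerate(1) sym unfolding nondegenerate_on_def by simp

text \<open>\<open>R\<close> and \<open>L\<close> are in duality, since a vector of one which is orthogonal to the other is orthogonal
  to all of \<open>T\<close>.\<close>

lemma R_eq_0:
  assumes "r \<in> R" "\<And>l. l \<in> L \<Longrightarrow> B l r = 0"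
  shows "r = 0"
proof (rule T_eq_0[OF in_T(2)[OF assms(1)]])
  fix v assume "v \<in> T"
  then obtain s r' l z where "s \<in> S" "r' \<in> R" "l \<in> L" "z \<in> P" "v = s + r' + l + z"
    by (rule decompose)
  then show "B v r = 0"
    using assms pairing(2) by simp
qed

lemma L_eq_0:
  assumes "l \<in> L" "\<And>r. r \<in> R \<Longrightarrow> B r l = 0"
  shows "l = 0"
proof (rule T_eq_0[OF in_T(3)[OF assms(1)]])
  fix v assume "v \<in> T"
  then obtain s r l' z where "s \<in> S" "r \<in> R" "l' \<in> L" "z \<in> P" "v = s + r + l' + z"
    by (rule decompose)
  then show "B v l = 0"
    using assms pairing(3) by simp
qed

lemma eq_P_if_orth:
  assumes v: "v \<in> T" "\<And>w. w \<in> S \<union> R \<union> L \<Longrightarrow> B v w = 0"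
  shows "v \<in> P"
proof -
  obtain s r l z where d: "s \<in> S" "r \<in> R" "l \<in> L" "z \<in> P" "v = s + r + l + z"
    using decompose[OF v(1)] .
  have "s = 0"
    using v(2) pairing(1)[OF d(1-4)] d(5) by (intro S_eq_0 d) simp
  moreover have "r = 0"
    using v(2) pairing(3)[OF d(1-4)] d(5) sym[OF in_T(2)[OF d(2)] in_T(3)] by (intro R_eq_0 d) simp
  moreover have "l = 0"
    using v(2) pairing(2)[OF d(1-4)] d(5) sym[OF in_T(3)[OF d(3)] in_T(2)] by (intro L_eq_0 d) simp
  ultimately show ?thesis
    using d by simp
qed

lemma decomposition_unique:
  assumes d: "s \<in> S" "r \<in> R" "l \<in> L" "z \<in> P" and 0: "s + r + l + z = 0"
  shows "s = 0" "r = 0" "l = 0" "z = 0"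
proof -
  show s: "s = 0"
    using pairing(1)[OF d] zero_left[OF in_T(1)] 0 by (intro S_eq_0 d) simp
  show r: "r = 0"
    using pairing(3)[OF d] zero_left[OF in_T(3)] 0 sym[OF in_T(2)[OF d(2)] in_T(3)] by (intro R_eq_0 d) simp
  show l: "l = 0"
    using pairing(2)[OF d] zero_left[OF in_T(2)] 0 sym[OF in_T(3)[OF d(3)] in_T(2)] by (intro L_eq_0 d) simp
  show "z = 0"
    using 0 s r l by simp
qed

lemma component_tangent:
  assumes "s \<in> S" "r \<in> R" "l \<in> L" "z \<in> P"
  shows "component (S + R) (L + P) (s + r + l + z) = s + r"
proof (rule component_eqI[where c = "l + z"])
  show "subspace (S + R)" "subspace (L + P)"
    by (intro subspace_set_plus subspaces)+
  show "s + r + l + z = s + r + (l + z)" "s + r \<in> S + R" "l + z \<in> L + P"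
    using assms by (auto simp: add.assoc intro: set_plus_intro)
  fix v assume "v \<in> S + R" "v \<in> L + P"
  then obtain s r l z where *: "s \<in> S" "r \<in> R" "l \<in> L" "z \<in> P" "v = s + r" "v = l + z"
    by (auto elim!: set_plus_elim)
  then have "s + r + (- l) + (- z) = 0"
    by (simp add: algebra_simps)
  from decomposition_unique[OF *(1,2) subspace_neg[OF subspaces(3) *(3)] subspace_neg[OF subspaces(4) *(4)] this]
  show "v = 0"
    using *(5) by simp
qed

lemma component_screen_transversal:
  assumes "t \<in> S + R" "l \<in> L" "z \<in> P"
  shows "component P (S + R + L) (z + (t + l)) = z"
proof (rule component_eqI[where c = "t + l"])
  show "subspace P" "subspace (S + R + L)"
    by (intro subspace_set_plus subspaces)+
  show "t + l \<in> S + R + L"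
    using assms by (auto intro: set_plus_intro)
  fix v assume v: "v \<in> P" "v \<in> S + R + L"
  then obtain s r l where *: "s \<in> S" "r \<in> R" "l \<in> L" "v = s + r + l"
    by (auto elim!: set_plus_elim)
  then have "s + r + l + (- v) = 0"
    by simp
  from decomposition_unique(4)[OF *(1-3) subspace_neg[OF subspaces(4) v(1)] this]
  show "v = 0"
    by simp
qed (use assms in simp_all)

text \<open>The tangential part of \<open>v\<close> pairs with a tangent vector like \<open>v\<close> with its screen part.\<close>

lemma component_tangent_pairing:
  assumes v: "v \<in> T" and t: "s \<in> S" "r \<in> R"
  shows "B (component (S + R) (L + P) v) (s + r) = B v s"
proof -
  obtain s' r' l' z' where d: "s' \<in> S" "r' \<in> R" "l' \<in> L" "z' \<in> P" "v = s' + r' + l' + z'"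
    using decompose[OF v] .
  show ?thesis
    unfolding d(5) component_tangent[OF d(1-4)] pairing(1)[OF d(1-4) t(1)]
    using d t in_T by (simp add: add_left add_right subspace_add[OF T] orth orth')
qed

lemma J_add: "\<lbrakk>v \<in> T; w \<in> T\<rbrakk> \<Longrightarrow> J (v + w) = J v + J w"
  using J_lin[of v w 1 1] by simp

lemma J_scale: "v \<in> T \<Longrightarrow> J (a *\<^sub>R v) = a *\<^sub>R J v"
  using J_lin[of v v a 0] by simp

lemma subspace_J_image:
  assumes "subspace A" "A \<subseteq> T"
  shows "subspace (J ` A)"
  unfolding subspace_def
proof (intro conjI ballI allI)
  have "J 0 = 0"
    using J_scale[OF subspace_0[OF T], of 0] by simp
  then show "0 \<in> J ` A"
    using subspace_0[OF assms(1)] by (metis imageI)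
  fix u assume "u \<in> J ` A"
  then obtain u' where u: "u' \<in> A" "u = J u'"
    by blast
  show "a *\<^sub>R u \<in> J ` A" for a
    using J_scale[of u' a] u assms subspace_scale[OF assms(1)] by (metis imageI subsetD)
  fix v assume "v \<in> J ` A"
  then obtain v' where v: "v' \<in> A" "v = J v'"
    by blast
  show "u + v \<in> J ` A"
    using J_add[of u' v'] u v assms subspace_add[OF assms(1)] by (metis imageI subsetD)
qed

lemma J_product: "\<lbrakk>v \<in> T; w \<in> T\<rbrakk> \<Longrightarrow> B (J v) (J w) = p * B v (J w) + q * B v w"
  using J_sym[of v "J w"] J_in J_sq by (simp add: add_right scale_right subspace_scale[OF T])

lemma Do_D: "d \<in> Do \<Longrightarrow> d \<in> P" "\<lbrakk>d \<in> Do; v \<in> R \<union> L \<union> S\<rbrakk> \<Longrightarrow> B d (J v) = 0"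
  unfolding Do_def by blast+

text \<open>
  \<open>J d\<close> is orthogonal to \<open>S\<close>, \<open>R\<close> and \<open>L\<close>, hence in \<open>P\<close>, and \<open>J\<^sup>2 = p J + q\<close> makes it orthogonal to the images
  under \<open>J\<close>.
\<close>

lemma J_Do:
  assumes d: "d \<in> Do"
  shows "J d \<in> Do"
proof -
  have dT: "d \<in> T"
    by (rule in_T(4)[OF Do_D(1)[OF d]])
  have T': "v \<in> T" if "v \<in> R \<union> L \<union> S" for v
    using that in_T by blast
  have "J d \<in> P"
  proof (rule eq_P_if_orth[OF J_in[OF dT]])
    fix w assume w: "w \<in> S \<union> R \<union> L"
    then have "w \<in> R \<union> L \<union> S"
      by blast
    then show "B (J d) w = 0"
      using J_sym[OF dT T'] Do_D(2)[OF d] by simp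
  qed
  moreover have "B (J d) (J v) = 0" if v: "v \<in> R \<union> L \<union> S" for v
  proof -
    have "B d v = 0"
      using v Do_D(1)[OF d] orth(3,4) orth'(5) by blast
    then show ?thesis
      using J_product[OF dT T'[OF v]] Do_D(2)[OF d v] by simp
  qed
  ultimately show ?thesis
    unfolding Do_def by blast
qed

lemma subspace_Do: "subspace Do"
  unfolding subspace_def
proof (intro conjI ballI allI)
  have JT: "J v \<in> T" if "v \<in> R \<union> L \<union> S" for v
    using that J_in in_T by blast
  show "0 \<in> Do"
    unfolding Do_def using subspace_0[OF subspaces(4)] zero_left[OF JT] by blast
  fix u assume u: "u \<in> Do"
  show "a *\<^sub>R u \<in> Do" for a
    using subspace_scale[OF subspaces(4) Do_D(1)[OF u]] scale_left[OF in_T(4)[OF Do_D(1)[OF u]] JT] Do_D(2)[OF u]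
    by (simp add: Do_def)
  fix v assume v: "v \<in> Do"
  show "u + v \<in> Do"
    using subspace_add[OF subspaces(4) Do_D(1)[OF u] Do_D(1)[OF v]]
      add_left[OF in_T(4)[OF Do_D(1)[OF u]] in_T(4)[OF Do_D(1)[OF v]] JT] Do_D(2)[OF u] Do_D(2)[OF v]
    by (simp add: Do_def)
qed

text \<open>
  By \<open>B (J v) (J u) = p B v (J u) + q B v u\<close>, only the summand \<open>J s\<close> pairs with \<open>J S\<close>.
\<close>

lemma J_pairing:
  assumes "s \<in> S" "r \<in> R" "l \<in> L" "d \<in> Do" "u \<in> S"
  shows "B (J r + J l + J s + d) (J u) = q * B s u"
proof -
  note mem = in_T(1)[OF assms(1)] in_T(2)[OF assms(2)] in_T(3)[OF assms(3)]
    in_T(4)[OF Do_D(1)[OF assms(4)]] in_T(1)[OF assms(5)]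
  have Ju: "J u \<in> P"
    using J_sub assms(5) by blast
  have "B (J r + J l + J s + d) (J u) = B (J r) (J u) + B (J l) (J u) + B (J s) (J u) + B d (J u)"
    using mem by (simp add: add_left subspace_add[OF T] J_in)
  also have "\<dots> = q * B s u"
    using assms mem Ju by (simp add: J_product orth orth' Do_D(2))
  finally show ?thesis .
qed

lemma component_J_screen:
  assumes "s \<in> S" "r \<in> R" "l \<in> L" "d \<in> Do"
  shows "component (J ` S) (J ` R + J ` L + Do) (J r + J l + J s + d) = J s"
proof (rule component_eqI[where c = "J r + J l + d"])
  have sub: "S \<subseteq> T" "R \<subseteq> T" "L \<subseteq> T"
    using in_T by blast+
  show "subspace (J ` S)" "subspace (J ` R + J ` L + Do)"
    by (intro subspace_set_plus subspace_J_image subspaces subspace_Do sub)+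
  show "J r + J l + d \<in> J ` R + J ` L + Do"
    using assms by (intro set_plus_intro) auto
  fix v assume "v \<in> J ` S" "v \<in> J ` R + J ` L + Do"
  then obtain s r l d where *: "s \<in> S" "v = J s" "r \<in> R" "l \<in> L" "d \<in> Do" "v = J r + J l + d"
    by (auto elim!: set_plus_elim)
  have "s = 0"
  proof (rule S_eq_0[OF *(1)])
    fix u assume u: "u \<in> S"
    have J0: "J 0 = 0"
      using J_scale[OF subspace_0[OF T], of 0] by simp
    have "B (J s) (J u) = q * B s u"
      using J_pairing[OF *(1) subspace_0[OF subspaces(2)] subspace_0[OF subspaces(3)] subspace_0[OF subspace_Do] u]
      by (simp add: J0)
    moreover have "B (J r + J l + d) (J u) = 0"
      using J_pairing[OF subspace_0[OF subspaces(1)] *(3-5) u] zero_left[OF in_T(1)[OF u]] by (simp add: J0)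
    ultimately show "B s u = 0"
      using q *(2,6) by simp
  qed
  then show "v = 0"
    using *(2) J_scale[OF subspace_0[OF T], of 0] by simp
qed (use assms in \<open>simp_all add: algebra_simps\<close>)

lemma component_screen:
  assumes "s \<in> S" "s' \<in> S"
  shows "component S (J ` S) (s + J s') = s"
proof (rule component_eqI)
  show "subspace S" "subspace (J ` S)"
    using in_T(1) by (auto intro!: subspace_J_image subspaces)
  fix v assume v: "v \<in> S" "v \<in> J ` S"
  then show "v = 0"
    using J_sub(1) orth(3) by (intro S_eq_0) auto
qed (use assms in auto)

text \<open>
  If \<open>v\<close> is orthogonal to \<open>J S\<close>, then the \<open>S\<close>-component of \<open>J\<close> applied to the \<open>J S\<close>-component of the
  \<open>P\<close>-component of \<open>J v\<close> is \<open>q\<close> times the \<open>S\<close>-component of \<open>v\<close>.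
\<close>

lemma screen_component_eq_0_iff:
  assumes v: "v \<in> T" and vJ: "\<And>u. u \<in> S \<Longrightarrow> B v (J u) = 0"
  shows "component S (J ` S) (J (component (J ` S) (J ` R + J ` L + Do) (component P (S + R + L) (J v)))) = 0
    \<longleftrightarrow> (\<forall>u\<in>S. B v u = 0)"
proof -
  obtain s r l z where d: "s \<in> S" "r \<in> R" "l \<in> L" "z \<in> P" "v = s + r + l + z"
    using decompose[OF v] .
  have "z \<in> J ` R + J ` L + J ` S + Do"
    using d(4) P_sum unfolding Do_def by blast
  then obtain s' r' l' d' where z: "s' \<in> S" "r' \<in> R" "l' \<in> L" "d' \<in> Do" "z = J r' + J l' + J s' + d'"
    by (auto elim!: set_plus_elim)
  have mem: "s \<in> T" "r \<in> T" "l \<in> T" "z \<in> T" "s' \<in> T" "r' \<in> T" "l' \<in> T" "d' \<in> T"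
    using d z in_T Do_D(1) by blast+
  \<comment> \<open>only \<open>J s'\<close> pairs with \<open>J S\<close>\<close>
  have s': "s' = 0"
  proof (rule S_eq_0[OF z(1)])
    fix u assume u: "u \<in> S"
    then have "J u \<in> P"
      using J_sub by blast
    then have "B z (J u) = 0"
      using vJ[OF u] pairing(4)[OF d(1-4)] d(5) by simp
    then show "B s' u = 0"
      using J_pairing[OF z(1-4) u] z(5) q by simp
  qed
  have J0: "J 0 = 0"
    using J_scale[OF subspace_0[OF T], of 0] by simp
  have z': "z = J r' + J l' + d'"
    using z(5) s' J0 by simp
  \<comment> \<open>\<open>J rr\<close> and \<open>J ll\<close> absorb the terms \<open>p J r'\<close> and \<open>p J l'\<close> of \<open>J z\<close>\<close>
  define rr ll where "rr = r + p *\<^sub>R r'" and "ll = l + p *\<^sub>R l'"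
  have rl: "rr \<in> R" "ll \<in> L"
    unfolding rr_def ll_def using d z by (auto intro!: subspace_add subspace_scale subspaces)
  have J_rl: "J rr = J r + p *\<^sub>R J r'" "J ll = J l + p *\<^sub>R J l'"
    unfolding rr_def ll_def using mem by (simp_all add: J_add J_scale subspace_scale[OF T])
  have "J v = J s + J r + J l + J z"
    using mem d(5) by (simp add: J_add subspace_add[OF T])
  also have "J z = (p *\<^sub>R J r' + q *\<^sub>R r') + (p *\<^sub>R J l' + q *\<^sub>R l') + J d'"
    using mem by (simp add: z' J_add J_in subspace_add[OF T] J_sq)
  finally have Jv: "J v = (J rr + J ll + J s + J d') + (q *\<^sub>R r' + q *\<^sub>R l')"
    by (simp add: J_rl algebra_simps)
  have "J rr + J ll + J s + J d' \<in> P"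
    using J_sub rl d(1) Do_D(1)[OF J_Do[OF z(4)]]
    by (intro subspace_add[OF subspaces(4)]) auto
  moreover have "q *\<^sub>R r' \<in> S + R"
    using set_plus_intro[OF subspace_0[OF subspaces(1)] subspace_scale[OF subspaces(2) z(2), of q]] by simp
  ultimately have "component P (S + R + L) (J v) = J rr + J ll + J s + J d'"
    unfolding Jv by (intro component_screen_transversal subspace_scale[OF subspaces(3)] z)
  then have "component (J ` S) (J ` R + J ` L + Do) (component P (S + R + L) (J v)) = J s"
    using component_J_screen[OF d(1) rl J_Do[OF z(4)]] by simp
  moreover have "J (J s) = q *\<^sub>R s + J (p *\<^sub>R s)"
    using J_sq[OF mem(1)] J_scale[OF mem(1)] by simp
  moreover have "component S (J ` S) (q *\<^sub>R s + J (p *\<^sub>R s)) = q *\<^sub>R s"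
    by (intro component_screen subspace_scale subspaces d)
  ultimately have "component S (J ` S) (J (component (J ` S) (J ` R + J ` L + Do)
      (component P (S + R + L) (J v)))) = q *\<^sub>R s"
    by simp
  moreover have "(\<forall>u\<in>S. B v u = 0) \<longleftrightarrow> s = 0"
    using pairing(1)[OF d(1-4)] d(5) S_eq_0[OF d(1)] zero_left[OF in_T(1)] by auto
  ultimately show ?thesis
    using q by simp
qed

end

section \<open>Screen transversal anti-invariant lightlike submanifolds\<close>

lemma dir_deriv_eq_0:
  assumes N: "smooth_manifold N" and x: "x \<in> points N" and f: "\<And>y. y \<in> points N \<Longrightarrow> f y = 0"
  shows "dir_deriv N x w f = 0"
proof -
  have c: "chart_at N x \<in> atlas N" "x \<in> fst (chart_at N x)"
    using charts_atD[OF chart_at_in[OF N x]] .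
  have "((f \<circ> chart_inv (chart_at N x)) has_derivative (\<lambda>v. 0)) (at (snd (chart_at N x) x))"
  proof (rule has_derivative_transform_within_open[OF has_derivative_const[of 0] smooth_manifold_chart(2)[OF N c(1)]])
    show "snd (chart_at N x) x \<in> snd (chart_at N x) ` fst (chart_at N x)"
      using c(2) by simp
    show "0 = (f \<circ> chart_inv (chart_at N x)) u" if "u \<in> snd (chart_at N x) ` fst (chart_at N x)" for u
      using that f chart_subset_points[OF N c(1)] by (auto simp: chart_inv_chart[OF N c(1)])
  qed
  from dir_deriv_eq[OF this] show ?thesis .
qed

text \<open>
  The lightlike transversal space is spanned by the isotropic frame dual to a frame of the radical.
\<close>

lemma lightlike_transversal_isotropic:
  assumes g: "semi_riemannian M g" and NM: "points N \<subseteq> points M"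
    and rad: "subbundle N M (Rad N M g) r"
    and ltr: "lightlike_transversal_bundle N M g r S SP ltr" and x: "x \<in> points N"
    and l: "l \<in> ltr x" "l' \<in> ltr x"
  shows "g x l l' = 0"
proof -
  interpret symmetric_form "tangent_space M x" "g x"
    using semi_riemannian_form[OF g] x NM by blast
  obtain Q \<xi> where Q: "x \<in> Q" "local_frame N M (Rad N M g) r Q \<xi>"
    using rad x unfolding subbundle_def by blast
  have "\<forall>Q \<xi>. local_frame N M (Rad N M g) r Q \<xi> \<longrightarrow>
       (\<exists>\<eta>. local_frame N M ltr r Q \<eta> \<and>
          (\<forall>x\<in>Q. \<forall>i<r. \<forall>j<r.
             g x (\<xi> i x) (\<eta> j x) = (if i = j then 1 else 0) \<and> g x (\<eta> i x) (\<eta> j x) = 0))"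
    using ltr unfolding lightlike_transversal_bundle_def by (elim conjE)
  then obtain \<eta> where \<eta>: "local_frame N M ltr r Q \<eta>"
    and iso: "\<And>i j. \<lbrakk>i < r; j < r\<rbrakk> \<Longrightarrow> g x (\<eta> i x) (\<eta> j x) = 0"
    using Q by blast
  let ?E = "(\<lambda>i. \<eta> i x) ` {..<r}"
  have sp: "span ?E = ltr x"
    using \<eta> Q(1) by (simp add: local_frame_def)
  have E: "v \<in> tangent_space M x" if "v \<in> ?E" for v
  proof -
    from that obtain i where i: "i < r" "v = \<eta> i x"
      by blast
    then have "smooth_along N M Q (\<eta> i)"
      using \<eta> by (simp add: local_frame_def)
    then show ?thesis
      unfolding i(2) by (rule smooth_alongD(1)[OF _ Q(1)])
  qed
  obtain a a' where "l = (\<Sum>v\<in>?E. a v *\<^sub>R v)" "l' = (\<Sum>v\<in>?E. a' v *\<^sub>R v)"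
    using l unfolding sp[symmetric] by (auto simp: span_finite)
  then have "g x l l' = (\<Sum>v\<in>?E. \<Sum>v'\<in>?E. g x (a v *\<^sub>R v) (a' v' *\<^sub>R v'))"
    using sum_both[of ?E "\<lambda>v. a v *\<^sub>R v" ?E "\<lambda>v. a' v *\<^sub>R v"] E subspace_scale[OF T] by simp
  also have "\<dots> = 0"
  proof (intro sum.neutral ballI)
    fix v v' assume vv: "v \<in> ?E" "v' \<in> ?E"
    then have "g x v v' = 0"
      using iso by auto
    then show "g x (a v *\<^sub>R v) (a' v' *\<^sub>R v') = 0"
      using E[OF vv(1)] E[OF vv(2)] by (simp add: scale_left scale_right subspace_scale[OF T])
  qed
  finally show ?thesis .
qed

text \<open>
  A screen transversal anti-invariant lightlike submanifold \<open>N\<close> of a locally metallic manifold \<open>M\<close>.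
\<close>

locale anti_invariant_submanifold =
  fixes M :: "('a, 'e::euclidean_space) mfd" and N :: "('a, 'm::euclidean_space) mfd"
    and g :: "('a, 'e) metric" and J :: "('a, 'e) tensor11"
    and nabla :: "('a, 'e, 'e) conn" and D :: "('a, 'm, 'e) conn"
    and S SP ltr :: "'a \<Rightarrow> ('a, 'e) tvec set" and p q r :: nat
  assumes q_pos: "0 < q"
    and metallic: "metallic_semi_riemannian p q M g J"
    and lc: "levi_civita M g nabla"
    and loc_metallic: "locally_metallic M J nabla"
    and lightlike: "lightlike_submanifold N M g r"
    and pullback: "pullback_connection N M nabla D"
    and screen: "screen_distribution N M g r S"
    and screen_transversal: "screen_transversal_bundle N M g r SP"
    and ltr: "lightlike_transversal_bundle N M g r S SP ltr"
    and anti_invariant: "screen_transversal_anti_invariant N M g J S SP ltr"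
begin

abbreviation R where "R \<equiv> Rad N M g"

lemma inc: "smooth_inclusion N M"
  using lightlike unfolding lightlike_submanifold_def by (intro submanifold_imp_smooth_inclusion) simp

lemmas N = smooth_inclusion_manifold(1)[OF inc] and M = smooth_inclusion_manifold(2)[OF inc]
  and NM = smooth_inclusion_manifold(3)[OF inc]

lemma g: "semi_riemannian M g" and J: "tensor_field11 M J"
  using metallic by (simp_all add: metallic_semi_riemannian_def)

lemmas D = pullback_connectionD(1)[OF pullback]

lemma R_bundle: "subbundle N M R r"
  using lightlike by (simp add: lightlike_submanifold_def)

lemma S_bundle: "subbundle N M S (DIM('m) - r)"
  using screen by (simp add: screen_distribution_def)

lemma tan_bundle_eq: "x \<in> points N \<Longrightarrow> tan_bundle N M x = S x + R x"
  using screen by (simp add: screen_distribution_def)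

lemma metallic_point:
  assumes x: "x \<in> points N"
  shows "metallic_point (tangent_space M x) (g x) (J x) (real p) (real q) (S x) (R x) (ltr x) (SP x)"
proof -
  have xM: "x \<in> points M"
    using x NM by blast
  note scr = screen[unfolded screen_distribution_def]
    and st = screen_transversal[unfolded screen_transversal_bundle_def]
    and lt = ltr[unfolded lightlike_transversal_bundle_def]
    and ai = bspec[OF anti_invariant[unfolded screen_transversal_anti_invariant_def] x]
    and met = metallic[unfolded metallic_semi_riemannian_def]
  have sub: "subspace (S x)" "subspace (R x)" "subspace (ltr x)" "subspace (SP x)"
    using subbundle_subspace[OF S_bundle x] subbundle_subspace[OF R_bundle x]
      subbundle_subspace[OF conjunct1[OF lt] x] subbundle_subspace[OF conjunct1[OF st] x] .
  have normal: "SP x + R x = normal_bundle N M g x"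
    using st x by blast
  have S_tan: "s \<in> tan_bundle N M x" if "s \<in> S x" for s
    using set_plus_intro[OF that subspace_0[OF sub(2)]] tan_bundle_eq[OF x] by simp
  have SP_normal: "z \<in> normal_bundle N M g x" if "z \<in> SP x" for z
    using set_plus_intro[OF that subspace_0[OF sub(2)]] normal by simp
  have R_mem: "v \<in> tan_bundle N M x" "v \<in> normal_bundle N M g x" if "v \<in> R x" for v
    using that by (simp_all add: Rad_def)
  have perp: "g x v t = 0" if "v \<in> normal_bundle N M g x" "t \<in> tan_bundle N M x" for v t
    using that by (simp add: normal_bundle_def)
  interpret symmetric_form "tangent_space M x" "g x"
    by (rule semi_riemannian_form[OF g xM])
  show ?thesis
  proof
    show "0 < real q"
      using q_pos by simp
    show "J x v \<in> tangent_space M x" if "v \<in> tangent_space M x" for v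
      by (rule tensor_field11D(1)[OF J xM that])
    show "J x (a *\<^sub>R v + b *\<^sub>R w) = a *\<^sub>R J x v + b *\<^sub>R J x w"
      if "v \<in> tangent_space M x" "w \<in> tangent_space M x" for v w a b
      by (rule tensor_field11D(2)[OF J xM that])
    show "J x (J x v) = real p *\<^sub>R J x v + real q *\<^sub>R v" if "v \<in> tangent_space M x" for v
      using met xM that by blast
    show "g x (J x v) w = g x v (J x w)" if "v \<in> tangent_space M x" "w \<in> tangent_space M x" for v w
      using met xM that by blast
    show "nondegenerate_on (g x) (tangent_space M x)"
      using g xM unfolding semi_riemannian_def by blast
    show "nondegenerate_on (g x) (S x)"
      using scr x by blast
    show "S x + R x + ltr x + SP x = tangent_space M x"
      using lt x by blast
    show "g x v s = 0" if "v \<in> R x" "s \<in> S x" for v s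
      using perp R_mem S_tan that by blast
    show "g x v v' = 0" if "v \<in> R x" "v' \<in> R x" for v v'
      using perp R_mem that by blast
    show "g x z s = 0" if "z \<in> SP x" "s \<in> S x" for z s
      using perp SP_normal S_tan that by blast
    show "g x z v = 0" if "z \<in> SP x" "v \<in> R x" for z v
      using perp SP_normal R_mem that by blast
    show "g x l s = 0" if "l \<in> ltr x" "s \<in> S x" for l s
      using lt x that by blast
    show "g x l z = 0" if "l \<in> ltr x" "z \<in> SP x" for l z
      using lt x that by blast
    show "g x l l' = 0" if "l \<in> ltr x" "l' \<in> ltr x" for l l'
      by (rule lightlike_transversal_isotropic[OF g NM R_bundle ltr x that])
    show "J x ` S x \<subseteq> SP x" "J x ` R x \<subseteq> SP x" "J x ` ltr x \<subseteq> SP x"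
      using ai by blast+
    show "SP x = J x ` R x + J x ` ltr x + J x ` S x + {z \<in> SP x. \<forall>v\<in>R x \<union> ltr x \<union> S x. g x z (J x v) = 0}"
      using ai unfolding D_o_def by blast
  qed (rule sub)+
qed

lemma metric_compatible:
  assumes "x \<in> points N" "w \<in> tangent_space N x" "field_along N M X" "field_along N M Y"
  shows "dir_deriv N x w (\<lambda>y. g y (X y) (Y y)) = g x (D x w X) (Y x) + g x (X x) (D x w Y)"
proof -
  obtain \<beta> C where "ambient_frame N M x \<beta> C"
    using ambient_frame_exists[OF inc assms(1)] .
  then show ?thesis
    by (rule ambient_frame.metric_compatible[OF _ g lc pullback assms(2-4)])
qed

lemma J_parallel:
  assumes "x \<in> points N" "w \<in> tangent_space N x" "field_along N M X"
  shows "D x w (\<lambda>y. J y (X y)) = J x (D x w X)"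
proof -
  obtain \<beta> C where "ambient_frame N M x \<beta> C"
    using ambient_frame_exists[OF inc assms(1)] .
  then show ?thesis
    by (rule ambient_frame.tensor_parallel[OF _ J loc_metallic lc pullback assms(2,3)])
qed

lemma sectionsD:
  assumes "X \<in> sections N M E"
  shows "field_along N M X" "x \<in> points N \<Longrightarrow> X x \<in> E x"
  using assms by (simp_all add: sections_def)

lemma S_sections: "X \<in> sections N M S \<Longrightarrow> X \<in> sections N M (tan_bundle N M)"
  and R_sections: "X \<in> sections N M R \<Longrightarrow> X \<in> sections N M (tan_bundle N M)"
proof -
  show "X \<in> sections N M R \<Longrightarrow> X \<in> sections N M (tan_bundle N M)"
    by (simp add: sections_def Rad_def)
  assume X: "X \<in> sections N M S"
  have "X x \<in> tan_bundle N M x" if x: "x \<in> points N" for x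
    using set_plus_intro[OF sectionsD(2)[OF X x] subspace_0[OF subbundle_subspace[OF R_bundle x]]]
    by (simp add: tan_bundle_eq[OF x])
  then show "X \<in> sections N M (tan_bundle N M)"
    using sectionsD(1)[OF X] by (simp add: sections_def)
qed

lemma J_tangent_orth:
  assumes x: "x \<in> points N" and t: "t \<in> tan_bundle N M x" "t' \<in> tan_bundle N M x"
  shows "g x t (J x t') = 0"
proof -
  interpret metallic_point "tangent_space M x" "g x" "J x" "real p" "real q" "S x" "R x" "ltr x" "SP x"
    by (rule metallic_point[OF x])
  obtain s v s' v' where *: "s \<in> S x" "v \<in> R x" "t = s + v" "s' \<in> S x" "v' \<in> R x" "t' = s' + v'"
    using t unfolding tan_bundle_eq[OF x] by (auto elim!: set_plus_elim)
  have "J x t' \<in> SP x"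
    using * J_sub subspace_add[OF subspaces(4), of "J x s'" "J x v'"] in_T by (simp add: J_add image_subset_iff)
  then show ?thesis
    using * in_T by (simp add: add_left orth')
qed

text \<open>
  The form \<open>g (D\<^sub>X Y) (J Z)\<close> on the tangent bundle of \<open>N\<close> is antisymmetric in \<open>Y\<close> and \<open>Z\<close>, because \<open>J\<close> is
  self-adjoint and parallel and maps the tangent bundle to its orthogonal complement.
\<close>

lemma second_form_antisymmetric:
  assumes x: "x \<in> points N" and w: "w \<in> tangent_space N x"
    and Y: "Y \<in> sections N M (tan_bundle N M)" and Z: "Z \<in> sections N M (tan_bundle N M)"
  shows "g x (D x w Y) (J x (Z x)) = - g x (D x w Z) (J x (Y x))"
proof -
  interpret metallic_point "tangent_space M x" "g x" "J x" "real p" "real q" "S x" "R x" "ltr x" "SP x"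
    by (rule metallic_point[OF x])
  note Yf = sectionsD(1)[OF Y] and Zf = sectionsD(1)[OF Z]
  have JZ: "field_along N M (\<lambda>y. J y (Z y))"
    by (rule smooth_along_tensor[OF inc J _ Zf]) simp
  have "0 = dir_deriv N x w (\<lambda>y. g y (Y y) (J y (Z y)))"
    by (rule dir_deriv_eq_0[OF N x, symmetric]) (rule J_tangent_orth[OF _ sectionsD(2)[OF Y] sectionsD(2)[OF Z]])
  also have "\<dots> = g x (D x w Y) (J x (Z x)) + g x (Y x) (J x (D x w Z))"
    using metric_compatible[OF x w Yf JZ] J_parallel[OF x w Zf] by simp
  also have "g x (Y x) (J x (D x w Z)) = g x (D x w Z) (J x (Y x))"
    using J_sym[OF connection_in_tangent_space[OF D x w Zf] smooth_alongD(1)[OF Yf x]]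
      sym[OF smooth_alongD(1)[OF Yf x] J_in[OF connection_in_tangent_space[OF D x w Zf]]] by simp
  finally show ?thesis
    by simp
qed

text \<open>
  Since \<open>D\<close> is torsion free, this form is also symmetric in \<open>X\<close> and \<open>Y\<close>; hence it vanishes.
\<close>

lemma second_form_eq_0:
  assumes x: "x \<in> points N" and w: "w \<in> tangent_space N x"
    and Y: "Y \<in> sections N M (tan_bundle N M)" and u: "u \<in> tan_bundle N M x"
  shows "g x (D x w Y) (J x u) = 0"
proof -
  obtain \<beta> C where "ambient_frame N M x \<beta> C"
    using ambient_frame_exists[OF inc x] .
  then obtain ext where vf: "\<And>v. v \<in> tangent_space N x \<Longrightarrow> vector_field N (ext v)"
    and ext_x: "\<And>v. v \<in> tangent_space N x \<Longrightarrow> ext v x = v"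
    and tor: "\<And>v w. \<lbrakk>v \<in> tangent_space N x; w \<in> tangent_space N x\<rbrakk> \<Longrightarrow>
      D x v (\<lambda>y. push N M y (ext w y)) = D x w (\<lambda>y. push N M y (ext v y))"
    by (rule ambient_frame.torsion_free_extension[OF _ lc pullback]) blast
  define E where "E v = (\<lambda>y. push N M y (ext v y))" for v
  have E: "E v \<in> sections N M (tan_bundle N M)" if "v \<in> tangent_space N x" for v
    using field_along_push[OF inc vf[OF that]] smooth_alongD(1)[OF vf[OF that]]
    by (auto simp: sections_def E_def tan_bundle_def)
  have E_x: "E v x = push N M x v" if "v \<in> tangent_space N x" for v
    by (simp add: E_def ext_x[OF that])
  define C where "C a b d = g x (D x a (E b)) (J x (E d x))" for a b d
  have swap12: "C a b d = C b a d" if "a \<in> tangent_space N x" "b \<in> tangent_space N x" for a b d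
    using tor[OF that] by (simp add: C_def E_def)
  have swap23: "C a b d = - C a d b"
    if "a \<in> tangent_space N x" "b \<in> tangent_space N x" "d \<in> tangent_space N x" for a b d
    unfolding C_def by (rule second_form_antisymmetric[OF x that(1) E[OF that(2)] E[OF that(3)]])
  obtain y z where y: "y \<in> tangent_space N x" "Y x = push N M x y"
    and z: "z \<in> tangent_space N x" "u = push N M x z"
    using sectionsD(2)[OF Y x] u unfolding tan_bundle_def by blast
  \<comment> \<open>alternating the two rules returns to the start with the opposite sign\<close>
  have "C w z y = C z w y"
    by (rule swap12[OF w z(1)])
  also have "\<dots> = - C z y w"
    by (rule swap23[OF z(1) w y(1)])
  also have "C z y w = C y z w"
    by (rule swap12[OF z(1) y(1)])
  also have "C y z w = - C y w z"
    by (rule swap23[OF y(1) z(1) w])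
  also have "C y w z = C w y z"
    by (rule swap12[OF y(1) w])
  also have "C w y z = - C w z y"
    by (rule swap23[OF w y(1) z(1)])
  finally have "C w z y = 0"
    by simp
  moreover have "g x (D x w Y) (J x u) = - g x (D x w (E z)) (J x (Y x))"
    using second_form_antisymmetric[OF x w Y E[OF z(1)]] by (simp add: E_x[OF z(1)] z(2))
  ultimately show ?thesis
    by (simp add: C_def E_x[OF y(1)] y(2))
qed

lemma B2_eq_0_iff:
  assumes x: "x \<in> points N" and w: "w \<in> tangent_space N x" and \<xi>: "\<xi> \<in> sections N M R"
  shows "B2 N M g J S SP ltr x (screen_transversal_connection N M SP ltr D x w (\<lambda>y. J y (\<xi> y))) = 0
    \<longleftrightarrow> (\<forall>u\<in>S x. g x (D x w \<xi>) u = 0)"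
proof -
  interpret metallic_point "tangent_space M x" "g x" "J x" "real p" "real q" "S x" "R x" "ltr x" "SP x"
    by (rule metallic_point[OF x])
  have Do: "D_o N M g J S SP ltr x = Do"
    by (simp add: D_o_def Do_def)
  have S_tan: "u \<in> tan_bundle N M x" if "u \<in> S x" for u
    using set_plus_intro[OF that subspace_0[OF subspaces(2)]] by (simp add: tan_bundle_eq[OF x])
  show ?thesis
    unfolding B2_def T2_def screen_transversal_connection_def Do tan_bundle_eq[OF x]
      J_parallel[OF x w sectionsD(1)[OF \<xi>]]
    by (rule screen_component_eq_0_iff[OF connection_in_tangent_space[OF D x w sectionsD(1)[OF \<xi>]]
          second_form_eq_0[OF x w R_sections[OF \<xi>] S_tan]])
qed

text \<open>
  The induced metric only sees the screen components.
\<close>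

lemma induced_connection_pairing:
  assumes x: "x \<in> points N" and w: "w \<in> tangent_space N x"
    and U: "field_along N M U" and t: "s \<in> S x" "v \<in> R x"
  shows "g x (induced_connection N M SP ltr D x w U) (s + v) = g x (D x w U) s"
    and "g x (s + v) (induced_connection N M SP ltr D x w U) = g x (D x w U) s"
proof -
  interpret metallic_point "tangent_space M x" "g x" "J x" "real p" "real q" "S x" "R x" "ltr x" "SP x"
    by (rule metallic_point[OF x])
  note DU = connection_in_tangent_space[OF D x w U]
  show *: "g x (induced_connection N M SP ltr D x w U) (s + v) = g x (D x w U) s"
    unfolding induced_connection_def tan_bundle_eq[OF x] by (rule component_tangent_pairing[OF DU t])
  obtain s' v' l z where d: "s' \<in> S x" "v' \<in> R x" "l \<in> ltr x" "z \<in> SP x" "D x w U = s' + v' + l + z"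
    using decompose[OF DU] .
  have "induced_connection N M SP ltr D x w U = s' + v'"
    unfolding induced_connection_def tan_bundle_eq[OF x] d(5) by (rule component_tangent[OF d(1-4)])
  then have "induced_connection N M SP ltr D x w U \<in> tangent_space M x"
    using d in_T subspace_add[OF T] by simp
  then show "g x (s + v) (induced_connection N M SP ltr D x w U) = g x (D x w U) s"
    using * sym[of "s + v"] subspace_add[OF T in_T(1)[OF t(1)] in_T(2)[OF t(2)]] by simp
qed

lemma radical_orth:
  assumes U: "U \<in> sections N M (tan_bundle N M)" and \<xi>: "\<xi> \<in> sections N M R" and y: "y \<in> points N"
  shows "g y (U y) (\<xi> y) = 0"
proof -
  interpret metallic_point "tangent_space M y" "g y" "J y" "real p" "real q" "S y" "R y" "ltr y" "SP y"
    by (rule metallic_point[OF y])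
  obtain s v where "s \<in> S y" "v \<in> R y" "U y = s + v"
    using sectionsD(2)[OF U y] unfolding tan_bundle_eq[OF y] by (auto elim!: set_plus_elim)
  then show ?thesis
    using sectionsD(2)[OF \<xi> y] in_T by (simp add: add_left orth orth')
qed

text \<open>
  At a point the right-hand side depends on the value of \<open>U\<close> only.
\<close>

lemma radical_derivative:
  assumes U: "U \<in> sections N M (tan_bundle N M)" and \<xi>: "\<xi> \<in> sections N M R"
    and x: "x \<in> points N" and w: "w \<in> tangent_space N x"
  shows "g x (D x w U) (\<xi> x) = - g x (U x) (D x w \<xi>)"
  using metric_compatible[OF x w sectionsD(1)[OF U] sectionsD(1)[OF \<xi>]]
    dir_deriv_eq_0[OF N x radical_orth[OF U \<xi>], where w = w] by simp

text \<open>
  Compare the metric condition for \<open>\<xi>\<close> and a section of \<open>S\<close> with the orthogonality of \<open>R\<close> and \<open>S\<close>.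
\<close>

lemma radical_screen_derivative_if_metric:
  assumes metric: "metric_connection N M g (induced_connection N M SP ltr D)"
    and W: "vector_field N W" and \<xi>: "\<xi> \<in> sections N M R" and x: "x \<in> points N" and u: "u \<in> S x"
  shows "g x (D x (W x) \<xi>) u = 0"
proof -
  note w = smooth_alongD(1)[OF W x]
  interpret metallic_point "tangent_space M x" "g x" "J x" "real p" "real q" "S x" "R x" "ltr x" "SP x"
    by (rule metallic_point[OF x])
  obtain U where U: "U \<in> sections N M S" "U x = u"
    using subbundle_section_through[OF inc S_bundle x u] .
  note Ut = S_sections[OF U(1)]
  have "dir_deriv N x (W x) (\<lambda>y. g y (U y) (\<xi> y)) =
      g x (induced_connection N M SP ltr D x (W x) U) (\<xi> x) +
      g x (U x) (induced_connection N M SP ltr D x (W x) \<xi>)"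
    using metric W Ut R_sections[OF \<xi>] x unfolding metric_connection_def by blast
  moreover have "g x (induced_connection N M SP ltr D x (W x) U) (\<xi> x) = 0"
    using induced_connection_pairing(1)[OF x w sectionsD(1)[OF Ut] subspace_0[OF subspaces(1)] sectionsD(2)[OF \<xi> x]]
      zero_right[OF connection_in_tangent_space[OF D x w sectionsD(1)[OF Ut]]] by simp
  moreover have "g x (U x) (induced_connection N M SP ltr D x (W x) \<xi>) = g x (D x (W x) \<xi>) u"
    using induced_connection_pairing(2)[OF x w sectionsD(1)[OF \<xi>] u subspace_0[OF subspaces(2)]] U(2) by simp
  ultimately show ?thesis
    using dir_deriv_eq_0[OF N x radical_orth[OF Ut \<xi>], where w = "W x"] by simp
qed

text \<open>
  The defect of the induced connection at \<open>x\<close> reduces to \<open>g (D\<^sub>W \<xi>) \<zeta> + g \<xi> (D\<^sub>W \<zeta>)\<close> for sections \<open>\<xi>\<close> and \<open>\<zeta>\<close> of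
  \<open>R\<close> through the radical components of \<open>U x\<close> and \<open>V x\<close>; this is the derivative of \<open>g(\<xi>, \<zeta>) = 0\<close>.
\<close>

lemma metric_if_radical_screen_derivative:
  assumes rad: "\<And>W \<xi> x u. \<lbrakk>vector_field N W; \<xi> \<in> sections N M R; x \<in> points N; u \<in> S x\<rbrakk> \<Longrightarrow>
    g x (D x (W x) \<xi>) u = 0"
  shows "metric_connection N M g (induced_connection N M SP ltr D)"
  unfolding metric_connection_def
proof (intro allI impI ballI)
  fix W U V x
  assume W: "vector_field N W" and U: "U \<in> sections N M (tan_bundle N M)"
    and V: "V \<in> sections N M (tan_bundle N M)" and x: "x \<in> points N"
  note w = smooth_alongD(1)[OF W x]
  interpret metallic_point "tangent_space M x" "g x" "J x" "real p" "real q" "S x" "R x" "ltr x" "SP x"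
    by (rule metallic_point[OF x])
  obtain us ur vs vr where d: "us \<in> S x" "ur \<in> R x" "U x = us + ur" "vs \<in> S x" "vr \<in> R x" "V x = vs + vr"
    using sectionsD(2)[OF U x] sectionsD(2)[OF V x] unfolding tan_bundle_eq[OF x] by (auto elim!: set_plus_elim)
  obtain \<xi> where \<xi>: "\<xi> \<in> sections N M R" "\<xi> x = ur"
    using subbundle_section_through[OF inc R_bundle x d(2)] .
  obtain \<zeta> where \<zeta>: "\<zeta> \<in> sections N M R" "\<zeta> x = vr"
    using subbundle_section_through[OF inc R_bundle x d(5)] .
  let ?D = "D x (W x)"
  have mem: "?D U \<in> tangent_space M x" "?D V \<in> tangent_space M x" "?D \<xi> \<in> tangent_space M x"
      "?D \<zeta> \<in> tangent_space M x"
    using connection_in_tangent_space[OF D x w] sectionsD(1)[OF U] sectionsD(1)[OF V]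
      sectionsD(1)[OF \<xi>(1)] sectionsD(1)[OF \<zeta>(1)] by blast+
  note T' = in_T(1)[OF d(1)] in_T(2)[OF d(2)] in_T(1)[OF d(4)] in_T(2)[OF d(5)]
  have "g x (?D U) vr = - g x ur (?D \<zeta>)"
    using radical_derivative[OF U \<zeta>(1) x w] rad[OF W \<zeta>(1) x d(1)] d(3) \<zeta>(2) T' mem
    by (simp add: add_left sym[of us])
  moreover have "g x (?D V) ur = - g x vr (?D \<xi>)"
    using radical_derivative[OF V \<xi>(1) x w] rad[OF W \<xi>(1) x d(4)] d(6) \<xi>(2) T' mem
    by (simp add: add_left sym[of vs])
  moreover have "g x (?D \<xi>) vr = - g x ur (?D \<zeta>)"
    using radical_derivative[OF R_sections[OF \<xi>(1)] \<zeta>(1) x w] \<xi>(2) \<zeta>(2) by simp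
  ultimately have 0: "g x (?D U) vr + g x (?D V) ur = 0"
    using sym[OF T'(4) mem(3)] sym[OF T'(2) mem(4)] by simp
  have "dir_deriv N x (W x) (\<lambda>y. g y (U y) (V y)) = g x (?D U) (vs + vr) + g x (us + ur) (?D V)"
    using metric_compatible[OF x w sectionsD(1)[OF U] sectionsD(1)[OF V]] d(3,6) by simp
  also have "\<dots> = g x (?D U) vs + g x (?D V) us + (g x (?D U) vr + g x (?D V) ur)"
    using T' mem by (simp add: add_left add_right sym[of us] sym[of ur])
  also have "\<dots> = g x (induced_connection N M SP ltr D x (W x) U) (V x) +
      g x (U x) (induced_connection N M SP ltr D x (W x) V)"
    unfolding 0 d(3,6)
    using induced_connection_pairing(1)[OF x w sectionsD(1)[OF U] d(4,5)]
      induced_connection_pairing(2)[OF x w sectionsD(1)[OF V] d(1,2)] by simp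
  finally show "dir_deriv N x (W x) (\<lambda>y. g y (U y) (V y)) =
      g x (induced_connection N M SP ltr D x (W x) U) (V x) +
      g x (U x) (induced_connection N M SP ltr D x (W x) V)" .
qed

end

theorem theorem3p8:
  fixes M :: "('a, 'e::euclidean_space) mfd"
    and N :: "('a, 'm::euclidean_space) mfd"
    and g :: "('a, 'e) metric"
    and J :: "('a, 'e) tensor11"
    and nabla :: "('a, 'e, 'e) conn"
    and D :: "('a, 'm, 'e) conn"
    and S SP ltr :: "'a \<Rightarrow> ('a, 'e) tvec set"
    and p q r :: nat
  assumes "0 < p" and "0 < q"
    and "metallic_semi_riemannian p q M g J"
    and "levi_civita M g nabla"
    and "locally_metallic M J nabla"
    and "lightlike_submanifold N M g r"
    and "pullback_connection N M nabla D"
    and "screen_distribution N M g r S"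
    and "screen_transversal_bundle N M g r SP"
    and "lightlike_transversal_bundle N M g r S SP ltr"
    and "screen_transversal_anti_invariant N M g J S SP ltr"
  shows "metric_connection N M g (induced_connection N M SP ltr D) \<longleftrightarrow>
    (\<forall>W \<xi>. vector_field N W \<and> \<xi> \<in> sections N M (Rad N M g) \<longrightarrow>
       (\<forall>x\<in>points N.
          B2 N M g J S SP ltr x
            (screen_transversal_connection N M SP ltr D x (W x) (\<lambda>y. J y (\<xi> y))) = 0))"
proof -
  interpret anti_invariant_submanifold M N g J nabla D S SP ltr p q r
    by (rule anti_invariant_submanifold.intro[OF assms(2-11)])
  show ?thesis
  proof (intro iffI allI impI ballI)
    fix W \<xi> x
    assume metric: "metric_connection N M g (induced_connection N M SP ltr D)"
      and "vector_field N W \<and> \<xi> \<in> sections N M (Rad N M g)" and x: "x \<in> points N"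
    then have W: "vector_field N W" and \<xi>: "\<xi> \<in> sections N M (Rad N M g)"
      by simp_all
    show "B2 N M g J S SP ltr x
        (screen_transversal_connection N M SP ltr D x (W x) (\<lambda>y. J y (\<xi> y))) = 0"
      unfolding B2_eq_0_iff[OF x smooth_alongD(1)[OF W x] \<xi>]
      using radical_screen_derivative_if_metric[OF metric W \<xi> x] by blast
  next
    assume B: "\<forall>W \<xi>. vector_field N W \<and> \<xi> \<in> sections N M (Rad N M g) \<longrightarrow>
       (\<forall>x\<in>points N.
          B2 N M g J S SP ltr x
            (screen_transversal_connection N M SP ltr D x (W x) (\<lambda>y. J y (\<xi> y))) = 0)"
    show "metric_connection N M g (induced_connection N M SP ltr D)"
    proof (rule metric_if_radical_screen_derivative)
      fix W \<xi> x u
      assume W: "vector_field N W" and \<xi>: "\<xi> \<in> sections N M (Rad N M g)" and x: "x \<in> points N"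
        and u: "u \<in> S x"
      show "g x (D x (W x) \<xi>) u = 0"
        using B[rule_format, OF conjI[OF W \<xi>] x] u
        unfolding B2_eq_0_iff[OF x smooth_alongD(1)[OF W x] \<xi>] by blast
    qed
  qed
qed

end
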